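(* Let $\ell\ge 2$ be an integer and let $\mathcal A$ be the irreducible Coxeter arrangement of type $A_{\ell-1}$, i.e. the arrangement of the hyperplanes $\ker(x_i-x_j)$, $1\le i<j\le\ell$, in the $(\ell-1)$-dimensional space $\mathbb C^\ell/\mathbb C(1,\dots,1)$. Then, for all integers $m,q\ge1$, the multiarrangement $(\mathcal A;m,q)$ with defining polynomial $$Q(\mathcal A;m,q)=\prod_{2\le j\le\ell}(x_1-x_j)^{m+q}\prod_{2\le i<j\le\ell}(x_i-x_j)^m$$ is inductively free, with multiset of exponents (having $\ell-1$ elements) $$\exp(\mathcal A;m,q)=\left\{\tfrac{m\ell}{2}+q,\ldots,\tfrac{m\ell}{2}+q\right\}$$ when $m$ is even, and $$\exp(\mathcal A;m,q)=\left\{\tfrac{(m-1)\ell}{2}+1+q,\tfrac{(m-1)\ell}{2}+2+q,\ldots,\tfrac{(m-1)\ell}{2}+\ell-1+q\right\}$$ when $m$ is odd.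
   Context: **Type $A$ arrangement.** The forms $x_i-x_j$ on $\mathbb C^\ell$ vanish on the line $\mathbb C(1,\dots,1)$, hence are linear forms on the quotient $\mathbb C^\ell/\mathbb C(1,\dots,1)$. The multiarrangement $(\mathcal A;m,q)$ has multiplicity $m+q$ on $\ker(x_1-x_j)$ for $2\le j\le\ell$ and multiplicity $m$ on $\ker(x_i-x_j)$ for $2\le i<j\le\ell$. **Multiarrangements.** Let $V$ be an $n$-dimensional vector space over a field $\mathbb K$ (here $\mathbb K=\mathbb C$), and let $S=S(V^* )\cong\mathbb K[y_1,\dots,y_n]$. A multiarrangement $(\mathcal A,\nu)$ in $V$ is a finite set $\mathcal A$ of linear hyperplanes $H=\ker\alpha_H$ ($\alpha_H\in V^*$) together with a multiplicity $\nu:\mathcal A\to\mathbb Z_{\ge 0}$. It is regarded as the multiset in which $H$ occurs $\nu(H)$ times; hyperplanes of multiplicity $0$ are discarded. Its defining polynomial is $Q(\mathcal A,\nu)=\prod_{H}\alpha_H^{\nu(H)}$. $\Phi_n$ denotes the empty arrangement in an $n$-dimensional space. **Freeness and exponents.** $\mathrm{Der}(S)$ is the $S$-module of $\mathbb K$-derivations of $S$. A derivation $\theta=\sum f_i\,\partial/\partial y_i$ is homogeneous of polynomial degree $\mathrm{pdeg}\,\theta=p$ if each $f_i$ is $0$ or homogeneous of degree $p$. Put $$D(\mathcal A,\nu)=\{\theta\in\mathrm{Der}(S)\mid\theta(\alpha_H)\in\alpha_H^{\nu(H)}S\text{ for all }H\in\mathcal A\}.$$ $(\mathcal A,\nu)$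 is free if $D(\mathcal A,\nu)$ is a free $S$-module; it then has a homogeneous basis $\theta_1,\dots,\theta_n$, and the well-defined multiset $\{\mathrm{pdeg}\,\theta_1,\dots,\mathrm{pdeg}\,\theta_n\}$ is denoted $\exp(\mathcal A,\nu)$. In particular $\Phi_n$ is free with exponents $0$ ($n$ times). **Deletion and restriction.** Fix $H_0=\ker\alpha_0\in\mathcal A$ with $\nu(H_0)\ge1$. The deletion $(\mathcal A',\nu')$ is obtained by lowering the multiplicity of $H_0$ by one (removing $H_0$ if $\nu(H_0)=1$). The restriction is $(\mathcal A'',\nu^* )$, an arrangement in $H_0$ with $\mathcal A''=\{H\cap H_0\mid H\in\mathcal A\setminus\{H_0\}\}$ and with the Euler multiplicity $\nu^*$ defined as follows. For $Y\in\mathcal A''$ let $\mathcal A_Y=\{H\in\mathcal A\mid Y\subseteq H\}$ and $\nu_Y=\nu|_{\mathcal A_Y}$. Choose coordinates with $Y=\{y_1=y_2=0\}$. Then $D(\mathcal A_Y,\nu_Y)$ is free and (by Abe–Terao–Wakefield) has a homogeneous basis $\theta_Y,\psi_Y,\partial/\partial y_3,\dots,\partial/\partial y_n$ with $\theta_Y\notin\alpha_0\mathrm{Der}(S)$ and $\psi_Y\in\alpha_0\mathrm{Der}(S)$. Set $\nu^*(Y)=\mathrm{pdeg}\,\theta_Y$. **Inductive freeness.** The class of inductively free multiarrangements is the smallest class such that (i) it contains $\Phi_n$ for every $n\ge0$; (ii) $(\mathcal A,\nu)$ belongs to it whenever there is $H_0\in\mathcal A$ such that $(\mathcal A',\nu')$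 and $(\mathcal A'',\nu^* )$ (with respect to $H_0$) both belong to it and $\exp(\mathcal A'',\nu^* )\subseteq\exp(\mathcal A',\nu')$ as multisets. (Members of this class are free, by the Addition-Deletion Theorem of Abe–Terao–Wakefield, so exponents make sense.) *)

theory Defs
  imports "HOL-Analysis.Analysis" "HOL-Library.Function_Algebras" "HOL-Library.Multiset"
begin

text \<open>
  Every space \<open>V\<close> is a linear subspace of some \<open>complex ^ 'k\<close>, so that a hyperplane of \<open>V\<close>
  is again a space of the same kind and restrictions can be taken literally. As the field is
  infinite, \<open>S(V\<^sup>*)\<close> is the algebra of polynomial functions on \<open>V\<close>. A function on \<open>V\<close> is
  represented by its extension by \<open>0\<close> to \<open>complex ^ 'k\<close>, which makes equality of functions on
  \<open>V\<close> plain equality; sums and products of functions are the pointwise ones.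
\<close>

type_synonym 'k fn = "complex ^ 'k \<Rightarrow> complex"

definition const_on :: "(complex ^ 'k) set \<Rightarrow> complex \<Rightarrow> 'k fn" where
  "const_on V c = (\<lambda>x. if x \<in> V then c else 0)"

definition dual :: "(complex ^ 'k) set \<Rightarrow> 'k fn set" where
  "dual V = {\<alpha>. (\<forall>x\<in>V. \<forall>y\<in>V. \<alpha> (x + y) = \<alpha> x + \<alpha> y) \<and>
                (\<forall>c. \<forall>x\<in>V. \<alpha> (c *s x) = c * \<alpha> x) \<and>
                (\<forall>x. x \<notin> V \<longrightarrow> \<alpha> x = 0)}"

definition ker_on :: "(complex ^ 'k) set \<Rightarrow> 'k fn \<Rightarrow> (complex ^ 'k) set" where
  "ker_on V \<alpha> = {x \<in> V. \<alpha> x = 0}"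

inductive_set poly_ring :: "(complex ^ 'k) set \<Rightarrow> 'k fn set"
  for V :: "(complex ^ 'k) set"
where
  const: "const_on V c \<in> poly_ring V"
| linear: "\<alpha> \<in> dual V \<Longrightarrow> \<alpha> \<in> poly_ring V"
| add: "f \<in> poly_ring V \<Longrightarrow> g \<in> poly_ring V \<Longrightarrow> f + g \<in> poly_ring V"
| mult: "f \<in> poly_ring V \<Longrightarrow> g \<in> poly_ring V \<Longrightarrow> f * g \<in> poly_ring V"

text \<open>
  \<open>homogeneous V p f\<close>: \<open>f\<close> is zero or homogeneous of degree \<open>p\<close>, that is, \<open>f\<close> lies in the
  span of the \<open>p\<close>-fold products of linear forms.
\<close>

inductive homogeneous :: "(complex ^ 'k) set \<Rightarrow> nat \<Rightarrow> 'k fn \<Rightarrow> bool"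
  for V :: "(complex ^ 'k) set"
where
  const: "homogeneous V 0 (const_on V c)"
| mult: "\<alpha> \<in> dual V \<Longrightarrow> homogeneous V p f \<Longrightarrow> homogeneous V (Suc p) (\<alpha> * f)"
| add: "homogeneous V p f \<Longrightarrow> homogeneous V p g \<Longrightarrow> homogeneous V p (f + g)"

text \<open>
  Derivations are extended by \<open>0\<close> outside of the ring, again so that they can be compared
  by plain equality.
\<close>

definition Der :: "(complex ^ 'k) set \<Rightarrow> ('k fn \<Rightarrow> 'k fn) set" where
  "Der V = {\<theta>. (\<forall>f\<in>poly_ring V. \<theta> f \<in> poly_ring V) \<and>
               (\<forall>f\<in>poly_ring V. \<forall>g\<in>poly_ring V. \<theta> (f + g) = \<theta> f + \<theta> g) \<and>
               (\<forall>c. \<forall>f\<in>poly_ring V. \<theta> (const_on V c * f) = const_on V c * \<theta> f) \<and>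
               (\<forall>f\<in>poly_ring V. \<forall>g\<in>poly_ring V. \<theta> (f * g) = \<theta> f * g + f * \<theta> g) \<and>
               (\<forall>f. f \<notin> poly_ring V \<longrightarrow> \<theta> f = 0)}"

definition der_smult :: "'k fn \<Rightarrow> ('k fn \<Rightarrow> 'k fn) \<Rightarrow> ('k fn \<Rightarrow> 'k fn)" where
  "der_smult g \<theta> = (\<lambda>f. g * \<theta> f)"

text \<open>
  The coefficients of \<open>\<theta>\<close> in linear coordinates \<open>y\<^sub>i\<close> are the \<open>\<theta> y\<^sub>i\<close>, so they are all zero or
  homogeneous of degree \<open>p\<close> iff \<open>\<theta> \<alpha>\<close> is so for every linear form \<open>\<alpha>\<close>.
\<close>

definition has_pdeg :: "(complex ^ 'k) set \<Rightarrow> nat \<Rightarrow> ('k fn \<Rightarrow> 'k fn) \<Rightarrow> bool" where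
  "has_pdeg V p \<theta> \<longleftrightarrow> \<theta> \<in> Der V \<and> (\<forall>\<alpha>\<in>dual V. homogeneous V p (\<theta> \<alpha>))"

text \<open>
  A multiarrangement is the multiset in which each hyperplane \<open>H\<close> occurs \<open>\<nu>(H)\<close> times.
\<close>

definition multiarrangement ::
  "(complex ^ 'k) set \<Rightarrow> (complex ^ 'k) set multiset \<Rightarrow> bool" where
  "multiarrangement V A \<longleftrightarrow>
     vec.subspace V \<and> (\<forall>H\<in>#A. \<exists>\<alpha>\<in>dual V. \<alpha> \<noteq> 0 \<and> H = ker_on V \<alpha>)"

definition log_der ::
  "(complex ^ 'k) set \<Rightarrow> (complex ^ 'k) set multiset \<Rightarrow> ('k fn \<Rightarrow> 'k fn) set" where
  "log_der V A = {\<theta> \<in> Der V. \<forall>H\<in>#A. \<forall>\<alpha>\<in>dual V. ker_on V \<alpha> = H \<longrightarrow>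
                    (\<exists>g\<in>poly_ring V. \<theta> \<alpha> = \<alpha> ^ count A H * g)}"

definition module_basis ::
  "(complex ^ 'k) set \<Rightarrow> ('k fn \<Rightarrow> 'k fn) set \<Rightarrow> ('k fn \<Rightarrow> 'k fn) list \<Rightarrow> bool" where
  "module_basis V D \<theta>s \<longleftrightarrow>
     set \<theta>s \<subseteq> D \<and>
     (\<forall>\<theta>\<in>D. \<exists>g. (\<forall>i<length \<theta>s. g i \<in> poly_ring V) \<and>
        \<theta> = (\<Sum>i<length \<theta>s. der_smult (g i) (\<theta>s ! i))) \<and>
     (\<forall>g. (\<forall>i<length \<theta>s. g i \<in> poly_ring V) \<and>
        (\<Sum>i<length \<theta>s. der_smult (g i) (\<theta>s ! i)) = 0 \<longrightarrow> (\<forall>i<length \<theta>s. g i = 0))"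

text \<open>
  \<open>has_exponents V A E\<close>: the multiarrangement is free and \<open>E\<close> is its multiset of exponents.
\<close>

definition has_exponents ::
  "(complex ^ 'k) set \<Rightarrow> (complex ^ 'k) set multiset \<Rightarrow> nat multiset \<Rightarrow> bool" where
  "has_exponents V A E \<longleftrightarrow>
     (\<exists>\<theta>s ps. module_basis V (log_der V A) \<theta>s \<and> list_all2 (has_pdeg V) ps \<theta>s \<and> mset ps = E)"

definition coordinates :: "(complex ^ 'k) set \<Rightarrow> 'k fn list \<Rightarrow> bool" where
  "coordinates V ys \<longleftrightarrow>
     set ys \<subseteq> dual V \<and> bij_betw (\<lambda>x. map (\<lambda>y. y x) ys) V {cs. length cs = length ys}"

text \<open>
  \<open>\<delta>s\<close> is the list of the partial derivatives \<open>\<partial>/\<partial>y\<^sub>i\<close> for the coordinates \<open>ys\<close>.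
\<close>

definition partials ::
  "(complex ^ 'k) set \<Rightarrow> 'k fn list \<Rightarrow> ('k fn \<Rightarrow> 'k fn) list \<Rightarrow> bool" where
  "partials V ys \<delta>s \<longleftrightarrow>
     length \<delta>s = length ys \<and> set \<delta>s \<subseteq> Der V \<and>
     (\<forall>i<length ys. \<forall>j<length ys. (\<delta>s ! i) (ys ! j) = const_on V (if i = j then 1 else 0))"

definition localization ::
  "(complex ^ 'k) set multiset \<Rightarrow> (complex ^ 'k) set \<Rightarrow> (complex ^ 'k) set multiset" where
  "localization A Y = filter_mset (\<lambda>H. Y \<subseteq> H) A"

text \<open>
  The first two entries \<open>\<theta>\<close>, \<open>\<psi>\<close> of the basis below are the derivations written
  \<open>\<theta>\<^sub>Y\<close>, \<open>\<psi>\<^sub>Y\<close> by Abe, Terao and Wakefield; by their theorem such a basis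
  exists, and the degree of \<open>\<theta>\<close> does not depend on the choices made.
\<close>

definition euler_mult ::
  "(complex ^ 'k) set \<Rightarrow> (complex ^ 'k) set multiset \<Rightarrow> (complex ^ 'k) set \<Rightarrow>
   (complex ^ 'k) set \<Rightarrow> nat" where
  "euler_mult V A H0 Y = (THE d. \<exists>\<alpha>0 y1 y2 ys \<delta>1 \<delta>2 \<delta>s \<theta> \<psi>.
     \<alpha>0 \<in> dual V \<and> ker_on V \<alpha>0 = H0 \<and>
     coordinates V (y1 # y2 # ys) \<and> Y = {x \<in> V. y1 x = 0 \<and> y2 x = 0} \<and>
     partials V (y1 # y2 # ys) (\<delta>1 # \<delta>2 # \<delta>s) \<and>
     module_basis V (log_der V (localization A Y)) (\<theta> # \<psi> # \<delta>s) \<and>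
     has_pdeg V d \<theta> \<and> (\<exists>p. has_pdeg V p \<psi>) \<and>
     \<theta> \<notin> der_smult \<alpha>0 ` Der V \<and> \<psi> \<in> der_smult \<alpha>0 ` Der V)"

definition deletion ::
  "(complex ^ 'k) set multiset \<Rightarrow> (complex ^ 'k) set \<Rightarrow> (complex ^ 'k) set multiset" where
  "deletion A H0 = A - {#H0#}"

definition restriction ::
  "(complex ^ 'k) set \<Rightarrow> (complex ^ 'k) set multiset \<Rightarrow> (complex ^ 'k) set \<Rightarrow>
   (complex ^ 'k) set multiset" where
  "restriction V A H0 =
     (\<Sum>Y\<in>(\<lambda>H. H \<inter> H0) ` (set_mset A - {H0}). replicate_mset (euler_mult V A H0 Y) Y)"

inductive inductively_free ::
  "(complex ^ 'k) set \<Rightarrow> (complex ^ 'k) set multiset \<Rightarrow> bool"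
where
  empty: "vec.subspace V \<Longrightarrow> inductively_free V {#}"
| step: "multiarrangement V A \<Longrightarrow> H0 \<in># A \<Longrightarrow>
     inductively_free V (deletion A H0) \<Longrightarrow> inductively_free H0 (restriction V A H0) \<Longrightarrow>
     has_exponents V (deletion A H0) E' \<Longrightarrow> has_exponents H0 (restriction V A H0) E'' \<Longrightarrow>
     E'' \<subseteq># E' \<Longrightarrow> inductively_free V A"

text \<open>
  The coordinates on \<open>\<complex>\<^sup>\<ell>\<close> are indexed by a type \<open>'l\<close> with \<open>\<ell>\<close> elements, one of which, \<open>i1\<close>,
  plays the role of the index \<open>1\<close>. A quotient of \<open>\<complex>\<^sup>\<ell>\<close> is given by a linear map \<open>\<pi>\<close>: it
  identifies \<open>range \<pi>\<close> with \<open>\<complex>\<^sup>\<ell>/ker \<pi>\<close>. If \<open>x\<^sub>i - x\<^sub>j\<close> vanishes on the kernel of \<open>\<pi>\<close>, the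
  kernel of the form that it induces on \<open>range \<pi>\<close> is the following set.
\<close>

definition hyp :: "(complex ^ 'l \<Rightarrow> complex ^ 'k) \<Rightarrow> 'l \<Rightarrow> 'l \<Rightarrow> (complex ^ 'k) set" where
  "hyp \<pi> i j = \<pi> ` {x. x $ i - x $ j = 0}"

definition type_A_mult ::
  "(complex ^ 'l \<Rightarrow> complex ^ 'k) \<Rightarrow> 'l \<Rightarrow> nat \<Rightarrow> nat \<Rightarrow> (complex ^ 'k) set multiset" where
  "type_A_mult \<pi> i1 m q =
     (\<Sum>H\<in>{hyp \<pi> i1 j | j. j \<noteq> i1}. replicate_mset (m + q) H) +
     (\<Sum>H\<in>{hyp \<pi> i j | i j. i \<noteq> i1 \<and> j \<noteq> i1 \<and> i \<noteq> j}. replicate_mset m H)"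

end

theory Submission
  imports Defs "HOL-Computational_Algebra.Polynomial"
begin

text \<open>
  The family of multiplicities \<open>n\<^sub>i + n\<^sub>j + [ij \<in> G]\<close> on the braid arrangement, with \<open>G\<close> a chordal
  graph, is closed under the restrictions and deletions that are needed, and it contains
  \<open>(\<A>; m, q)\<close> with \<open>G\<close> empty for even \<open>m\<close> and complete for odd \<open>m\<close>.
  Freeness is explicit. Let \<open>E\<^sub>b\<^sub>c\<close> be the integral of \<open>\<Prod>\<^sub>s (t - x\<^sub>s)\<^bsup>n s\<^esup>\<close> from \<open>x\<^sub>b\<close> to \<open>x\<^sub>c\<close>. It is
  \<open>(x\<^sub>c - x\<^sub>b)\<^bsup>n b + n c + 1\<^esup>\<close> times a factor that does not vanish on \<open>x\<^sub>b = x\<^sub>c\<close>. The derivations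
  \<open>\<theta>\<^sub>i : x\<^sub>c - x\<^sub>b \<mapsto> \<partial>\<^sub>i E\<^sub>b\<^sub>c\<close> generate the logarithmic derivations for \<open>G = \<emptyset>\<close>, their sum being
  the only relation, and \<open>\<Sum> c\<^sub>i \<theta>\<^sub>i\<close> is logarithmic for \<open>G\<close> iff \<open>c\<^sub>i \<equiv> c\<^sub>j\<close> modulo \<open>x\<^sub>i - x\<^sub>j\<close> for
  all edges \<open>ij\<close>. A perfect elimination order of \<open>G\<close> gives a triangular basis of these splines,
  and the exponents are \<open>\<Sum> n\<^sub>s\<close> plus the numbers of later neighbours.
\<close>

section \<open>Polynomial functions on a subspace\<close>

text \<open>The obstacle is that addition asks for the exponents of every deletion and restriction
  on the way, and lowering a single multiplicity at once leaves the multiplicities with only two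
  values. Cutting the edges of a graph one at a time keeps explicit bases available throughout. The
  hyperplane whose multiplicity is lowered is an edge vj, where v is the first vertex that has an
  edge. Vertices before v are isolated, so the order stays perfect after the cut, and every vertex
  other than v has the same later neighbours in the deletion and in the restriction. The sum of the
  \<open>n s\<close> is also the same for both. Hence the exponents of the restriction are those of
  the deletion with the one of v left out, and the inclusion needed for addition is immediate. That
  the derivations generate is an induction on the sum of the \<open>n s\<close>; its step is the
  spline criterion for a star, because raising \<open>n v\<close> by one asks for one more power
  exactly on the pairs that contain v.\<close>

lemma sum_fun_app: "(sum f A) x = (\<Sum>i\<in>A. f i x)"
  by (induction A rule: infinite_finite_induct) auto

lemma prod_fun_app: "(prod f A) x = (\<Prod>i\<in>A. f i x)"
  by (induction A rule: infinite_finite_induct) auto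

lemma power_fun_app: "((f :: 'a \<Rightarrow> 'b :: comm_semiring_1) ^ n) x = f x ^ n"
  by (induction n) auto

lemma uminus_fun_app: "(- (f :: 'a \<Rightarrow> 'b :: ab_group_add)) x = - f x"
  by (simp add: fun_Compl_def)

lemma minus_fun_app: "(f - g :: 'a \<Rightarrow> 'b :: ab_group_add) x = f x - g x"
  by (simp add: fun_diff_def)

lemmas fun_app = sum_fun_app prod_fun_app power_fun_app uminus_fun_app minus_fun_app
  plus_fun_apply zero_fun_apply times_fun_apply one_fun_apply

text \<open>Evaluation at a point is kept out of the simpset: identities are handled in the ring of
  functions, and \<open>fun_app\<close> evaluates only where points are wanted.\<close>

declare plus_fun_apply [simp del] zero_fun_apply [simp del] times_fun_apply [simp del]
  one_fun_apply [simp del]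

definition ext0 :: "(complex ^ 'k) set \<Rightarrow> 'k fn \<Rightarrow> 'k fn" where
  "ext0 V F = (\<lambda>x. if x \<in> V then F x else 0)"

text \<open>Elements of \<open>poly_ring V\<close> vanish off \<open>V\<close>, while lambda terms
  such as constants need not. \<open>polyfun\<close> and \<open>homfun\<close> look only at the
  values on \<open>V\<close>, so that closure can be proved along the shape of a term.\<close>

definition polyfun :: "(complex ^ 'k) set \<Rightarrow> 'k fn \<Rightarrow> bool" where
  "polyfun V F \<longleftrightarrow> ext0 V F \<in> poly_ring V"

definition homfun :: "(complex ^ 'k) set \<Rightarrow> nat \<Rightarrow> 'k fn \<Rightarrow> bool" where
  "homfun V p F \<longleftrightarrow> homogeneous V p (ext0 V F)"

definition pdvd :: "(complex ^ 'k) set \<Rightarrow> 'k fn \<Rightarrow> 'k fn \<Rightarrow> bool" where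
  "pdvd V f g \<longleftrightarrow> (\<exists>h\<in>poly_ring V. g = f * h)"

lemma dual_outside: "\<alpha> \<in> dual V \<Longrightarrow> x \<notin> V \<Longrightarrow> \<alpha> x = 0"
  and dual_add: "\<alpha> \<in> dual V \<Longrightarrow> x \<in> V \<Longrightarrow> y \<in> V \<Longrightarrow> \<alpha> (x + y) = \<alpha> x + \<alpha> y"
  and dual_scale: "\<alpha> \<in> dual V \<Longrightarrow> x \<in> V \<Longrightarrow> \<alpha> (c *s x) = c * \<alpha> x"
  by (auto simp: dual_def)

lemma const_on_outside: "x \<notin> V \<Longrightarrow> const_on V c x = 0"
  by (simp add: const_on_def)

lemma const_on_in [simp]: "x \<in> V \<Longrightarrow> const_on V c x = c"
  by (simp add: const_on_def)

lemma poly_ring_outside: "f \<in> poly_ring V \<Longrightarrow> x \<notin> V \<Longrightarrow> f x = 0"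
  by (induction rule: poly_ring.induct) (auto simp: const_on_outside dual_outside fun_app)

lemma poly_ring_eqI:
  assumes "f \<in> poly_ring V" "g \<in> poly_ring V" "\<And>x. x \<in> V \<Longrightarrow> f x = g x"
  shows "f = g"
  using assms poly_ring_outside by (metis ext)

lemma ext0_in [simp]: "x \<in> V \<Longrightarrow> ext0 V F x = F x"
  by (simp add: ext0_def)

lemma ext0_poly: "f \<in> poly_ring V \<Longrightarrow> ext0 V f = f"
  by (auto simp: ext0_def poly_ring_outside)

lemma ext0_dual: "f \<in> dual V \<Longrightarrow> ext0 V f = f"
  by (rule ext0_poly[OF poly_ring.linear])

lemma ext0_add: "ext0 V (\<lambda>x. F x + G x) = ext0 V F + ext0 V G"
  and ext0_mult: "ext0 V (\<lambda>x. F x * G x) = ext0 V F * ext0 V G"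
  and ext0_const: "ext0 V (\<lambda>x. c) = const_on V c"
  by (auto simp: ext0_def const_on_def fun_app)

lemma ext0_cong: "(\<And>x. x \<in> V \<Longrightarrow> F x = G x) \<Longrightarrow> ext0 V F = ext0 V G"
  by (auto simp: ext0_def)

lemma polyfun_poly: "f \<in> poly_ring V \<Longrightarrow> polyfun V f"
  by (simp add: polyfun_def ext0_poly)

lemma polyfun_dual: "f \<in> dual V \<Longrightarrow> polyfun V f"
  by (rule polyfun_poly[OF poly_ring.linear])

lemma polyfun_cong: "(\<And>x. x \<in> V \<Longrightarrow> F x = G x) \<Longrightarrow> polyfun V F \<longleftrightarrow> polyfun V G"
  unfolding polyfun_def by (metis ext0_cong)

lemma homfun_cong: "(\<And>x. x \<in> V \<Longrightarrow> F x = G x) \<Longrightarrow> homfun V p F \<longleftrightarrow> homfun V p G"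
  unfolding homfun_def by (metis ext0_cong)

lemma polyfun_const [simp]: "polyfun V (\<lambda>x. c)"
  by (simp add: polyfun_def ext0_const poly_ring.const)

lemma polyfun_add: "polyfun V F \<Longrightarrow> polyfun V G \<Longrightarrow> polyfun V (\<lambda>x. F x + G x)"
  and polyfun_mult: "polyfun V F \<Longrightarrow> polyfun V G \<Longrightarrow> polyfun V (\<lambda>x. F x * G x)"
  by (auto simp: polyfun_def ext0_add ext0_mult intro: poly_ring.intros)

lemma polyfun_uminus: "polyfun V F \<Longrightarrow> polyfun V (\<lambda>x. - F x)"
  using polyfun_mult[of V "\<lambda>x. -1" F] by simp

lemma polyfun_diff: "polyfun V F \<Longrightarrow> polyfun V G \<Longrightarrow> polyfun V (\<lambda>x. F x - G x)"
  using polyfun_add[of V F "\<lambda>x. - G x"] by (simp add: polyfun_uminus)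

lemma polyfun_sum: "(\<And>i. i \<in> A \<Longrightarrow> polyfun V (F i)) \<Longrightarrow> polyfun V (\<lambda>x. \<Sum>i\<in>A. F i x)"
  by (induction A rule: infinite_finite_induct) (auto intro: polyfun_add)

lemma polyfun_prod: "(\<And>i. i \<in> A \<Longrightarrow> polyfun V (F i)) \<Longrightarrow> polyfun V (\<lambda>x. \<Prod>i\<in>A. F i x)"
  by (induction A rule: infinite_finite_induct) (auto intro: polyfun_mult)

lemma polyfun_power: "polyfun V F \<Longrightarrow> polyfun V (\<lambda>x. F x ^ n)"
  by (induction n) (auto intro: polyfun_mult)

lemma polyfun_ext0: "polyfun V F \<Longrightarrow> ext0 V F \<in> poly_ring V"
  by (simp add: polyfun_def)

lemma poly_ring_of_polyfun:
  assumes "polyfun V f" "\<And>x. x \<notin> V \<Longrightarrow> f x = 0"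
  shows "f \<in> poly_ring V"
proof -
  have "ext0 V f = f" using assms(2) by (auto simp: ext0_def)
  then show ?thesis using assms(1) by (simp add: polyfun_def)
qed

lemma poly_ring_zero: "0 \<in> poly_ring V"
  and poly_ring_minus: "f \<in> poly_ring V \<Longrightarrow> g \<in> poly_ring V \<Longrightarrow> f - g \<in> poly_ring V"
  and poly_ring_uminus: "f \<in> poly_ring V \<Longrightarrow> - f \<in> poly_ring V"
  and poly_ring_pow_mult: "f \<in> poly_ring V \<Longrightarrow> g \<in> poly_ring V \<Longrightarrow> f ^ n * g \<in> poly_ring V"
  and poly_ring_sum: "(\<And>i. i \<in> A \<Longrightarrow> h i \<in> poly_ring V) \<Longrightarrow> (\<Sum>i\<in>A. h i) \<in> poly_ring V"
proof -
  show "0 \<in> poly_ring V"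
    by (rule poly_ring_of_polyfun) (auto simp: zero_fun_def)
  show "f - g \<in> poly_ring V" if "f \<in> poly_ring V" "g \<in> poly_ring V"
    using that by (intro poly_ring_of_polyfun)
      (auto simp: fun_diff_def poly_ring_outside intro: polyfun_diff polyfun_poly)
  show "- f \<in> poly_ring V" if "f \<in> poly_ring V"
    using that by (intro poly_ring_of_polyfun)
      (auto simp: fun_Compl_def poly_ring_outside intro: polyfun_uminus polyfun_poly)
  show "f ^ n * g \<in> poly_ring V" if "f \<in> poly_ring V" "g \<in> poly_ring V"
    using that by (intro poly_ring_of_polyfun)
      (auto simp: times_fun_def power_fun_app poly_ring_outside
        intro!: polyfun_mult polyfun_power intro: polyfun_poly)
  show "(\<Sum>i\<in>A. h i) \<in> poly_ring V" if "\<And>i. i \<in> A \<Longrightarrow> h i \<in> poly_ring V"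
  proof (rule poly_ring_of_polyfun)
    have "sum h A = (\<lambda>x. \<Sum>i\<in>A. h i x)" by (auto simp: sum_fun_app)
    then show "polyfun V (sum h A)" using that by (auto intro: polyfun_sum polyfun_poly)
    show "sum h A x = 0" if "x \<notin> V" for x
      unfolding sum_fun_app using \<open>\<And>i. i \<in> A \<Longrightarrow> h i \<in> poly_ring V\<close> poly_ring_outside that
      by (intro sum.neutral) blast
  qed
qed

lemma dual_zero: "0 \<in> dual V"
  by (auto simp: dual_def fun_app)

lemma homogeneous_poly_ring: "homogeneous V p f \<Longrightarrow> f \<in> poly_ring V"
  by (induction rule: homogeneous.induct) (auto intro: poly_ring.intros)

lemma homogeneous_zero: "homogeneous V p 0"
proof (induction p)
  case 0
  have "const_on V 0 = 0" by (auto simp: const_on_def fun_app)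
  then show ?case by (metis homogeneous.const)
next
  case (Suc p)
  then show ?case using homogeneous.mult[OF dual_zero Suc] by simp
qed

lemma homogeneous_const_mult: "homogeneous V p f \<Longrightarrow> homogeneous V p (const_on V c * f)"
proof (induction rule: homogeneous.induct)
  case (const d)
  have "const_on V c * const_on V d = const_on V (c * d)" by (auto simp: const_on_def fun_app)
  then show ?case by (metis homogeneous.const)
next
  case (mult \<alpha> p f)
  then show ?case using homogeneous.mult[of \<alpha> V p "const_on V c * f"]
    by (simp add: mult.left_commute)
next
  case (add p f g)
  then show ?case using homogeneous.add by (metis distrib_left)
qed

lemma homogeneous_times:
  "homogeneous V p f \<Longrightarrow> homogeneous V q g \<Longrightarrow> homogeneous V (p + q) (f * g)"
proof (induction rule: homogeneous.induct)
  case (const c)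
  then show ?case by (simp add: homogeneous_const_mult)
next
  case (mult \<alpha> p f)
  then show ?case using homogeneous.mult[of \<alpha> V "p + q" "f * g"] by (simp add: mult.assoc)
next
  case (add p f g)
  then show ?case by (simp add: distrib_right homogeneous.add)
qed

lemma homfun_hom: "homogeneous V p f \<Longrightarrow> homfun V p f"
  by (simp add: homfun_def ext0_poly homogeneous_poly_ring)

lemma homfun_dual: "f \<in> dual V \<Longrightarrow> homfun V 1 f"
proof -
  assume f: "f \<in> dual V"
  have "f * const_on V 1 = f" using dual_outside[OF f] by (auto simp: const_on_def fun_app)
  then show ?thesis using homogeneous.mult[OF f homogeneous.const[of V 1]]
    by (simp add: homfun_def ext0_dual[OF f])
qed

lemma homfun_const: "homfun V 0 (\<lambda>x. c)"
  by (simp add: homfun_def ext0_const homogeneous.const)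

lemma homfun_add: "homfun V p F \<Longrightarrow> homfun V p G \<Longrightarrow> homfun V p (\<lambda>x. F x + G x)"
  and homfun_mult: "homfun V p F \<Longrightarrow> homfun V q G \<Longrightarrow> homfun V (p + q) (\<lambda>x. F x * G x)"
  by (auto simp: homfun_def ext0_add ext0_mult intro: homogeneous.add homogeneous_times)

lemma homfun_cmult: "homfun V p F \<Longrightarrow> homfun V p (\<lambda>x. c * F x)"
  using homfun_mult[OF homfun_const, of V p F c] by simp

lemma homfun_diff: "homfun V p F \<Longrightarrow> homfun V p G \<Longrightarrow> homfun V p (\<lambda>x. F x - G x)"
  using homfun_add[of V p F "\<lambda>x. - 1 * G x"] homfun_cmult[of V p G "-1"] by simp

lemma homfun_power: "homfun V p F \<Longrightarrow> homfun V (n * p) (\<lambda>x. F x ^ n)"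
  by (induction n) (auto intro: homfun_mult homfun_const simp: add.commute)

lemma homfun_prod:
  "finite A \<Longrightarrow> (\<And>i. i \<in> A \<Longrightarrow> homfun V (d i) (F i)) \<Longrightarrow>
    homfun V (\<Sum>i\<in>A. d i) (\<lambda>x. \<Prod>i\<in>A. F i x)"
  by (induction A rule: finite_induct) (auto intro: homfun_mult homfun_const)

lemma homogeneous_of_homfun:
  assumes "homfun V p f" "\<And>x. x \<notin> V \<Longrightarrow> f x = 0"
  shows "homogeneous V p f"
proof -
  have "ext0 V f = f" using assms(2) by (auto simp: ext0_def)
  then show ?thesis using assms(1) by (simp add: homfun_def)
qed

lemma homogeneous_sum:
  "(\<And>i. i \<in> A \<Longrightarrow> homogeneous V p (h i)) \<Longrightarrow> homogeneous V p (\<Sum>i\<in>A. h i)"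
  by (induction A rule: infinite_finite_induct) (auto intro: homogeneous.add homogeneous_zero)

section \<open>Lines, vanishing and divisibility by linear forms on a subspace\<close>

locale poly_space =
  fixes V :: "(complex ^ 'k) set"
  assumes subspace_V: "vec.subspace V"
begin

lemma V_0 [simp]: "0 \<in> V" and V_add: "x \<in> V \<Longrightarrow> y \<in> V \<Longrightarrow> x + y \<in> V"
  and V_scale: "x \<in> V \<Longrightarrow> c *s x \<in> V"
  and V_diff: "x \<in> V \<Longrightarrow> y \<in> V \<Longrightarrow> x - y \<in> V"
  and V_sum: "(\<And>i. i \<in> A \<Longrightarrow> g i \<in> V) \<Longrightarrow> sum g A \<in> V"
  using subspace_V by (auto simp: vec.subspace_0 vec.subspace_add vec.subspace_scale
      vec.subspace_diff vec.subspace_sum)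

lemma dual_0: "\<alpha> \<in> dual V \<Longrightarrow> \<alpha> 0 = 0"
  using dual_scale[of \<alpha> V 0 0] by simp

lemma dual_diff_arg: "\<alpha> \<in> dual V \<Longrightarrow> x \<in> V \<Longrightarrow> y \<in> V \<Longrightarrow> \<alpha> (x - y) = \<alpha> x - \<alpha> y"
  using dual_add[of \<alpha> V "x - y" y] V_diff[of x y] by simp

lemma dual_sum_arg: "\<alpha> \<in> dual V \<Longrightarrow> (\<And>i. i \<in> A \<Longrightarrow> g i \<in> V) \<Longrightarrow> \<alpha> (sum g A) = (\<Sum>i\<in>A. \<alpha> (g i))"
  by (induction A rule: infinite_finite_induct) (auto simp: dual_0 dual_add V_sum)

lemma dual_diff: "\<alpha> \<in> dual V \<Longrightarrow> \<beta> \<in> dual V \<Longrightarrow> \<alpha> - \<beta> \<in> dual V"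
  by (auto simp: dual_def fun_app algebra_simps)

lemma ker_subspace: "\<alpha> \<in> dual V \<Longrightarrow> vec.subspace (ker_on V \<alpha>)"
  unfolding vec.subspace_def ker_on_def
  by (auto simp: dual_0 dual_add dual_scale V_add V_scale)

text \<open>Along lines everything is a univariate polynomial; primality, differentiability and the
  comparison of degrees all rest on this.\<close>

lemma poly_on_line:
  assumes "f \<in> poly_ring V" "x \<in> V" "e \<in> V"
  shows "\<exists>p. \<forall>t. f (x + t *s e) = poly p t"
  using assms(1)
proof (induction rule: poly_ring.induct)
  case (const c)
  then show ?case using assms by (intro exI[of _ "[:c:]"]) (auto simp: V_add V_scale)
next
  case (linear \<alpha>)
  then show ?case using assms
    by (intro exI[of _ "[:\<alpha> x, \<alpha> e:]"]) (auto simp: dual_add dual_scale V_scale)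
next
  case (add f g)
  then show ?case by (metis plus_fun_apply poly_add)
next
  case (mult f g)
  then show ?case by (metis times_fun_apply poly_mult)
qed

lemma homogeneous_scale: "homogeneous V p f \<Longrightarrow> x \<in> V \<Longrightarrow> f (t *s x) = t ^ p * f x"
  by (induction rule: homogeneous.induct)
    (auto simp: V_scale dual_scale algebra_simps fun_app)

text \<open>Restricting to the line through a point where \<open>f\<close> and one where \<open>g\<close> does not vanish.\<close>

lemma poly_ring_prime:
  assumes f: "f \<in> poly_ring V" and g: "g \<in> poly_ring V"
    and W: "vec.subspace W" "W \<subseteq> V"
    and x: "x \<in> W" "f x \<noteq> 0" and z: "z \<in> W" "g z \<noteq> 0"
  shows "\<exists>w\<in>W. f w * g w \<noteq> 0"
proof -
  have V: "x \<in> V" "z - x \<in> V" using W x z V_diff by auto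
  obtain p where p: "\<And>t. f (x + t *s (z - x)) = poly p t" using poly_on_line[OF f V] by auto
  obtain q where q: "\<And>t. g (x + t *s (z - x)) = poly q t" using poly_on_line[OF g V] by auto
  have "p \<noteq> 0" using p[of 0] x by auto
  moreover have "q \<noteq> 0" using q[of 1] z by auto
  ultimately have "p * q \<noteq> 0" by simp
  then obtain t where "poly (p * q) t \<noteq> 0"
    using poly_all_0_iff_0 by blast
  then have "f (x + t *s (z - x)) * g (x + t *s (z - x)) \<noteq> 0"
    unfolding p q by simp
  moreover have "x + t *s (z - x) \<in> W"
    using W x z by (simp add: vec.subspace_add vec.subspace_scale vec.subspace_diff)
  ultimately show ?thesis by blast
qed

text \<open>The case \<open>W = V\<close> of \<open>poly_ring_prime\<close>; the case where
  \<open>W\<close> is a kernel makes linear forms prime in \<open>pdvd_power_cancel\<close>.\<close>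

lemma poly_ring_domain:
  assumes "f \<in> poly_ring V" "g \<in> poly_ring V" "f * g = 0" "f \<noteq> 0"
  shows "g = 0"
proof (rule ccontr)
  assume "g \<noteq> 0"
  then obtain z where z: "g z \<noteq> 0" by (auto simp: fun_eq_iff fun_app)
  obtain x where x: "f x \<noteq> 0" using assms by (auto simp: fun_eq_iff fun_app)
  have "x \<in> V" "z \<in> V" using x z assms poly_ring_outside by blast+
  then obtain w where "f w * g w \<noteq> 0"
    using poly_ring_prime[OF assms(1,2) subspace_V _ _ x _ z] by blast
  then show False using assms(3) by (metis times_fun_apply zero_fun_apply)
qed

text \<open>Let \<open>\<alpha> e = 1\<close>, and let \<open>T f\<close> be \<open>f\<close>
  composed with the projection along \<open>e\<close> onto the kernel of \<alpha>. By induction on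
  the generation of the ring, the difference of \<open>f\<close> and \<open>T f\<close> is a
  multiple of \<alpha>; if \<open>f\<close> vanishes on the kernel, then \<open>T f\<close> is zero
  on \<open>V\<close>.\<close>

lemma pdvd_if_vanishes:
  assumes \<alpha>: "\<alpha> \<in> dual V" "\<alpha> \<noteq> 0" and f: "f \<in> poly_ring V"
    and van: "\<And>x. x \<in> V \<Longrightarrow> \<alpha> x = 0 \<Longrightarrow> f x = 0"
  shows "pdvd V \<alpha> f"
proof -
  obtain u where u: "\<alpha> u \<noteq> 0" using \<alpha> by (auto simp: fun_eq_iff fun_app)
  have uV: "u \<in> V" using u \<alpha> dual_outside by blast
  define e where "e = (1 / \<alpha> u) *s u"
  have e: "e \<in> V" "\<alpha> e = 1" using u uV by (auto simp: e_def V_scale dual_scale[OF \<alpha>(1)])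
  define T where "T g x = g (x - \<alpha> x *s e)" for g :: "complex ^ 'k \<Rightarrow> complex" and x
  have TV: "x - \<alpha> x *s e \<in> V" if "x \<in> V" for x using that e V_diff V_scale by blast
  have *: "polyfun V (T g) \<and> (\<exists>h\<in>poly_ring V. \<forall>x\<in>V. g x - T g x = \<alpha> x * h x)"
    if "g \<in> poly_ring V" for g
    using that
  proof (induction rule: poly_ring.induct)
    case (const c)
    have "polyfun V (T (const_on V c)) \<longleftrightarrow> polyfun V (\<lambda>x. c)"
      by (rule polyfun_cong) (auto simp: T_def TV)
    then have "polyfun V (T (const_on V c))" by simp
    moreover have "\<forall>x\<in>V. const_on V c x - T (const_on V c) x = \<alpha> x * 0 x"
      by (auto simp: T_def TV fun_app)
    ultimately show ?case using poly_ring_zero by blast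
  next
    case (linear \<beta>)
    have eq: "T \<beta> x = \<beta> x - \<alpha> x * \<beta> e" if "x \<in> V" for x
      using that e by (simp add: T_def dual_diff_arg[OF linear] V_scale dual_scale[OF linear])
    have "polyfun V (T \<beta>) \<longleftrightarrow> polyfun V (\<lambda>x. \<beta> x - \<alpha> x * \<beta> e)"
      by (rule polyfun_cong) (auto simp: eq)
    moreover have "polyfun V (\<lambda>x. \<beta> x - \<alpha> x * \<beta> e)"
      using linear \<alpha> by (intro polyfun_diff polyfun_mult polyfun_const polyfun_dual)
    ultimately show ?case
      by (auto simp: eq intro!: bexI[of _ "const_on V (\<beta> e)"] poly_ring.const)
  next
    case (add f g)
    obtain h k where "h \<in> poly_ring V" "\<forall>x\<in>V. f x - T f x = \<alpha> x * h x"
      "k \<in> poly_ring V" "\<forall>x\<in>V. g x - T g x = \<alpha> x * k x"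
      using add by auto
    moreover have "T (f + g) = (\<lambda>x. T f x + T g x)" by (auto simp: T_def fun_app)
    moreover have "h + k \<in> poly_ring V" using calculation poly_ring.add by blast
    moreover have "polyfun V (T (f + g))" using add polyfun_add calculation(5) by metis
    moreover have "(f + g) x - T (f + g) x = \<alpha> x * (h + k) x" if "x \<in> V" for x
      using calculation that by (auto simp: plus_fun_apply algebra_simps)
    ultimately show ?case by blast
  next
    case (mult f g)
    obtain h k where h: "h \<in> poly_ring V" "\<forall>x\<in>V. f x - T f x = \<alpha> x * h x"
      and k: "k \<in> poly_ring V" "\<forall>x\<in>V. g x - T g x = \<alpha> x * k x"
      using mult by auto
    have T: "T (f * g) = (\<lambda>x. T f x * T g x)" by (auto simp: T_def fun_app)
    have "f x * g x - T f x * T g x = \<alpha> x * ext0 V (\<lambda>x. f x * k x + h x * T g x) x"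
      if "x \<in> V" for x
    proof -
      have "f x * g x - T f x * T g x = f x * (g x - T g x) + (f x - T f x) * T g x"
        by (simp add: algebra_simps)
      then show ?thesis using that h k by (simp add: algebra_simps)
    qed
    moreover have "polyfun V (\<lambda>x. f x * k x + h x * T g x)"
      using h k mult by (intro polyfun_add polyfun_mult) (auto intro: polyfun_poly)
    moreover have "polyfun V (T (f * g))" unfolding T using mult polyfun_mult by blast
    moreover have "(f * g) x - T (f * g) x = f x * g x - T f x * T g x" for x
      unfolding T by (simp add: times_fun_apply)
    ultimately show ?case
      by (intro conjI bexI[of _ "ext0 V (\<lambda>x. f x * k x + h x * T g x)"] ballI)
        (simp_all only: polyfun_ext0)
  qed
  obtain h where h: "h \<in> poly_ring V" "\<forall>x\<in>V. f x - T f x = \<alpha> x * h x" using *[OF f] by auto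
  have "T f x = 0" if "x \<in> V" for x
    using that van[OF TV[OF that]] e \<alpha>
    by (simp add: T_def dual_diff_arg[OF \<alpha>(1)] V_scale dual_scale[OF \<alpha>(1)])
  then have "f = \<alpha> * h"
    using h f \<alpha> by (intro poly_ring_eqI[of f V]) (auto simp: fun_app intro: poly_ring.intros)
  then show ?thesis using h by (auto simp: pdvd_def)
qed

text \<open>The kernel of \<alpha> is a subspace, so two polynomials that are not identically zero
  on it have a product that is not identically zero on it. As \<open>g\<close> is such a polynomial,
  \<open>f\<close> has to vanish on the kernel, and one factor \<alpha> can be cancelled.\<close>

lemma pdvd_power_cancel:
  assumes \<alpha>: "\<alpha> \<in> dual V" and f: "f \<in> poly_ring V" and g: "g \<in> poly_ring V"
    and x: "x \<in> V" "\<alpha> x = 0" "g x \<noteq> 0" and \<alpha>0: "\<alpha> \<noteq> 0"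
    and dvd: "pdvd V (\<alpha> ^ n) (g * f)"
  shows "pdvd V (\<alpha> ^ n) f"
  using f dvd
proof (induction n arbitrary: f)
  case 0
  then show ?case by (metis mult_1 pdvd_def power_0)
next
  case (Suc n)
  obtain h where h: "h \<in> poly_ring V" "g * f = \<alpha> ^ Suc n * h"
    using Suc.prems by (auto simp: pdvd_def)
  have "f z = 0" if "z \<in> V" "\<alpha> z = 0" for z
  proof (rule ccontr)
    assume z: "f z \<noteq> 0"
    have "\<exists>w\<in>ker_on V \<alpha>. g w * f w \<noteq> 0"
      using z that x by (intro poly_ring_prime[OF g Suc.prems(1) ker_subspace[OF \<alpha>]])
        (auto simp: ker_on_def)
    then obtain w where w: "\<alpha> w = 0" "g w * f w \<noteq> 0" by (auto simp: ker_on_def)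
    have "(g * f) w = (\<alpha> ^ Suc n * h) w" using h by simp
    then show False using w by (simp add: fun_app)
  qed
  then obtain k where k: "k \<in> poly_ring V" "f = \<alpha> * k"
    using pdvd_if_vanishes[OF \<alpha> \<alpha>0 Suc.prems(1)] by (auto simp: pdvd_def)
  have \<alpha>P: "\<alpha> \<in> poly_ring V" using \<alpha> by (rule poly_ring.linear)
  have "\<alpha> * (g * k - \<alpha> ^ n * h) = 0" using h k by (simp add: algebra_simps)
  moreover have "g * k - \<alpha> ^ n * h \<in> poly_ring V"
    by (intro poly_ring_minus poly_ring.mult poly_ring_pow_mult \<alpha>P k(1) h(1) g)
  ultimately have "g * k - \<alpha> ^ n * h = 0"
    using poly_ring_domain[OF \<alpha>P _ _ \<alpha>0] by blast
  then have "g * k = \<alpha> ^ n * h" by simp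
  then have "pdvd V (\<alpha> ^ n) (g * k)" using h by (auto simp: pdvd_def)
  then have "pdvd V (\<alpha> ^ n) k" using Suc.IH k by blast
  then show ?case using k by (auto simp: pdvd_def mult.assoc)
qed

text \<open>\<open>log_der\<close> quantifies over all forms with a given kernel; this reduces the
  condition to one of them.\<close>

lemma ker_on_eq_scale:
  assumes \<alpha>: "\<alpha> \<in> dual V" "\<alpha> \<noteq> 0" and \<beta>: "\<beta> \<in> dual V" and eq: "ker_on V \<beta> = ker_on V \<alpha>"
  obtains c where "c \<noteq> 0" "\<beta> = const_on V c * \<alpha>"
proof -
  obtain u where u: "\<alpha> u \<noteq> 0" using \<alpha> by (auto simp: fun_eq_iff fun_app)
  have uV: "u \<in> V" using u \<alpha> dual_outside by blast
  define c where "c = \<beta> u / \<alpha> u"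
  have bu: "\<beta> u \<noteq> 0" using u uV eq by (auto simp: ker_on_def)
  have "\<beta> x = c * \<alpha> x" if x: "x \<in> V" for x
  proof -
    have V: "x - (\<alpha> x / \<alpha> u) *s u \<in> V" using x uV by (intro V_diff V_scale)
    have "\<alpha> (x - (\<alpha> x / \<alpha> u) *s u) = 0"
      using u x uV by (simp add: dual_diff_arg[OF \<alpha>(1)] V_scale dual_scale[OF \<alpha>(1)])
    then have "\<beta> (x - (\<alpha> x / \<alpha> u) *s u) = 0" using V eq by (auto simp: ker_on_def)
    then show ?thesis
      using u x uV by (simp add: dual_diff_arg[OF \<beta>] V_scale dual_scale[OF \<beta>] c_def)
  qed
  then have "\<beta> = const_on V c * \<alpha>"
    using \<alpha> \<beta> by (intro poly_ring_eqI[of \<beta> V]) (auto simp: fun_app intro: poly_ring.intros)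
  moreover have "c \<noteq> 0" using bu u by (simp add: c_def)
  ultimately show ?thesis using that by blast
qed

section \<open>Derivations\<close>

text \<open>The analytic derivative along a line does not depend on how a polynomial function is
  written, and it inherits linearity and the product rule from calculus.\<close>

definition pd :: "complex ^ 'k \<Rightarrow> 'k fn \<Rightarrow> 'k fn" where
  "pd e f = (if f \<in> poly_ring V
     then (\<lambda>x. if x \<in> V then deriv (\<lambda>t. f (x + t *s e)) 0 else 0) else 0)"

lemma has_field_derivative_pd:
  assumes f: "f \<in> poly_ring V" and x: "x \<in> V" and e: "e \<in> V"
  shows "((\<lambda>t. f (x + t *s e)) has_field_derivative pd e f x) (at 0)"
proof -
  obtain p where p: "\<And>t. f (x + t *s e) = poly p t" using poly_on_line[OF f x e] by auto
  have "((\<lambda>t. f (x + t *s e)) has_field_derivative poly (pderiv p) 0) (at 0)"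
    unfolding p by (rule poly_DERIV)
  then show ?thesis using f x by (simp add: pd_def DERIV_imp_deriv)
qed

lemma pd_eqI:
  assumes "f \<in> poly_ring V" "x \<in> V" "e \<in> V"
    "((\<lambda>t. f (x + t *s e)) has_field_derivative D) (at 0)"
  shows "pd e f x = D"
  using has_field_derivative_pd[OF assms(1-3)] assms(4) DERIV_unique by blast

lemma pd_outside: "x \<notin> V \<Longrightarrow> pd e f x = 0"
  by (simp add: pd_def fun_app)

lemma pd_const: "e \<in> V \<Longrightarrow> pd e (const_on V c) = 0"
proof
  fix x
  show "e \<in> V \<Longrightarrow> pd e (const_on V c) x = 0 x"
  proof (cases "x \<in> V")
    case True
    then show "e \<in> V \<Longrightarrow> pd e (const_on V c) x = 0 x"
      by (auto simp: V_add V_scale fun_app intro!: pd_eqI poly_ring.const)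
  qed (simp add: pd_outside fun_app)
qed

lemma pd_linear: "e \<in> V \<Longrightarrow> \<alpha> \<in> dual V \<Longrightarrow> pd e \<alpha> = const_on V (\<alpha> e)"
proof
  fix x
  assume *: "e \<in> V" "\<alpha> \<in> dual V"
  show "pd e \<alpha> x = const_on V (\<alpha> e) x"
  proof (cases "x \<in> V")
    case True
    have "((\<lambda>t. \<alpha> x + t * \<alpha> e) has_field_derivative \<alpha> e) (at 0)"
      by (auto intro!: derivative_eq_intros)
    then show ?thesis using * True
      by (auto simp: dual_add dual_scale V_scale intro!: pd_eqI poly_ring.linear)
  qed (simp add: pd_outside const_on_outside)
qed

lemma pd_add:
  assumes "e \<in> V" "f \<in> poly_ring V" "g \<in> poly_ring V"
  shows "pd e (f + g) = pd e f + pd e g"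
proof
  fix x
  show "pd e (f + g) x = (pd e f + pd e g) x"
  proof (cases "x \<in> V")
    case True
    show ?thesis using assms True
      by (auto simp: fun_app intro!: pd_eqI poly_ring.add derivative_eq_intros has_field_derivative_pd)
  qed (simp add: pd_outside fun_app)
qed

lemma pd_mult:
  assumes "e \<in> V" "f \<in> poly_ring V" "g \<in> poly_ring V"
  shows "pd e (f * g) = pd e f * g + f * pd e g"
proof
  fix x
  show "pd e (f * g) x = (pd e f * g + f * pd e g) x"
  proof (cases "x \<in> V")
    case True
    have "((\<lambda>t. f (x + t *s e) * g (x + t *s e)) has_field_derivative
        pd e f x * g (x + 0 *s e) + pd e g x * f (x + 0 *s e)) (at 0)"
      using assms True by (intro DERIV_mult has_field_derivative_pd)
    then show ?thesis using assms True
      by (auto intro!: pd_eqI poly_ring.mult simp: algebra_simps fun_app)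
  qed (simp add: pd_outside fun_app)
qed

lemma pd_poly:
  assumes "e \<in> V" "f \<in> poly_ring V"
  shows "pd e f \<in> poly_ring V"
  using assms(2)
proof (induction rule: poly_ring.induct)
  case (const c)
  then show ?case using assms by (simp add: pd_const poly_ring_zero)
next
  case (linear \<alpha>)
  then show ?case using assms by (simp add: pd_linear poly_ring.const)
next
  case (add f g)
  then show ?case using assms by (simp add: pd_add poly_ring.add)
next
  case (mult f g)
  then show ?case using assms by (simp add: pd_mult poly_ring.intros)
qed

text \<open>In degree 0 the subtraction truncates, and the induction step for a product
  \<open>\<alpha> * f\<close> with \<open>f\<close> of degree 0 needs
  \<open>\<alpha> * pd e f\<close> to have degree 0, which holds because it is zero. Hence the
  second conjunct.\<close>

lemma pd_homogeneous:
  assumes e: "e \<in> V" and f: "homogeneous V p f"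
  shows "homogeneous V (p - 1) (pd e f) \<and> (p = 0 \<longrightarrow> pd e f = 0)"
  using f
proof (induction rule: homogeneous.induct)
  case (const c)
  then show ?case using e by (simp add: pd_const homogeneous_zero)
next
  case (mult \<alpha> p f)
  have f: "f \<in> poly_ring V" using mult homogeneous_poly_ring by blast
  have "pd e (\<alpha> * f) = const_on V (\<alpha> e) * f + \<alpha> * pd e f"
    using mult f e by (simp add: pd_mult pd_linear poly_ring.linear)
  moreover have "homogeneous V p (\<alpha> * pd e f)"
  proof (cases p)
    case 0
    then show ?thesis using mult homogeneous_zero by simp
  next
    case (Suc r)
    then show ?thesis using mult homogeneous.mult by simp
  qed
  ultimately show ?case using mult homogeneous_const_mult homogeneous.add by fastforce
next
  case (add p f g)
  then have "f \<in> poly_ring V" "g \<in> poly_ring V" using homogeneous_poly_ring by blast+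
  then show ?case using add e by (auto simp: pd_add homogeneous.add)
qed

text \<open>The unit of \<open>poly_ring V\<close> is \<open>const_on V 1\<close>; the function
  \<open>1\<close> lies outside the ring unless \<open>V\<close> is the whole space. This is why
  factors \<open>const_on V 1\<close> accompany powers later on.\<close>

lemma const_mult_poly: "f \<in> poly_ring V \<Longrightarrow> const_on V 1 * f = f"
  by (rule poly_ring_eqI[of _ V]) (auto simp: fun_app intro: poly_ring.intros)

lemma pd_Der: "e \<in> V \<Longrightarrow> pd e \<in> Der V"
  by (auto simp: Der_def pd_poly pd_add pd_mult pd_const poly_ring.const)
    (auto simp: pd_def)

lemma DerD:
  assumes "\<theta> \<in> Der V"
  shows Der_poly: "f \<in> poly_ring V \<Longrightarrow> \<theta> f \<in> poly_ring V"
    and Der_add: "f \<in> poly_ring V \<Longrightarrow> g \<in> poly_ring V \<Longrightarrow> \<theta> (f + g) = \<theta> f + \<theta> g"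
    and Der_cmult: "f \<in> poly_ring V \<Longrightarrow> \<theta> (const_on V c * f) = const_on V c * \<theta> f"
    and Der_mult: "f \<in> poly_ring V \<Longrightarrow> g \<in> poly_ring V \<Longrightarrow> \<theta> (f * g) = \<theta> f * g + f * \<theta> g"
    and Der_outside: "f \<notin> poly_ring V \<Longrightarrow> \<theta> f = 0"
  using assms by (auto simp: Der_def)

lemma Der_const:
  assumes "\<theta> \<in> Der V"
  shows "\<theta> (const_on V c) = 0"
proof -
  have "\<theta> (const_on V 1 * const_on V 1) =
    \<theta> (const_on V 1) * const_on V 1 + const_on V 1 * \<theta> (const_on V 1)"
    using assms by (intro Der_mult poly_ring.const)
  moreover have "\<theta> (const_on V 1) * const_on V 1 = \<theta> (const_on V 1)"
    "const_on V 1 * \<theta> (const_on V 1) = \<theta> (const_on V 1)"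
    using const_mult_poly[OF Der_poly[OF assms poly_ring.const[of V 1]]] by (simp_all add: mult.commute)
  ultimately have "\<theta> (const_on V 1) = \<theta> (const_on V 1) + \<theta> (const_on V 1)"
    by (metis const_mult_poly poly_ring.const)
  then have "\<theta> (const_on V 1) = 0" by simp
  moreover have "const_on V c = const_on V c * const_on V 1" by (auto simp: const_on_def fun_app)
  ultimately show ?thesis using Der_cmult[OF assms poly_ring.const, of c 1] by simp
qed

lemma Der_zero: "0 \<in> Der V"
  by (auto simp: Der_def poly_ring_zero fun_app)

lemma Der_smult: "\<theta> \<in> Der V \<Longrightarrow> g \<in> poly_ring V \<Longrightarrow> der_smult g \<theta> \<in> Der V"
  by (auto simp: Der_def der_smult_def poly_ring.intros algebra_simps)

lemma Der_plus: "\<theta> \<in> Der V \<Longrightarrow> \<eta> \<in> Der V \<Longrightarrow> \<theta> + \<eta> \<in> Der V"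
  by (auto simp: Der_def poly_ring.intros algebra_simps fun_app)

lemma Der_sum: "(\<And>i. i \<in> A \<Longrightarrow> \<theta> i \<in> Der V) \<Longrightarrow> (\<Sum>i\<in>A. \<theta> i) \<in> Der V"
  by (induction A rule: infinite_finite_induct) (auto intro: Der_plus Der_zero)

lemma Der_diff:
  assumes "\<theta> \<in> Der V" "f \<in> poly_ring V" "g \<in> poly_ring V"
  shows "\<theta> (f - g) = \<theta> f - \<theta> g"
  using Der_add[OF assms(1), of "f - g" g] assms by (simp add: poly_ring_minus)

lemma Der_sum_arg:
  assumes "\<theta> \<in> Der V" "\<And>i. i \<in> A \<Longrightarrow> f i \<in> poly_ring V"
  shows "\<theta> (\<Sum>i\<in>A. f i) = (\<Sum>i\<in>A. \<theta> (f i))"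
  using assms(2)
proof (induction A rule: infinite_finite_induct)
  have "const_on V 0 = 0" by (auto simp: const_on_def fun_app)
  then have 0: "\<theta> 0 = 0" using Der_const[OF assms(1), of 0] by simp
  { case (infinite A) then show ?case using 0 by simp }
  { case empty then show ?case using 0 by simp }
  { case (insert x F)
    then show ?case by (simp add: Der_add[OF assms(1)] poly_ring_sum) }
qed

lemma Der_eqI:
  assumes "\<theta> \<in> Der V" "\<eta> \<in> Der V" "\<And>\<alpha>. \<alpha> \<in> dual V \<Longrightarrow> \<theta> \<alpha> = \<eta> \<alpha>"
  shows "\<theta> = \<eta>"
proof
  fix f
  show "\<theta> f = \<eta> f"
  proof (cases "f \<in> poly_ring V")
    case True
    then show ?thesis
    proof (induction rule: poly_ring.induct)
      case (const c) then show ?case using assms by (simp add: Der_const)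
    next
      case (linear \<alpha>) then show ?case using assms by simp
    next
      case (add f g) then show ?case using assms by (simp add: Der_add)
    next
      case (mult f g) then show ?case using assms by (simp add: Der_mult)
    qed
  next
    case False
    then show ?thesis using assms Der_outside by metis
  qed
qed

end

section \<open>Definite integrals of complex polynomials\<close>

text \<open>An antiderivative replaces the path integral; \<open>pint_eq\<close> shows that every
  antiderivative gives the same value.\<close>

definition pint :: "complex poly \<Rightarrow> complex \<Rightarrow> complex \<Rightarrow> complex" where
  "pint P u w = (let Q = (SOME Q. pderiv Q = P) in poly Q w - poly Q u)"

lemma pderiv_surj: "\<exists>Q. pderiv Q = (P :: complex poly)"
proof -
  have "\<exists>Q. pderiv Q = monom (c :: complex) n" for c n
    by (rule exI[of _ "monom (c / of_nat (Suc n)) (Suc n)"]) (simp add: pderiv_monom del: of_nat_Suc)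
  then obtain Q where Q: "\<And>c n. pderiv (Q c n) = monom (c :: complex) n" by metis
  have "pderiv (\<Sum>i\<le>degree P. Q (coeff P i) i) = (\<Sum>i\<le>degree P. pderiv (Q (coeff P i) i))"
    using sum_comp_morphism[of pderiv "\<lambda>i. Q (coeff P i) i" "{..degree P}"]
    by (simp add: pderiv_add comp_def)
  then show ?thesis by (metis (no_types, lifting) Q poly_as_sum_of_monoms sum.cong)
qed

lemma pint_eq:
  assumes "pderiv Q = P"
  shows "pint P u w = poly Q w - poly Q u"
proof -
  define R where "R = (SOME Q. pderiv Q = P)"
  have "pderiv R = P" unfolding R_def by (rule someI[of _ Q]) (rule assms)
  then have "pderiv (R - Q) = 0" using assms by (simp add: pderiv_diff)
  then obtain c where "R - Q = [:c:]" using pderiv_iszero by blast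
  then have "R = Q + [:c:]" by (simp add: algebra_simps)
  then show ?thesis by (simp add: pint_def R_def[symmetric])
qed

lemma pint_add: "pint (P + R) u w = pint P u w + pint R u w"
proof -
  obtain A B where "pderiv A = P" "pderiv B = R" using pderiv_surj by metis
  then show ?thesis by (simp add: pint_eq[of A P] pint_eq[of B R] pint_eq[of "A + B" "P + R"] pderiv_add)
qed

lemma pint_smult: "pint (smult c P) u w = c * pint P u w"
proof -
  obtain A where "pderiv A = P" using pderiv_surj by metis
  then show ?thesis
    by (simp add: pint_eq[of A P] pint_eq[of "smult c A" "smult c P"] pderiv_smult algebra_simps)
qed

lemma pint_minus: "pint (P - R) u w = pint P u w - pint R u w"
  using pint_add[of P "smult (-1) R" u w] pint_smult[of "-1" R u w] by simp

lemma pint_self [simp]: "pint P u u = 0"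
  by (simp add: pint_def)

lemma pint_trans: "pint P u v + pint P v w = pint P u w"
  by (simp add: pint_def Let_def)

lemma pint_1: "pint 1 u w = w - u"
  by (subst pint_eq[of "[:0, 1:]"]) (auto simp: pderiv_pCons one_pCons)

text \<open>Serves twice: to normalise the interval of integration to [0, 1], and to remove a common
  translation of all roots and end points.\<close>

lemma pint_pcompose: "c * pint (P \<circ>\<^sub>p [:h, c:]) u w = pint P (h + c * u) (h + c * w)"
proof -
  obtain A where A: "pderiv A = P" using pderiv_surj by metis
  have "pderiv (A \<circ>\<^sub>p [:h, c:]) = smult c (P \<circ>\<^sub>p [:h, c:])"
    by (simp add: pderiv_pcompose A pderiv_pCons)
  then have "pint (smult c (P \<circ>\<^sub>p [:h, c:])) u w = poly A (h + c * w) - poly A (h + c * u)"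
    by (subst pint_eq[of "A \<circ>\<^sub>p [:h, c:]"]) (auto simp: poly_pcompose algebra_simps)
  then show ?thesis using A by (simp add: pint_smult pint_eq[of A P])
qed

lemma pint_has_derivative:
  "((\<lambda>t. pint P u (w + k * t)) has_field_derivative k * poly P w) (at 0)"
proof -
  obtain A where A: "pderiv A = P" using pderiv_surj by metis
  have "((\<lambda>t. poly A (w + k * t) - poly A u) has_field_derivative poly (pderiv A) (w + k * 0) * k - 0) (at 0)"
    by (intro DERIV_diff DERIV_chain'[where g = "poly A" and f = "\<lambda>t. w + k * t"] poly_DERIV DERIV_const)
      (auto intro!: derivative_eq_intros)
  then show ?thesis using A by (simp add: pint_eq[of A P] mult.commute)
qed

text \<open>Differentiation under the integral sign, with a root and the upper limit moving
  together: a boundary term, and the integral of the differentiated integrand. One moving factor at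
  a time is split into its value at \<open>t = 0\<close> and a multiple of \<open>t\<close>; the
  arbitrary cofactor \<open>R\<close> takes up the fixed part.\<close>

lemma pint_moving_root:
  "((\<lambda>t. pint ([:- (p + t), 1:] ^ N * R) u (w + k * t)) has_field_derivative
     k * (poly ([:- p, 1:] ^ N * R) w) - of_nat N * pint ([:- p, 1:] ^ (N - 1) * R) u w) (at 0)"
proof (induction N arbitrary: R)
  case 0
  then show ?case using pint_has_derivative[of R u w k] by simp
next
  case (Suc N)
  have "[:- (p + t), 1:] ^ Suc N * R =
      [:- (p + t), 1:] ^ N * ([:- p, 1:] * R) - smult t ([:- (p + t), 1:] ^ N * R)" for t
  proof -
    have "[:- (p + t), 1:] = [:- p, 1:] - [:t:]" by simp
    then have "[:- (p + t), 1:] * R = [:- p, 1:] * R - smult t R"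
      by (simp only: left_diff_distrib) simp
    moreover have "[:- (p + t), 1:] ^ Suc N * R = [:- (p + t), 1:] ^ N * ([:- (p + t), 1:] * R)"
      by (simp only: power_Suc2 mult.assoc)
    ultimately show ?thesis by (simp only: right_diff_distrib mult_smult_right)
  qed
  then have eq: "pint ([:- (p + t), 1:] ^ Suc N * R) u (w + k * t) =
      pint ([:- (p + t), 1:] ^ N * ([:- p, 1:] * R)) u (w + k * t)
      - t * pint ([:- (p + t), 1:] ^ N * R) u (w + k * t)" for t
    by (simp only: pint_minus pint_smult)
  \<comment> \<open>For \<open>N = 0\<close> both sides are 0, whatever the truncated exponent
    gives.\<close>
  have N: "of_nat N * pint ([:- p, 1:] ^ (N - 1) * ([:- p, 1:] * R)) u w
      = of_nat N * pint ([:- p, 1:] ^ N * R) u w"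
    by (cases N) (simp_all add: algebra_simps power_Suc2 del: power_Suc)
  have "((\<lambda>t. pint ([:- (p + t), 1:] ^ Suc N * R) u (w + k * t)) has_field_derivative
     (k * (poly ([:- p, 1:] ^ N * ([:- p, 1:] * R)) w)
       - of_nat N * pint ([:- p, 1:] ^ (N - 1) * ([:- p, 1:] * R)) u w)
     - (1 * pint ([:- (p + 0), 1:] ^ N * R) u (w + k * 0)
       + (k * (poly ([:- p, 1:] ^ N * R) w) - of_nat N * pint ([:- p, 1:] ^ (N - 1) * R) u w) * 0))
     (at 0)"
    unfolding eq by (intro DERIV_diff DERIV_mult Suc.IH DERIV_ident)
  then show ?case
    unfolding N by (rule DERIV_cong) (simp add: algebra_simps)
qed

text \<open>Up to sign this is the Beta value p! q! / (p + q + 1)!. Integration by parts trades a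
  power of the second factor for one of the first, since t^(p+1) (t-1)^(q+1) vanishes at both
  ends.\<close>

lemma beta_nonzero: "pint ([:0, 1:] ^ p * [:- 1, 1:] ^ q) 0 1 \<noteq> 0"
proof (induction q arbitrary: p)
  case 0
  have "pint ([:0, 1:] ^ p) 0 1 = 1 / of_nat (Suc p)"
    by (subst pint_eq[of "smult (1 / of_nat (Suc p)) ([:0, 1:] ^ Suc p)"])
      (auto simp: pderiv_smult pderiv_power_Suc pderiv_pCons poly_power simp del: power_Suc of_nat_Suc)
  then show ?case by (simp del: of_nat_Suc)
next
  case (Suc q)
  let ?P = "[:0, 1:] ^ Suc p * [:- 1, 1:] ^ Suc q :: complex poly"
  have "pderiv ?P = smult (of_nat (Suc p)) ([:0, 1:] ^ p * [:- 1, 1:] ^ Suc q)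
      + smult (of_nat (Suc q)) ([:0, 1:] ^ Suc p * [:- 1, 1:] ^ q)"
    unfolding pderiv_mult pderiv_power_Suc
    by (simp add: pderiv_pCons algebra_simps del: power_Suc of_nat_Suc)
  then have "of_nat (Suc p) * pint ([:0, 1:] ^ p * [:- 1, 1:] ^ Suc q) 0 1
      + of_nat (Suc q) * pint ([:0, 1:] ^ Suc p * [:- 1, 1:] ^ q) 0 1 = poly ?P 1 - poly ?P 0"
    using pint_eq[of ?P "pderiv ?P" 0 1] by (simp only: pint_add pint_smult)
  also have "\<dots> = 0" by simp
  finally show ?case using Suc.IH[of "Suc p"] by (auto simp del: of_nat_Suc power_Suc)
qed

section \<open>Braid arrangements\<close>

definition bhyp :: "(complex ^ 'k) set \<Rightarrow> ('i \<Rightarrow> 'k fn) \<Rightarrow> 'i \<Rightarrow> 'i \<Rightarrow> (complex ^ 'k) set" where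
  "bhyp V a i j = {x \<in> V. a i x = a j x}"

text \<open>Multiplicity 0 stands for an absent hyperplane, so that \<mu> can be given by one
  formula on all pairs.\<close>

definition braid_arr ::
  "(complex ^ 'k) set \<Rightarrow> 'i set \<Rightarrow> ('i \<Rightarrow> 'k fn) \<Rightarrow> ('i \<Rightarrow> 'i \<Rightarrow> nat) \<Rightarrow>
   (complex ^ 'k) set multiset \<Rightarrow> bool" where
  "braid_arr V I a \<mu> A \<longleftrightarrow>
     (\<forall>i\<in>I. \<forall>j\<in>I. i \<noteq> j \<longrightarrow> count A (bhyp V a i j) = \<mu> i j) \<and>
     (\<forall>H\<in>#A. \<exists>i\<in>I. \<exists>j\<in>I. i \<noteq> j \<and> H = bhyp V a i j)"

text \<open>Only the differences of the \<open>a i\<close> matter. The additional coordinates \<open>y k\<close> are there for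
  localizations, where the arrangement is not essential.\<close>

locale braid = poly_space V for V :: "(complex ^ 'k) set" +
  fixes I :: "'i set" and a :: "'i \<Rightarrow> 'k fn" and K :: "'j set" and y :: "'j \<Rightarrow> 'k fn"
  assumes finI: "finite I" and finK: "finite K"
    and a_dual: "i \<in> I \<Longrightarrow> a i \<in> dual V" and y_dual: "k \<in> K \<Longrightarrow> y k \<in> dual V"
    and sep: "x \<in> V \<Longrightarrow> (\<And>i j. i \<in> I \<Longrightarrow> j \<in> I \<Longrightarrow> a i x = a j x) \<Longrightarrow>
      (\<And>k. k \<in> K \<Longrightarrow> y k x = 0) \<Longrightarrow> x = 0"
    and surj: "\<exists>x\<in>V. (\<forall>i\<in>I. \<forall>j\<in>I. a i x - a j x = c i - c j) \<and> (\<forall>k\<in>K. y k x = d k)"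
begin

definition L :: "'i \<Rightarrow> 'i \<Rightarrow> 'k fn" where "L b c = a c - a b"

text \<open>The class of the \<open>v\<close>-th unit vector modulo the all-one vector, with
  additional coordinates 0. The forms \<open>a i\<close> are meaningful only up to a common summand,
  so only differences are prescribed.\<close>

definition e :: "'i \<Rightarrow> complex ^ 'k" where
  "e v = (SOME x. x \<in> V \<and> (\<forall>i\<in>I. \<forall>j\<in>I. a i x - a j x = of_bool (i = v) - of_bool (j = v)) \<and>
     (\<forall>k\<in>K. y k x = 0))"

definition f :: "'j \<Rightarrow> complex ^ 'k" where
  "f l = (SOME x. x \<in> V \<and> (\<forall>i\<in>I. \<forall>j\<in>I. a i x = a j x) \<and> (\<forall>k\<in>K. y k x = of_bool (k = l)))"

lemma e_props: "e v \<in> V \<and> (\<forall>i\<in>I. \<forall>j\<in>I. a i (e v) - a j (e v) = of_bool (i = v) - of_bool (j = v)) \<and>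
     (\<forall>k\<in>K. y k (e v) = 0)"
  unfolding e_def by (rule someI_ex)
    (use surj[of "\<lambda>i. of_bool (i = v)" "\<lambda>_. 0"] in blast)

lemma f_props: "f l \<in> V \<and> (\<forall>i\<in>I. \<forall>j\<in>I. a i (f l) = a j (f l)) \<and> (\<forall>k\<in>K. y k (f l) = of_bool (k = l))"
  unfolding f_def by (rule someI_ex)
    (use surj[of "\<lambda>i. 0" "\<lambda>k. of_bool (k = l)"] in auto)

lemma e_V [simp]: "e v \<in> V" and y_e: "k \<in> K \<Longrightarrow> y k (e v) = 0"
  and f_V [simp]: "f l \<in> V" and y_f: "k \<in> K \<Longrightarrow> y k (f l) = of_bool (k = l)"
  using e_props f_props by auto

lemma L_app: "L b c x = a c x - a b x"
  by (simp add: L_def fun_app)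

lemma L_dual: "b \<in> I \<Longrightarrow> c \<in> I \<Longrightarrow> L b c \<in> dual V"
  by (simp add: L_def dual_diff a_dual)

lemma L_poly: "b \<in> I \<Longrightarrow> c \<in> I \<Longrightarrow> L b c \<in> poly_ring V"
  by (simp add: poly_ring.linear L_dual)

lemma L_e: "b \<in> I \<Longrightarrow> c \<in> I \<Longrightarrow> L b c (e v) = of_bool (c = v) - of_bool (b = v)"
  using e_props by (simp add: L_app)

lemma L_f: "b \<in> I \<Longrightarrow> c \<in> I \<Longrightarrow> L b c (f l) = 0"
  by (metis L_app eq_iff_diff_eq_0 f_props)

lemma L_nonzero: "b \<in> I \<Longrightarrow> c \<in> I \<Longrightarrow> b \<noteq> c \<Longrightarrow> L b c \<noteq> 0"
  using L_e[of b c c] by (auto simp: fun_app)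

text \<open>The labels \<open>c\<close> prescribe which coordinates coincide; inclusions between
  flats and nonvanishing of products are read off at such points.\<close>

lemma generic_point: "\<exists>x\<in>V. \<forall>i\<in>I. \<forall>j\<in>I. a i x = a j x \<longleftrightarrow> (c i :: nat) = c j"
proof -
  obtain x where x: "x \<in> V" "\<And>i j. i \<in> I \<Longrightarrow> j \<in> I \<Longrightarrow> a i x - a j x = of_nat (c i) - of_nat (c j)"
    using surj[of "\<lambda>i. of_nat (c i)" "\<lambda>_. 0"] by blast
  have "a i x = a j x \<longleftrightarrow> c i = c j" if "i \<in> I" "j \<in> I" for i j
    using x(2)[OF that] by (metis eq_iff_diff_eq_0 of_nat_eq_iff)
  then show ?thesis using x by blast
qed

text \<open>All labels are distinct except that \<open>b\<close> receives the one of
  \<open>c\<close>. For \<open>b = c\<close> the point lies on none of the hyperplanes.\<close>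

lemma generic_on:
  assumes "b \<in> I" "c \<in> I"
  shows "\<exists>x\<in>V. a b x = a c x \<and> (\<forall>i\<in>I. \<forall>j\<in>I. a i x = a j x \<longrightarrow> i = j \<or> {i, j} = {b, c})"
proof -
  obtain h :: "'i \<Rightarrow> nat" where h: "inj_on h I"
    using finite_imp_inj_to_nat_seg[OF finI] by blast
  obtain x where x: "x \<in> V" "\<forall>i\<in>I. \<forall>j\<in>I. a i x = a j x \<longleftrightarrow> (h(b := h c)) i = (h(b := h c)) j"
    using generic_point by blast
  have "a b x = a c x" using x assms by auto
  moreover have "i = j \<or> {i, j} = {b, c}" if "i \<in> I" "j \<in> I" "a i x = a j x" for i j
    using x(2) that assms h by (auto simp: inj_on_def split: if_splits)
  ultimately show ?thesis using x by blast
qed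

lemma bhyp_ker: "b \<in> I \<Longrightarrow> c \<in> I \<Longrightarrow> bhyp V a b c = ker_on V (L b c)"
  by (auto simp: bhyp_def ker_on_def L_app)

lemma bhyp_sym: "bhyp V a b c = bhyp V a c b"
  by (auto simp: bhyp_def)

lemma decompose:
  assumes "z \<in> I" "x \<in> V"
  shows "x = (\<Sum>i\<in>I. L z i x *s e i) + (\<Sum>k\<in>K. y k x *s f k)" (is "x = ?w")
proof -
  have w: "?w \<in> V" by (intro V_add V_sum V_scale) auto
  have ev: "\<alpha> ?w = (\<Sum>i\<in>I. L z i x * \<alpha> (e i)) + (\<Sum>k\<in>K. y k x * \<alpha> (f k))" if "\<alpha> \<in> dual V" for \<alpha>
  proof -
    have "\<alpha> ?w = \<alpha> (\<Sum>i\<in>I. L z i x *s e i) + \<alpha> (\<Sum>k\<in>K. y k x *s f k)"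
      by (intro dual_add[OF that] V_sum V_scale) auto
    also have "\<alpha> (\<Sum>i\<in>I. L z i x *s e i) = (\<Sum>i\<in>I. \<alpha> (L z i x *s e i))"
      by (intro dual_sum_arg[OF that] V_scale) auto
    also have "\<alpha> (\<Sum>k\<in>K. y k x *s f k) = (\<Sum>k\<in>K. \<alpha> (y k x *s f k))"
      by (intro dual_sum_arg[OF that] V_scale) auto
    finally show ?thesis by (simp add: dual_scale[OF that])
  qed
  have L: "L b c ?w = L b c x" if "b \<in> I" "c \<in> I" for b c
  proof -
    have "L b c ?w = (\<Sum>i\<in>I. L z i x * of_bool (c = i)) - (\<Sum>i\<in>I. L z i x * of_bool (b = i))"
      by (simp add: ev[OF L_dual[OF that]] L_e that L_f right_diff_distrib sum_subtractf)
    also have "\<dots> = L z c x - L z b x"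
      using that finI by (simp add: of_bool_def if_distrib cong: if_cong)
    finally show ?thesis by (simp add: L_app)
  qed
  have y: "y l ?w = y l x" if "l \<in> K" for l
    using that finK by (simp add: ev[OF y_dual] y_e y_f of_bool_def if_distrib cong: if_cong)
  have "x - ?w = 0"
  proof (rule sep)
    show "x - ?w \<in> V" using assms w V_diff by blast
    show "a i (x - ?w) = a j (x - ?w)" if "i \<in> I" "j \<in> I" for i j
    proof -
      have "L j i (x - ?w) = 0"
        using L[OF that(2,1)] assms w by (simp add: dual_diff_arg[OF L_dual[OF that(2,1)]])
      then show ?thesis by (simp add: L_app)
    qed
    show "y k (x - ?w) = 0" if "k \<in> K" for k
      using y[OF that] assms w by (simp add: dual_diff_arg[OF y_dual[OF that]])
  qed
  then show ?thesis by simp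
qed

lemma dual_decompose:
  assumes "z \<in> I" "\<alpha> \<in> dual V"
  shows "\<alpha> = (\<Sum>i\<in>I. const_on V (\<alpha> (e i)) * L z i) + (\<Sum>k\<in>K. const_on V (\<alpha> (f k)) * y k)"
proof (rule poly_ring_eqI[of _ V])
  show "\<alpha> \<in> poly_ring V" using assms by (simp add: poly_ring.linear)
  show "(\<Sum>i\<in>I. const_on V (\<alpha> (e i)) * L z i) + (\<Sum>k\<in>K. const_on V (\<alpha> (f k)) * y k) \<in> poly_ring V"
    using assms by (intro poly_ring.add poly_ring_sum poly_ring.mult poly_ring.const L_poly
        poly_ring.linear y_dual)
  fix x assume x: "x \<in> V"
  have "\<alpha> x = \<alpha> ((\<Sum>i\<in>I. L z i x *s e i) + (\<Sum>k\<in>K. y k x *s f k))"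
    using decompose[OF assms(1) x] by simp
  also have "\<dots> = \<alpha> (\<Sum>i\<in>I. L z i x *s e i) + \<alpha> (\<Sum>k\<in>K. y k x *s f k)"
    by (intro dual_add[OF assms(2)] V_sum V_scale) auto
  also have "\<alpha> (\<Sum>i\<in>I. L z i x *s e i) = (\<Sum>i\<in>I. \<alpha> (L z i x *s e i))"
    by (intro dual_sum_arg[OF assms(2)] V_scale) auto
  also have "\<alpha> (\<Sum>k\<in>K. y k x *s f k) = (\<Sum>k\<in>K. \<alpha> (y k x *s f k))"
    by (intro dual_sum_arg[OF assms(2)] V_scale) auto
  finally show "\<alpha> x = ((\<Sum>i\<in>I. const_on V (\<alpha> (e i)) * L z i) + (\<Sum>k\<in>K. const_on V (\<alpha> (f k)) * y k)) x"
    using x by (simp add: fun_app dual_scale[OF assms(2)] mult.commute)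
qed

lemma Der_dual_expand:
  assumes z: "z \<in> I" and \<alpha>: "\<alpha> \<in> dual V" and that: "\<xi> \<in> Der V"
  shows "\<xi> \<alpha> = (\<Sum>i\<in>I. const_on V (\<alpha> (e i)) * \<xi> (L z i)) + (\<Sum>k\<in>K. const_on V (\<alpha> (f k)) * \<xi> (y k))"
proof -
    have P1: "(\<Sum>i\<in>I. const_on V (\<alpha> (e i)) * L z i) \<in> poly_ring V"
      and P2: "(\<Sum>k\<in>K. const_on V (\<alpha> (f k)) * y k) \<in> poly_ring V"
      using z by (auto intro!: poly_ring_sum poly_ring.mult poly_ring.const L_poly
          intro: poly_ring.linear y_dual)
    have "\<xi> \<alpha> = \<xi> ((\<Sum>i\<in>I. const_on V (\<alpha> (e i)) * L z i) + (\<Sum>k\<in>K. const_on V (\<alpha> (f k)) * y k))"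
      using dual_decompose[OF z \<alpha>] by simp
    also have "\<dots> = \<xi> (\<Sum>i\<in>I. const_on V (\<alpha> (e i)) * L z i) + \<xi> (\<Sum>k\<in>K. const_on V (\<alpha> (f k)) * y k)"
      by (rule Der_add[OF that P1 P2])
    also have "\<xi> (\<Sum>i\<in>I. const_on V (\<alpha> (e i)) * L z i) = (\<Sum>i\<in>I. \<xi> (const_on V (\<alpha> (e i)) * L z i))"
      using z by (intro Der_sum_arg[OF that] poly_ring.mult poly_ring.const L_poly)
    also have "\<xi> (\<Sum>k\<in>K. const_on V (\<alpha> (f k)) * y k) = (\<Sum>k\<in>K. \<xi> (const_on V (\<alpha> (f k)) * y k))"
      by (intro Der_sum_arg[OF that] poly_ring.mult poly_ring.const poly_ring.linear y_dual)
    also have "(\<Sum>i\<in>I. \<xi> (const_on V (\<alpha> (e i)) * L z i)) = (\<Sum>i\<in>I. const_on V (\<alpha> (e i)) * \<xi> (L z i))"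
      using z by (intro sum.cong refl Der_cmult[OF that] L_poly)
    also have "(\<Sum>k\<in>K. \<xi> (const_on V (\<alpha> (f k)) * y k)) = (\<Sum>k\<in>K. const_on V (\<alpha> (f k)) * \<xi> (y k))"
      by (intro sum.cong refl Der_cmult[OF that] poly_ring.linear y_dual)
    finally show ?thesis .
qed

lemma Der_coord_eqI:
  assumes z: "z \<in> I" and \<theta>: "\<theta> \<in> Der V" and \<eta>: "\<eta> \<in> Der V"
    and L: "\<And>i. i \<in> I \<Longrightarrow> \<theta> (L z i) = \<eta> (L z i)" and y: "\<And>k. k \<in> K \<Longrightarrow> \<theta> (y k) = \<eta> (y k)"
  shows "\<theta> = \<eta>"
proof (rule Der_eqI[OF \<theta> \<eta>])
  fix \<alpha> assume \<alpha>: "\<alpha> \<in> dual V"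
  show "\<theta> \<alpha> = \<eta> \<alpha>"
    unfolding Der_dual_expand[OF z \<alpha> \<theta>] Der_dual_expand[OF z \<alpha> \<eta>] using L y by (simp cong: sum.cong)
qed

lemma has_pdegI:
  assumes z: "z \<in> I" and \<theta>: "\<theta> \<in> Der V" and L: "\<And>i. i \<in> I \<Longrightarrow> homogeneous V p (\<theta> (L z i))"
    and y: "\<And>k. k \<in> K \<Longrightarrow> homogeneous V p (\<theta> (y k))"
  shows "has_pdeg V p \<theta>"
  unfolding has_pdeg_def
proof (intro conjI ballI \<theta>)
  fix \<alpha> assume \<alpha>: "\<alpha> \<in> dual V"
  show "homogeneous V p (\<theta> \<alpha>)"
    unfolding Der_dual_expand[OF z \<alpha> \<theta>]
    by (intro homogeneous.add homogeneous_sum homogeneous_const_mult L y)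
qed

lemma L_trans: "L b c + L c d = L b d"
  by (auto simp: L_app fun_app)

lemma Der_L:
  assumes "\<theta> \<in> Der V" "z \<in> I" "b \<in> I" "c \<in> I"
  shows "\<theta> (L b c) = \<theta> (L z c) - \<theta> (L z b)"
  using Der_add[OF assms(1), of "L z b" "L b c"] assms by (simp add: L_trans L_poly)

definition mkder :: "('i \<Rightarrow> 'k fn) \<Rightarrow> 'k fn \<Rightarrow> 'k fn" where
  "mkder h = (\<Sum>i\<in>I. der_smult (h i) (pd (e i)))"

lemma mkder_Der: "(\<And>i. i \<in> I \<Longrightarrow> h i \<in> poly_ring V) \<Longrightarrow> mkder h \<in> Der V"
  unfolding mkder_def by (intro Der_sum Der_smult pd_Der) auto

lemma mkder_L:
  assumes "b \<in> I" "c \<in> I" "\<And>i. i \<in> I \<Longrightarrow> h i \<in> poly_ring V"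
  shows "mkder h (L b c) = h c - h b"
proof (rule poly_ring_eqI[of _ V])
  show "mkder h (L b c) \<in> poly_ring V" using assms by (intro Der_poly[OF mkder_Der] L_poly)
  show "h c - h b \<in> poly_ring V" using assms by (intro poly_ring_minus)
  fix x assume x: "x \<in> V"
  have "mkder h (L b c) x = (\<Sum>i\<in>I. h i x * (of_bool (c = i) - of_bool (b = i)))"
    using assms x by (simp add: mkder_def fun_app der_smult_def pd_linear L_dual L_e)
  also have "\<dots> = (h c - h b) x"
  proof -
    have "(\<Sum>i\<in>I. h i x * (of_bool (c = i) - of_bool (b = i))) =
        (\<Sum>i\<in>I. if c = i then h i x else 0) - (\<Sum>i\<in>I. if b = i then h i x else 0)"
      unfolding sum_subtractf [symmetric] by (intro sum.cong) auto
    then show ?thesis using assms finI by (simp add: fun_app)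
  qed
  finally show "mkder h (L b c) x = (h c - h b) x" .
qed

lemma mkder_y:
  assumes "k \<in> K" "\<And>i. i \<in> I \<Longrightarrow> h i \<in> poly_ring V"
  shows "mkder h (y k) = 0"
proof (rule poly_ring_eqI[of _ V])
  show "mkder h (y k) \<in> poly_ring V"
    using assms by (intro Der_poly[OF mkder_Der] poly_ring.linear[OF y_dual])
  fix x assume x: "x \<in> V"
  show "mkder h (y k) x = 0 x"
    using assms x by (simp add: mkder_def fun_app der_smult_def pd_linear y_dual y_e)
qed (rule poly_ring_zero)

text \<open>The unit vectors add up to the all-one vector, which is 0 in the quotient. This is the
  source of the relation among the universal derivations.\<close>

lemma sum_pd_e: "I \<noteq> {} \<Longrightarrow> (\<Sum>i\<in>I. pd (e i)) = 0"
proof -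
  assume "I \<noteq> {}"
  then obtain z where z: "z \<in> I" by auto
  show ?thesis
  proof (rule Der_coord_eqI[OF z])
    show "(\<Sum>i\<in>I. pd (e i)) (L z j) = 0 (L z j)" if j: "j \<in> I" for j
    proof
      fix x
      show "(\<Sum>i\<in>I. pd (e i)) (L z j) x = 0 (L z j) x"
        using z j finI by (cases "x \<in> V") (simp_all add: fun_app pd_linear L_dual L_e pd_outside
            sum_subtractf of_bool_def const_on_outside)
    qed
    show "(\<Sum>i\<in>I. pd (e i)) (y k) = 0 (y k)" if "k \<in> K" for k
    proof
      fix x
      show "(\<Sum>i\<in>I. pd (e i)) (y k) x = 0 (y k) x"
        using that by (cases "x \<in> V")
          (simp_all add: fun_app pd_linear y_dual y_e pd_outside const_on_outside)
    qed
  qed (auto intro!: Der_sum pd_Der Der_zero)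
qed

lemma log_der_iff:
  assumes A: "braid_arr V I a \<mu> A"
  shows "\<theta> \<in> log_der V A \<longleftrightarrow>
    \<theta> \<in> Der V \<and> (\<forall>b\<in>I. \<forall>c\<in>I. b \<noteq> c \<longrightarrow> pdvd V (L b c ^ \<mu> b c) (\<theta> (L b c)))"
    (is "_ \<longleftrightarrow> ?R")
proof
  assume \<theta>: "\<theta> \<in> log_der V A"
  have "pdvd V (L b c ^ \<mu> b c) (\<theta> (L b c))" if "b \<in> I" "c \<in> I" "b \<noteq> c" for b c
  proof (cases "\<mu> b c = 0")
    case True
    have "\<theta> (L b c) \<in> poly_ring V"
      using \<theta> that by (auto simp: log_der_def intro: Der_poly L_poly)
    then show ?thesis unfolding True pdvd_def by (metis mult_1 power_0)
  next
    case False
    have c: "count A (bhyp V a b c) = \<mu> b c" using A that by (simp add: braid_arr_def)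
    then have in_A: "bhyp V a b c \<in># A" using False by (metis count_eq_zero_iff)
    have "\<forall>\<alpha>\<in>dual V. ker_on V \<alpha> = bhyp V a b c \<longrightarrow> pdvd V (\<alpha> ^ \<mu> b c) (\<theta> \<alpha>)"
      using \<theta> in_A unfolding log_der_def pdvd_def c [symmetric] by blast
    then show ?thesis using L_dual[OF that(1,2)] bhyp_ker[OF that(1,2)] by auto
  qed
  then show ?R using \<theta> by (auto simp: log_der_def)
next
  assume R: ?R
  have "\<exists>g\<in>poly_ring V. \<theta> \<alpha> = \<alpha> ^ count A H * g"
    if H: "H \<in># A" and \<alpha>: "\<alpha> \<in> dual V" "ker_on V \<alpha> = H" for H \<alpha>
  proof -
    obtain b c where bc: "b \<in> I" "c \<in> I" "b \<noteq> c" "H = bhyp V a b c"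
      using A H by (auto simp: braid_arr_def)
    define m where "m = \<mu> b c"
    have m: "count A H = m" using A bc by (simp add: braid_arr_def m_def)
    obtain r where r: "r \<noteq> 0" "\<alpha> = const_on V r * L b c"
      using ker_on_eq_scale[OF L_dual[OF bc(1,2)] L_nonzero[OF bc(1-3)] \<alpha>(1)] \<alpha>(2) bc
      by (auto simp: bhyp_ker)
    obtain h where h: "h \<in> poly_ring V" "\<theta> (L b c) = L b c ^ m * h"
      using R bc by (auto simp: pdvd_def m_def)
    have "\<theta> \<alpha> = const_on V r * (L b c ^ m * h)"
      unfolding r(2) using R h(2) bc by (simp add: Der_cmult L_poly)
    \<comment> \<open>As \<alpha> is \<open>r\<close> times \<open>L b c\<close>, its power carries
      \<open>r ^ m\<close>, which the scalar \<open>r / r ^ m\<close> corrects.\<close>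
    also have "\<dots> = \<alpha> ^ m * (const_on V (r / r ^ m) * h)"
    proof (rule poly_ring_eqI[of _ V])
      show "const_on V r * (L b c ^ m * h) \<in> poly_ring V"
        using bc h by (intro poly_ring.mult poly_ring.const poly_ring_pow_mult L_poly)
      show "\<alpha> ^ m * (const_on V (r / r ^ m) * h) \<in> poly_ring V"
        using \<alpha> h by (intro poly_ring_pow_mult poly_ring.mult poly_ring.const) (auto intro: poly_ring.linear)
      show "(const_on V r * (L b c ^ m * h)) x = (\<alpha> ^ m * (const_on V (r / r ^ m) * h)) x"
        if "x \<in> V" for x
        using that r by (simp add: fun_app power_mult_distrib)
    qed
    finally show ?thesis unfolding m using h by (blast intro: poly_ring.intros)
  qed
  then show "\<theta> \<in> log_der V A" using R by (auto simp: log_der_def)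
qed

section \<open>The integrals\<close>

definition \<omega> :: "('i \<Rightarrow> nat) \<Rightarrow> complex ^ 'k \<Rightarrow> complex poly" where
  "\<omega> n x = (\<Prod>s\<in>I. [:- a s x, 1:] ^ n s)"

definition E :: "('i \<Rightarrow> nat) \<Rightarrow> 'i \<Rightarrow> 'i \<Rightarrow> 'k fn" where
  "E n b c = ext0 V (\<lambda>x. pint (\<omega> n x) (a b x) (a c x))"

text \<open>The substitution t = x_b + u (x_c - x_b) moves the integral \<open>E n b c\<close> to
  [0, 1]. The factors of \<open>b\<close> and \<open>c\<close> and the differential release
  \<open>n b + n c + 1\<close> powers of x_c - x_b; \<open>g\<close> is the integral that
  remains.\<close>

definition g :: "('i \<Rightarrow> nat) \<Rightarrow> 'i \<Rightarrow> 'i \<Rightarrow> 'k fn" where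
  "g n b c = ext0 V (\<lambda>x. pint ([:0, 1:] ^ n b * [:- 1, 1:] ^ n c *
     (\<Prod>s\<in>I - {b, c}. [:a b x - a s x, a c x - a b x:] ^ n s)) 0 1)"

lemma E_app: "x \<in> V \<Longrightarrow> E n b c x = pint (\<omega> n x) (a b x) (a c x)"
  and E_outside: "x \<notin> V \<Longrightarrow> E n b c x = 0"
  by (simp_all add: E_def ext0_def)

lemma E_trans: "E n b c + E n c d = E n b d"
proof
  fix x
  show "(E n b c + E n c d) x = E n b d x"
    by (cases "x \<in> V") (simp_all add: fun_app E_app E_outside pint_trans)
qed

lemma E_self: "E n b b = 0"
proof
  fix x
  show "E n b b x = 0 x" by (cases "x \<in> V") (simp_all add: fun_app E_app E_outside)
qed

lemma E_uminus: "E n b c = - E n c b"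
  using E_trans[of n b c b] by (simp add: E_self eq_neg_iff_add_eq_0)

lemma E_eq:
  assumes "b \<in> I" "c \<in> I" "b \<noteq> c"
  shows "E n b c = L b c ^ (n b + n c + 1) * g n b c"
proof
  fix x
  show "E n b c x = (L b c ^ (n b + n c + 1) * g n b c) x"
  proof (cases "x \<in> V")
    case True
    define u where "u = L b c x"
    have ac: "a c x = a b x + u" by (simp add: u_def L_app)
    have lin: "[:- a s x, 1:] \<circ>\<^sub>p [:a b x, u:] = [:a b x - a s x, u:]" for s
      by (simp add: pcompose_pCons)
    have pw: "(p ^ k) \<circ>\<^sub>p q = (p \<circ>\<^sub>p q) ^ k" for p q :: "complex poly" and k
      by (induction k) (auto simp: pcompose_mult pcompose_1)
    have "\<omega> n x \<circ>\<^sub>p [:a b x, u:] = (\<Prod>s\<in>I. [:a b x - a s x, u:] ^ n s)"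
      by (simp add: \<omega>_def pcompose_prod pw lin)
    also have "\<dots> = [:0, u:] ^ n b * ([:- u, u:] ^ n c * (\<Prod>s\<in>I - {b, c}. [:a b x - a s x, u:] ^ n s))"
      using assms finI ac
      by (simp add: prod.remove[of I b] prod.remove[of "I - {b}" c] Diff_insert2 [symmetric] insert_commute)
    also have "[:0, u:] = smult u [:0, 1:]" by simp
    also have "[:- u, u:] = smult u [:- 1, 1:]" by simp
    also have "(smult u [:0, 1:]) ^ n b * ((smult u [:- 1, 1:]) ^ n c *
         (\<Prod>s\<in>I - {b, c}. [:a b x - a s x, u:] ^ n s)) =
       smult (u ^ (n b + n c)) ([:0, 1:] ^ n b * [:- 1, 1:] ^ n c *
         (\<Prod>s\<in>I - {b, c}. [:a b x - a s x, u:] ^ n s))"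
      unfolding smult_power by (simp add: power_add mult_ac)
    also have "u = a c x - a b x" by (simp add: ac)
    finally have "\<omega> n x \<circ>\<^sub>p [:a b x, u:] = smult (u ^ (n b + n c)) ([:0, 1:] ^ n b * [:- 1, 1:] ^ n c *
       (\<Prod>s\<in>I - {b, c}. [:a b x - a s x, a c x - a b x:] ^ n s))"
      by (simp only: ac add_diff_cancel_left')
    moreover have "E n b c x = u * pint (\<omega> n x \<circ>\<^sub>p [:a b x, u:]) 0 1"
      using True by (simp add: E_app pint_pcompose ac)
    ultimately show ?thesis using True
      by (simp add: pint_smult g_def fun_app u_def)
  qed (simp add: E_outside g_def ext0_def fun_app)
qed

text \<open>Expand one linear factor at a time: its constant part comes out as a scalar, the other
  part as a scalar times the variable, which the arbitrary polynomial \<open>C\<close> takes up.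
  Each expansion contributes one degree.\<close>

lemma pint_prod_homfun:
  assumes "finite S" "\<And>s. s \<in> S \<Longrightarrow> homfun V 1 (\<alpha> s)" "homfun V 1 \<beta>"
  shows "homfun V (\<Sum>s\<in>S. n s) (\<lambda>x. pint (C * (\<Prod>s\<in>S. [:\<alpha> s x, \<beta> x:] ^ n s)) 0 1)"
  using assms(1,2)
proof (induction S arbitrary: C rule: finite_induct)
  case empty
  then show ?case by (simp add: homfun_const)
next
  case (insert r S)
  have "homfun V (m + (\<Sum>s\<in>S. n s))
      (\<lambda>x. pint (C * ([:\<alpha> r x, \<beta> x:] ^ m * (\<Prod>s\<in>S. [:\<alpha> s x, \<beta> x:] ^ n s))) 0 1)" for m C
  proof (induction m arbitrary: C)
    case 0
    then show ?case using insert by simp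
  next
    case (Suc m)
    let ?R = "\<lambda>x. [:\<alpha> r x, \<beta> x:] ^ m * (\<Prod>s\<in>S. [:\<alpha> s x, \<beta> x:] ^ n s)"
    have "C * ([:\<alpha> r x, \<beta> x:] ^ Suc m * (\<Prod>s\<in>S. [:\<alpha> s x, \<beta> x:] ^ n s)) =
        smult (\<alpha> r x) (C * ?R x) + smult (\<beta> x) (([:0, 1:] * C) * ?R x)" for x
    proof -
      have "[:\<alpha> r x, \<beta> x:] = smult (\<alpha> r x) 1 + smult (\<beta> x) [:0, 1:]" by (simp add: one_pCons)
      then show ?thesis unfolding power_Suc by (simp only:) (simp add: algebra_simps)
    qed
    then have "(\<lambda>x. pint (C * ([:\<alpha> r x, \<beta> x:] ^ Suc m * (\<Prod>s\<in>S. [:\<alpha> s x, \<beta> x:] ^ n s))) 0 1) =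
       (\<lambda>x. \<alpha> r x * pint (C * ?R x) 0 1 + \<beta> x * pint (([:0, 1:] * C) * ?R x) 0 1)"
      by (simp only: pint_add pint_smult)
    moreover have "homfun V (1 + (m + (\<Sum>s\<in>S. n s)))
       (\<lambda>x. \<alpha> r x * pint (C * ?R x) 0 1 + \<beta> x * pint (([:0, 1:] * C) * ?R x) 0 1)"
      using insert.prems assms(3) by (intro homfun_add homfun_mult Suc.IH) auto
    ultimately show ?case by simp
  qed
  then show ?case using insert by simp
qed

lemma homfun_L: "b \<in> I \<Longrightarrow> c \<in> I \<Longrightarrow> homfun V 1 (\<lambda>x. a c x - a b x)"
  by (intro homfun_diff homfun_dual a_dual)

lemma g_homogeneous:
  "b \<in> I \<Longrightarrow> c \<in> I \<Longrightarrow> homogeneous V (\<Sum>s\<in>I - {b, c}. n s) (g n b c)"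
  unfolding g_def homfun_def [symmetric]
  using finI by (intro pint_prod_homfun homfun_L) auto

lemma g_poly: "b \<in> I \<Longrightarrow> c \<in> I \<Longrightarrow> g n b c \<in> poly_ring V"
  using g_homogeneous homogeneous_poly_ring by blast

lemma E_homogeneous:
  assumes "b \<in> I" "c \<in> I"
  shows "homogeneous V ((\<Sum>s\<in>I. n s) + 1) (E n b c)"
proof (cases "b = c")
  case True
  then show ?thesis by (simp add: E_self homogeneous_zero)
next
  case False
  have "(\<Sum>s\<in>I. n s) = n b + (n c + (\<Sum>s\<in>I - {b, c}. n s))"
    using assms False finI
    by (simp add: sum.remove[of I b] sum.remove[of "I - {b}" c] Diff_insert2 [symmetric] insert_commute)
  moreover have "homfun V ((n b + n c + 1) * 1 + (\<Sum>s\<in>I - {b, c}. n s)) (\<lambda>x. L b c x ^ (n b + n c + 1) * g n b c x)"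
    using assms by (intro homfun_mult homfun_power homfun_dual L_dual homfun_hom g_homogeneous)
  moreover have "E n b c = (\<lambda>x. L b c x ^ (n b + n c + 1) * g n b c x)"
    by (simp add: E_eq[OF assms False] fun_eq_iff fun_app)
  ultimately have "homfun V ((\<Sum>s\<in>I. n s) + 1) (E n b c)" by (simp add: add_ac)
  then show ?thesis by (rule homogeneous_of_homfun) (rule E_outside)
qed

lemma E_poly: "b \<in> I \<Longrightarrow> c \<in> I \<Longrightarrow> E n b c \<in> poly_ring V"
  using E_homogeneous homogeneous_poly_ring by blast

text \<open>At a generic point of the hyperplane the factors of the other vertices are nonzero and
  free of the variable of integration; what remains is a Beta integral.\<close>

lemma g_nonzero:
  assumes "b \<in> I" "c \<in> I" "b \<noteq> c"
  shows "\<exists>x\<in>V. L b c x = 0 \<and> g n b c x \<noteq> 0"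
proof -
  obtain x where x: "x \<in> V" "a b x = a c x"
    "\<forall>i\<in>I. \<forall>j\<in>I. a i x = a j x \<longrightarrow> i = j \<or> {i, j} = {b, c}"
    using generic_on[OF assms(1,2)] by blast
  have pr: "(\<Prod>s\<in>S. [:d - a s x:] ^ n s) = [:(\<Prod>s\<in>S. (d - a s x) ^ n s):]"
    if "finite S" for S and d :: complex
    using that by (induction S rule: finite_induct) (simp_all add: poly_const_pow one_pCons)
  have "g n b c x = (\<Prod>s\<in>I - {b, c}. (a b x - a s x) ^ n s) * pint ([:0, 1:] ^ n b * [:- 1, 1:] ^ n c) 0 1"
  proof -
    have 0: "[:d, 0:] = [:d:]" for d :: complex by simp
    have pC: "P * [:c:] = smult c P" for P and c :: complex by simp
    show ?thesis using x finI by (simp only: g_def ext0_in diff_self 0 pr[OF finite_Diff] pC pint_smult)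
  qed
  moreover have "a b x - a s x \<noteq> 0" if "s \<in> I - {b, c}" for s using x(3) that assms by force
  ultimately have "g n b c x \<noteq> 0" using beta_nonzero finI by simp
  moreover have "L b c x = 0" using x by (simp add: L_app)
  ultimately show ?thesis using x by blast
qed

lemma E_zero: "(\<And>s. s \<in> I \<Longrightarrow> n s = 0) \<Longrightarrow> b \<in> I \<Longrightarrow> c \<in> I \<Longrightarrow> E n b c = L b c"
proof
  fix x
  assume *: "\<And>s. s \<in> I \<Longrightarrow> n s = 0" "b \<in> I" "c \<in> I"
  show "E n b c x = L b c x"
    using dual_outside[OF L_dual[OF *(2,3)]] *(1)
    by (cases "x \<in> V") (simp_all add: E_app E_outside \<omega>_def pint_1 L_app)
qed

lemma \<omega>_Suc: "v \<in> I \<Longrightarrow> \<omega> (n(v := Suc (n v))) x = [:- a v x, 1:] * \<omega> n x"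
  using finI by (simp add: \<omega>_def prod.remove[of I v] algebra_simps)

text \<open>The two integrands differ by the factor (t - x_v) - (t - x_w), which is independent of
  t.\<close>

lemma E_Suc_diff:
  assumes "v \<in> I" "w \<in> I"
  shows "E (n(v := Suc (n v))) b c - E (n(w := Suc (n w))) b c = L v w * E n b c"
proof
  fix x
  have "[:- a v x, 1:] * \<omega> n x - [:- a w x, 1:] * \<omega> n x = smult (a w x - a v x) (\<omega> n x)"
    by (simp add: smult_diff_left)
  then show "(E (n(v := Suc (n v))) b c - E (n(w := Suc (n w))) b c) x = (L v w * E n b c) x"
    using assms by (cases "x \<in> V")
      (simp_all add: fun_app E_app E_outside \<omega>_Suc pint_minus [symmetric] pint_smult L_app)
qed

text \<open>The raised integrand vanishes at t = x_v, so there is no boundary term even if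
  \<open>v\<close> is an end point, and only the factor of \<open>v\<close> is
  differentiated.\<close>

lemma pd_E_Suc:
  assumes v: "v \<in> I" and b: "b \<in> I" and c: "c \<in> I"
  shows "pd (e v) (E (n(v := Suc (n v))) b c) = const_on V (- of_nat (Suc (n v))) * E n b c"
proof -
  let ?n = "n(v := Suc (n v))"
  \<comment> \<open>\<open>pint_moving_root\<close> moves the upper limit only, so a
    \<open>v\<close> at the lower end is left to antisymmetry in the end points.\<close>
  have main: "pd (e v) (E ?n b c) = const_on V (- of_nat (Suc (n v))) * E n b c"
    if vb: "v \<noteq> b" and b: "b \<in> I" and c: "c \<in> I" for b c
  proof
    fix x
    show "pd (e v) (E ?n b c) x = (const_on V (- of_nat (Suc (n v))) * E n b c) x"
    proof (cases "x \<in> V")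
      case True
      define R where "R = (\<Prod>s\<in>I - {v}. [:- a s x, 1:] ^ n s)"
      define k :: complex where "k = of_bool (c = v)"
      \<comment> \<open>\<open>e v\<close> raises the coordinate of \<open>v\<close> by 1 relative
        to the others and may shift all of them by a common \<tau>. That shift is undone by
        translating the variable of integration.\<close>
      define \<tau> where "\<tau> = a v (e v) - 1"
      have a_e: "a s (e v) = of_bool (s = v) + \<tau>" if "s \<in> I" for s
      proof -
        have "a s (e v) - a v (e v) = of_bool (s = v) - of_bool (v = v)"
          using e_props v that by blast
        then show ?thesis by (simp add: \<tau>_def algebra_simps)
      qed
      have a_line: "a s (x + t *s e v) = a s x + t * of_bool (s = v) + t * \<tau>" if "s \<in> I" for s t
        using a_dual[OF that] True
        by (simp add: dual_add V_scale dual_scale a_e[OF that] algebra_simps)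
      have wn: "\<omega> n x = [:- a v x, 1:] ^ n v * R"
        using finI v by (simp add: \<omega>_def R_def prod.remove[of I v])
      have "E ?n b c (x + t *s e v) = pint ([:- (a v x + t), 1:] ^ Suc (n v) * R) (a b x) (a c x + k * t)" for t
      proof -
        have "\<omega> ?n (x + t *s e v) = [:- a v (x + t *s e v), 1:] ^ Suc (n v) *
            (\<Prod>s\<in>I - {v}. [:- a s (x + t *s e v), 1:] ^ n s)"
          using finI v by (simp add: \<omega>_def prod.remove[of I v])
        also have "(\<Prod>s\<in>I - {v}. [:- a s (x + t *s e v), 1:] ^ n s) =
            (\<Prod>s\<in>I - {v}. [:- a s x - t * \<tau>, 1:] ^ n s)"
          by (intro prod.cong refl) (simp add: a_line)
        finally have *: "\<omega> ?n (x + t *s e v) = [:- a v (x + t *s e v), 1:] ^ Suc (n v) *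
            (\<Prod>s\<in>I - {v}. [:- a s x - t * \<tau>, 1:] ^ n s)" .
        have w: "\<omega> ?n (x + t *s e v) = [:- (a v x + t) - t * \<tau>, 1:] ^ Suc (n v) *
            (\<Prod>s\<in>I - {v}. [:- a s x - t * \<tau>, 1:] ^ n s)"
        proof -
          have eq: "- a v (x + t *s e v) = - (a v x + t) - t * \<tau>" by (simp add: a_line[OF v])
          show ?thesis using * by (simp only: eq)
        qed
        have pw: "(p ^ k) \<circ>\<^sub>p q = (p \<circ>\<^sub>p q) ^ k" for p q :: "complex poly" and k
          by (induction k) (auto simp: pcompose_mult pcompose_1)
        have sh: "\<omega> ?n (x + t *s e v) \<circ>\<^sub>p [:t * \<tau>, 1:] = [:- (a v x + t), 1:] ^ Suc (n v) * R"
          unfolding w R_def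
          by (simp add: pcompose_mult pw pcompose_prod pcompose_pCons del: power_Suc)
        have "pint (\<omega> ?n (x + t *s e v) \<circ>\<^sub>p [:t * \<tau>, 1:]) (a b x) (a c x + k * t) =
            pint (\<omega> ?n (x + t *s e v)) (t * \<tau> + a b x) (t * \<tau> + (a c x + k * t))"
          using pint_pcompose[of 1 _ "t * \<tau>"] by simp
        moreover have "t * \<tau> + a b x = a b (x + t *s e v)"
          "t * \<tau> + (a c x + k * t) = a c (x + t *s e v)"
          using a_line[OF b] a_line[OF c] vb by (simp_all add: k_def)
        ultimately show ?thesis using True sh by (simp add: E_app V_add V_scale)
      qed
      then have "((\<lambda>t. E ?n b c (x + t *s e v)) has_field_derivative
          k * (poly ([:- a v x, 1:] ^ Suc (n v) * R) (a c x))
          - of_nat (Suc (n v)) * pint ([:- a v x, 1:] ^ (Suc (n v) - 1) * R) (a b x) (a c x)) (at 0)"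
        using pint_moving_root[of "a v x" "Suc (n v)" R "a b x" "a c x" k] by simp
      then have "pd (e v) (E ?n b c) x = k * (poly ([:- a v x, 1:] ^ Suc (n v) * R) (a c x))
          - of_nat (Suc (n v)) * pint ([:- a v x, 1:] ^ (Suc (n v) - 1) * R) (a b x) (a c x)"
        using True b c by (intro pd_eqI E_poly) auto
      \<comment> \<open>Either the upper limit is fixed and \<open>k = 0\<close>, or
        \<open>c = v\<close> and the integrand has a root there.\<close>
      also have "k * (poly ([:- a v x, 1:] ^ Suc (n v) * R) (a c x)) = 0"
        by (simp add: k_def)
      finally show ?thesis using True
        by (simp add: fun_app E_app wn del: fun_upd_apply of_nat_Suc power_Suc)
    qed (simp add: pd_outside fun_app E_outside)
  qed
  consider "v \<noteq> b" | "v \<noteq> c" | "v = b" "v = c" by blast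
  then show ?thesis
  proof cases
    case 1
    then show ?thesis using main b c by blast
  next
    case 2
    have "pd (e v) (E ?n b c) = pd (e v) (const_on V (- 1) * E ?n c b)"
    proof -
      have "E ?n b c = const_on V (- 1) * E ?n c b"
        using b c by (subst E_uminus, intro poly_ring_eqI[of _ V])
          (auto intro: poly_ring_uminus poly_ring.intros E_poly simp: fun_app)
      then show ?thesis by simp
    qed
    also have "\<dots> = const_on V (- 1) * pd (e v) (E ?n c b)"
      using b c by (intro Der_cmult[OF pd_Der] E_poly) auto
    also have "\<dots> = const_on V (- 1) * (const_on V (- of_nat (Suc (n v))) * E n c b)"
      using main[OF 2 c b] by simp
    also have "\<dots> = const_on V (- of_nat (Suc (n v))) * E n b c"
      using b c by (subst (2) E_uminus, intro poly_ring_eqI[of _ V])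
        (auto intro!: poly_ring.intros(1,3,4) poly_ring_uminus E_poly simp: fun_app)
    finally show ?thesis .
  next
    case 3
    then show ?thesis using pd_const[OF e_V, of v 0] by (simp add: E_self ext0_const[symmetric])
        (simp add: ext0_def fun_eq_iff fun_app pd_def)
  qed
qed

end

context poly_space
begin

lemma pd_power_mult:
  assumes f: "f \<in> poly_ring V" and h: "h \<in> poly_ring V" and x: "x \<in> V" and e: "e \<in> V"
  shows "pd e (f ^ m * h) x = f x ^ m * pd e h x + of_nat m * f x ^ (m - 1) * pd e f x * h x"
proof (rule pd_eqI[OF poly_ring_pow_mult[OF f h] x e])
  have "((\<lambda>t. f (x + t *s e) ^ m * h (x + t *s e)) has_field_derivative
      (of_nat m * (pd e f x * f (x + 0 *s e) ^ (m - Suc 0))) * h (x + 0 *s e)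
      + pd e h x * f (x + 0 *s e) ^ m) (at 0)"
    by (intro DERIV_mult DERIV_power has_field_derivative_pd f h x e)
  then show "((\<lambda>t. (f ^ m * h) (x + t *s e)) has_field_derivative
      f x ^ m * pd e h x + of_nat m * f x ^ (m - 1) * pd e f x * h x) (at 0)"
    by (simp add: fun_app mult_ac add.commute)
qed

lemma power_mult_cancel:
  assumes f: "f \<in> poly_ring V" "f \<noteq> 0" and h: "h \<in> poly_ring V"
  shows "f ^ m * h = 0 \<Longrightarrow> h = 0"
  using h
proof (induction m)
  case (Suc m)
  have "f * (f ^ m * h) = 0" using Suc.prems by (simp add: mult.assoc)
  then have "f ^ m * h = 0"
    using poly_ring_domain[OF f(1) _ _ f(2)] poly_ring_pow_mult[OF f(1) Suc.prems(2)] by blast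
  then show ?case using Suc by blast
qed simp

end

section \<open>The universal derivations\<close>

context braid
begin

text \<open>\<open>th n i\<close> sends \<open>L b c\<close> to the derivative of \<open>E n b c\<close> in the direction \<open>e i\<close>.\<close>

definition th :: "('i \<Rightarrow> nat) \<Rightarrow> 'i \<Rightarrow> 'k fn \<Rightarrow> 'k fn" where
  "th n i = mkder (\<lambda>j. pd (e i) (E n (SOME z. z \<in> I) j))"

definition comb :: "('i \<Rightarrow> nat) \<Rightarrow> ('i \<Rightarrow> 'k fn) \<Rightarrow> 'k fn \<Rightarrow> 'k fn" where
  "comb n c = (\<Sum>i\<in>I. der_smult (c i) (th n i))"

lemma some_in_I: "b \<in> I \<Longrightarrow> (SOME z. z \<in> I) \<in> I"
  by (rule someI)

lemma pd_E_poly: "b \<in> I \<Longrightarrow> c \<in> I \<Longrightarrow> pd (e i) (E n b c) \<in> poly_ring V"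
  by (simp add: pd_poly E_poly)

lemma th_Der: "th n i \<in> Der V"
  unfolding th_def by (rule mkder_Der) (blast intro: pd_E_poly some_in_I)

lemma th_L:
  assumes "b \<in> I" "c \<in> I"
  shows "th n i (L b c) = pd (e i) (E n b c)"
proof -
  let ?z = "SOME z. z \<in> I"
  have z: "?z \<in> I" using some_in_I assms by blast
  have "th n i (L b c) = pd (e i) (E n ?z c) - pd (e i) (E n ?z b)"
    unfolding th_def using assms by (intro mkder_L pd_E_poly z)
  moreover have "pd (e i) (E n ?z c) = pd (e i) (E n ?z b) + pd (e i) (E n b c)"
    using assms z by (subst E_trans[of n ?z b c, symmetric]) (simp add: pd_add E_poly)
  ultimately show ?thesis by simp
qed

lemma th_y: "k \<in> K \<Longrightarrow> th n i (y k) = 0"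
  unfolding th_def by (rule mkder_y) (auto intro: pd_E_poly some_in_I)

lemma comb_Der: "(\<And>i. i \<in> I \<Longrightarrow> c i \<in> poly_ring V) \<Longrightarrow> comb n c \<in> Der V"
  unfolding comb_def by (intro Der_sum Der_smult th_Der)

lemma comb_L:
  "b \<in> I \<Longrightarrow> d \<in> I \<Longrightarrow> comb n c (L b d) x = (\<Sum>i\<in>I. c i x * pd (e i) (E n b d) x)"
  by (simp add: comb_def fun_app der_smult_def th_L)

lemma comb_y: "k \<in> K \<Longrightarrow> comb n c (y k) = 0"
  by (auto simp: comb_def fun_app der_smult_def th_y fun_eq_iff)

lemma comb_eqI:
  assumes z: "z \<in> I" and c: "\<And>i. i \<in> I \<Longrightarrow> c i \<in> poly_ring V" and \<eta>: "\<eta> \<in> Der V"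
    and L: "\<And>j x. j \<in> I \<Longrightarrow> x \<in> V \<Longrightarrow> \<eta> (L z j) x = (\<Sum>i\<in>I. c i x * pd (e i) (E n z j) x)"
    and y: "\<And>k. k \<in> K \<Longrightarrow> \<eta> (y k) = 0"
  shows "\<eta> = comb n c"
proof (rule Der_coord_eqI[OF z \<eta> comb_Der[OF c]])
  show "\<eta> (L z j) = comb n c (L z j)" if "j \<in> I" for j
  proof (rule poly_ring_eqI[of _ V])
    show "\<eta> (L z j) \<in> poly_ring V" using that z by (intro Der_poly[OF \<eta>] L_poly)
    show "comb n c (L z j) \<in> poly_ring V"
      using that z by (intro Der_poly[OF comb_Der] L_poly) (auto intro: c)
    show "\<eta> (L z j) x = comb n c (L z j) x" if "x \<in> V" for x
      using that \<open>j \<in> I\<close> z by (simp add: L comb_L)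
  qed
  show "\<eta> (y k) = comb n c (y k)" if "k \<in> K" for k using that y by (simp add: comb_y)
qed

lemma sum_pd_E: "I \<noteq> {} \<Longrightarrow> (\<Sum>i\<in>I. pd (e i) h x) = 0"
  using fun_cong[OF fun_cong[OF sum_pd_e], of h x] by (simp add: fun_app)

lemma comb_const:
  assumes "\<And>i. i \<in> I \<Longrightarrow> c i = c0" "c0 \<in> poly_ring V" "I \<noteq> {}"
  shows "comb n c = 0"
proof -
  obtain z where z: "z \<in> I" using assms by auto
  have "0 = comb n c"
  proof (rule comb_eqI[OF z])
    show "0 (L z j) x = (\<Sum>i\<in>I. c i x * pd (e i) (E n z j) x)" for j x
      using sum_pd_E[OF assms(3)] assms(1) by (simp add: fun_app sum_distrib_left [symmetric])
  qed (use assms in \<open>auto intro: Der_zero simp: fun_app\<close>)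
  then show ?thesis by simp
qed

text \<open>Product rule for the factorization \<open>E_eq\<close>. The direction \<open>e i\<close>
  changes \<open>L b d\<close> only if \<open>i\<close> is \<open>b\<close> or \<open>d\<close>,
  which leaves \<open>c d - c b\<close> at the lower power.\<close>

lemma comb_L_expand:
  assumes "b \<in> I" "d \<in> I" "b \<noteq> d" and c: "\<And>i. i \<in> I \<Longrightarrow> c i \<in> poly_ring V"
  shows "comb n c (L b d) = L b d ^ (n b + n d + 1) * (\<Sum>i\<in>I. c i * pd (e i) (g n b d))
    + L b d ^ (n b + n d) * (const_on V (of_nat (n b + n d + 1)) * (g n b d * (c d - c b)))"
    (is "_ = ?R")
proof (rule poly_ring_eqI[of _ V])
  have cb: "c b \<in> poly_ring V" "c d \<in> poly_ring V" using assms by auto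
  show "comb n c (L b d) \<in> poly_ring V"
    using assms by (intro Der_poly[OF comb_Der] L_poly)
  show "?R \<in> poly_ring V"
    using assms cb by (intro poly_ring.add poly_ring_pow_mult poly_ring_sum poly_ring.mult poly_ring.const
        poly_ring_minus L_poly pd_poly g_poly e_V c)
  fix x assume x: "x \<in> V"
  let ?M = "n b + n d"
  have pdE: "pd (e i) (E n b d) x = L b d x ^ (?M + 1) * pd (e i) (g n b d) x
      + of_nat (?M + 1) * L b d x ^ ?M * (of_bool (d = i) - of_bool (b = i)) * g n b d x" for i
    unfolding E_eq[OF assms(1-3)] using assms x
    by (subst pd_power_mult) (auto simp: L_poly g_poly pd_linear L_dual L_e)
  have "comb n c (L b d) x = L b d x ^ (?M + 1) * (\<Sum>i\<in>I. c i x * pd (e i) (g n b d) x)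
      + of_nat (?M + 1) * L b d x ^ ?M * g n b d x * (\<Sum>i\<in>I. c i x * (of_bool (d = i) - of_bool (b = i)))"
    unfolding comb_L[OF assms(1,2)] pdE sum_distrib_left sum.distrib [symmetric]
    by (intro sum.cong) (auto simp: algebra_simps)
  also have "(\<Sum>i\<in>I. c i x * (of_bool (d = i) - of_bool (b = i))) =
        (\<Sum>i\<in>I. if d = i then c i x else 0) - (\<Sum>i\<in>I. if b = i then c i x else 0)"
      unfolding sum_subtractf [symmetric] by (intro sum.cong) auto
  also have "\<dots> = c d x - c b x" using assms finI by simp
  finally show "comb n c (L b d) x = ?R x" using x by (simp add: fun_app mult_ac)
qed

text \<open>Modulo the next power of \<open>L b d\<close> only the term with
  \<open>c d - c b\<close> survives, and its cofactor, a nonzero constant times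
  \<open>g n b d\<close>, is prime to \<open>L b d\<close>. This is where the spline condition comes
  from.\<close>

lemma comb_pdvd:
  assumes "b \<in> I" "d \<in> I" "b \<noteq> d" and c: "\<And>i. i \<in> I \<Longrightarrow> c i \<in> poly_ring V"
  shows "pdvd V (L b d ^ (n b + n d)) (comb n c (L b d))"
    and "pdvd V (L b d ^ (n b + n d + 1)) (comb n c (L b d)) \<longleftrightarrow> pdvd V (L b d) (c d - c b)"
proof -
  let ?M = "n b + n d" and ?k = "const_on V (of_nat (n b + n d + 1))"
  define S where "S = (\<Sum>i\<in>I. c i * pd (e i) (g n b d))"
  have cb: "c b \<in> poly_ring V" "c d \<in> poly_ring V" using assms by auto
  have LP: "L b d \<in> poly_ring V" and gP: "g n b d \<in> poly_ring V" and SP: "S \<in> poly_ring V"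
    unfolding S_def using assms
    by (auto intro!: L_poly g_poly poly_ring_sum poly_ring.mult pd_poly)
  have cdb: "c d - c b \<in> poly_ring V" using cb poly_ring_minus by blast
  have ex: "comb n c (L b d) = L b d ^ (?M + 1) * S + L b d ^ ?M * (?k * (g n b d * (c d - c b)))"
    using comb_L_expand[OF assms] by (simp add: S_def)
  then have "comb n c (L b d) = L b d ^ ?M * (L b d * S + ?k * (g n b d * (c d - c b)))"
    by (simp add: algebra_simps)
  moreover have "L b d * S + ?k * (g n b d * (c d - c b)) \<in> poly_ring V"
    using LP SP gP cdb by (intro poly_ring.add poly_ring.mult poly_ring.const)
  ultimately show "pdvd V (L b d ^ ?M) (comb n c (L b d))" by (auto simp: pdvd_def)
  show "pdvd V (L b d ^ (?M + 1)) (comb n c (L b d)) \<longleftrightarrow> pdvd V (L b d) (c d - c b)"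
  proof
    assume "pdvd V (L b d) (c d - c b)"
    then obtain h where h: "h \<in> poly_ring V" "c d - c b = L b d * h" by (auto simp: pdvd_def)
    have "comb n c (L b d) = L b d ^ (?M + 1) * (S + ?k * (g n b d * h))"
      unfolding ex h(2) by (simp add: algebra_simps)
    moreover have "S + ?k * (g n b d * h) \<in> poly_ring V"
      using SP gP h by (intro poly_ring.add poly_ring.mult poly_ring.const)
    ultimately show "pdvd V (L b d ^ (?M + 1)) (comb n c (L b d))" by (auto simp: pdvd_def)
  next
    assume "pdvd V (L b d ^ (?M + 1)) (comb n c (L b d))"
    then obtain h where h: "h \<in> poly_ring V" "comb n c (L b d) = L b d ^ (?M + 1) * h"
      by (auto simp: pdvd_def)
    have "L b d ^ ?M * (?k * (g n b d * (c d - c b)) - L b d * (h - S)) = 0"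
      using h(2) ex by (simp add: algebra_simps)
    moreover have "?k * (g n b d * (c d - c b)) - L b d * (h - S) \<in> poly_ring V"
      by (rule poly_ring_minus[OF poly_ring.mult[OF poly_ring.const poly_ring.mult[OF gP cdb]]
            poly_ring.mult[OF LP poly_ring_minus[OF h(1) SP]]])
    ultimately have "?k * (g n b d * (c d - c b)) - L b d * (h - S) = 0"
      using power_mult_cancel[OF LP L_nonzero[OF assms(1-3)]] by blast
    then have *: "(?k * g n b d) * (c d - c b) = L b d ^ 1 * (h - S)"
      by (simp add: mult.assoc)
    obtain x where x: "x \<in> V" "L b d x = 0" "g n b d x \<noteq> 0" using g_nonzero[OF assms(1-3)] by blast
    have "(?k * g n b d) x \<noteq> 0"
      using x of_nat_neq_0[of "n b + n d", where 'a = complex] by (simp add: fun_app)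
    moreover have "pdvd V (L b d ^ 1) ((?k * g n b d) * (c d - c b))"
      unfolding * pdvd_def using h SP poly_ring_minus by blast
    moreover have "?k * g n b d \<in> poly_ring V" using gP by (intro poly_ring.mult poly_ring.const)
    ultimately have "pdvd V (L b d ^ 1) (c d - c b)"
      using pdvd_power_cancel[OF L_dual[OF assms(1,2)] cdb _ x(1,2) _ L_nonzero[OF assms(1-3)]] by blast
    then show "pdvd V (L b d) (c d - c b)" by simp
  qed
qed

text \<open>Differentiating \<open>E (n + \<delta>\<^sub>v) - E (n + \<delta>\<^sub>i) = L v i * E n\<close> in the direction \<open>e i\<close>
  expresses the universal derivations for \<open>n\<close> through those for \<open>n + \<delta>\<^sub>v\<close>.\<close>

lemma pd_E_shift:
  assumes "v \<in> I" "i \<in> I" "i \<noteq> v" "b \<in> I" "d \<in> I" "x \<in> V"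
  shows "L v i x * pd (e i) (E n b d) x = pd (e i) (E (n(v := Suc (n v))) b d) x
    - of_nat (n i) / of_nat (Suc (n v)) * pd (e v) (E (n(v := Suc (n v))) b d) x"
proof -
  let ?v = "n(v := Suc (n v))" and ?i = "n(i := Suc (n i))"
  have "pd (e i) (E ?v b d) - pd (e i) (E ?i b d) = pd (e i) (L v i * E n b d)"
    using assms by (simp add: E_Suc_diff [symmetric] Der_diff[OF pd_Der] E_poly)
  also have "\<dots> = pd (e i) (L v i) * E n b d + L v i * pd (e i) (E n b d)"
    using assms by (intro pd_mult E_poly L_poly) auto
  finally have "pd (e i) (E ?v b d) x - pd (e i) (E ?i b d) x =
      pd (e i) (L v i) x * E n b d x + L v i x * pd (e i) (E n b d) x"
    by (drule_tac fun_cong[of _ _ x]) (simp only: fun_app)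
  moreover have "pd (e i) (L v i) x = 1" using assms by (simp add: pd_linear L_dual L_e)
  moreover have "pd (e i) (E ?i b d) x = - of_nat (Suc (n i)) * E n b d x"
    using assms by (simp only: pd_E_Suc fun_app const_on_in)
  \<comment> \<open>The multiples of \<open>E n b d\<close> collected so far add up to
    \<open>n i\<close> times it, and \<open>pd_E_Suc\<close> at \<open>v\<close> rewrites
    \<open>E n b d\<close> as a derivative for the raised multiplicity.\<close>
  moreover have "of_nat (n i) / of_nat (Suc (n v)) * pd (e v) (E ?v b d) x
      = - of_nat (n i) * E n b d x"
    using assms by (simp add: pd_E_Suc fun_app del: of_nat_Suc fun_upd_apply)
  ultimately show ?thesis by (simp only:) (simp add: algebra_simps del: fun_upd_apply)
qed

text \<open>Derivations that kill all \<open>y k\<close> are singled out because every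
  \<open>comb n c\<close> does; the directions \<open>f k\<close> are added in
  \<open>chordal_basis\<close>.\<close>

definition generates :: "('i \<Rightarrow> nat) \<Rightarrow> bool" where
  "generates n \<longleftrightarrow> (\<forall>\<eta>\<in>Der V. (\<forall>b\<in>I. \<forall>d\<in>I. b \<noteq> d \<longrightarrow> pdvd V (L b d ^ (n b + n d)) (\<eta> (L b d))) \<longrightarrow>
     (\<forall>k\<in>K. \<eta> (y k) = 0) \<longrightarrow> (\<exists>c. (\<forall>i. c i \<in> poly_ring V) \<and> \<eta> = comb n c))"

definition indep :: "('i \<Rightarrow> nat) \<Rightarrow> bool" where
  "indep n \<longleftrightarrow> (\<forall>c. (\<forall>i\<in>I. c i \<in> poly_ring V) \<longrightarrow> comb n c = 0 \<longrightarrow> (\<forall>i\<in>I. \<forall>j\<in>I. c i = c j))"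

lemma comb_zero_exp:
  assumes "\<And>i. i \<in> I \<Longrightarrow> n i = 0" "b \<in> I" "d \<in> I" "x \<in> V"
  shows "(\<Sum>i\<in>I. c i x * pd (e i) (E n b d) x) = c d x - c b x"
proof -
  have "(\<Sum>i\<in>I. c i x * pd (e i) (E n b d) x) = (\<Sum>i\<in>I. if d = i then c i x else 0) - (\<Sum>i\<in>I. if b = i then c i x else 0)"
    unfolding sum_subtractf [symmetric] using assms
    by (intro sum.cong) (auto simp: E_zero pd_linear L_dual L_e)
  then show ?thesis using assms finI by simp
qed

text \<open>For \<open>n = 0\<close> the integral is \<open>L b d\<close> itself, so
  \<open>th n i\<close> is the derivative in the direction \<open>e i\<close>, and the coefficients
  are the values on the coordinates.\<close>

lemma generates_zero:
  assumes "\<And>i. i \<in> I \<Longrightarrow> n i = 0" "z \<in> I"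
  shows "generates n"
  unfolding generates_def
proof (intro ballI impI)
  fix \<eta> assume \<eta>: "\<eta> \<in> Der V" and y: "\<forall>k\<in>K. \<eta> (y k) = 0"
  define c where "c i = (if i \<in> I then \<eta> (L z i) else 0)" for i
  have c: "c i \<in> poly_ring V" for i
    using assms by (auto simp: c_def poly_ring_zero intro: Der_poly[OF \<eta>] L_poly)
  have "L z z = 0" by (simp add: L_def)
  then have "\<eta> (L z z) = 0" using Der_const[OF \<eta>, of 0] ext0_const[of V 0]
    by (metis L_app Der_L[OF \<eta> assms(2) assms(2) assms(2)] cancel_comm_monoid_add_class.diff_cancel)
  then have "c z = 0" using assms by (simp add: c_def)
  then have "\<eta> (L z j) x = (\<Sum>i\<in>I. c i x * pd (e i) (E n z j) x)" if "j \<in> I" "x \<in> V" for j x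
  proof -
    have "(\<Sum>i\<in>I. c i x * pd (e i) (E n z j) x) = c j x - c z x"
      using assms that by (intro comb_zero_exp) auto
    then show ?thesis using that \<open>c z = 0\<close> by (simp only: fun_app) (simp add: c_def)
  qed
  then have "\<eta> = comb n c"
    using y by (intro comb_eqI[OF assms(2) c \<eta>]) auto
  then show "\<exists>c. (\<forall>i. c i \<in> poly_ring V) \<and> \<eta> = comb n c" using c by blast
qed

lemma indep_zero:
  assumes "\<And>i. i \<in> I \<Longrightarrow> n i = 0"
  shows "indep n"
  unfolding indep_def
proof (intro allI impI ballI)
  fix c i j assume c: "\<forall>i\<in>I. c i \<in> poly_ring V" and 0: "comb n c = 0" and ij: "i \<in> I" "j \<in> I"
  show "c i = c j"
  proof (rule poly_ring_eqI[of _ V])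
    fix x assume x: "x \<in> V"
    have "comb n c (L i j) x = c j x - c i x"
      using comb_zero_exp[OF assms ij x] ij by (simp add: comb_L)
    then show "c i x = c j x" using 0 by (simp add: fun_app)
  qed (use c ij in auto)
qed

text \<open>This is \<open>pd_E_shift\<close> multiplied by \<open>d i\<close> and summed over
  \<open>i\<close>: all corrections point in the direction of \<open>v\<close> and are collected in
  the coefficient there, in place of \<open>d v\<close>, whose factor \<open>L v v\<close> is
  0.\<close>

lemma comb_shift:
  fixes n v d
  assumes v: "v \<in> I" and dP: "\<And>i. i \<in> I \<Longrightarrow> d i \<in> poly_ring V"
  defines "\<kappa> \<equiv> \<lambda>i. of_nat (n i) / of_nat (Suc (n v))"
  shows "comb n (\<lambda>i. d i * L v i) =
    comb (n(v := Suc (n v))) (\<lambda>i. if i = v then - (\<Sum>i\<in>I - {v}. const_on V (\<kappa> i) * d i) else d i)"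
    (is "?l = comb ?n ?c")
proof (rule comb_eqI[OF v])
  show "?c i \<in> poly_ring V" if "i \<in> I" for i
    using that dP by (auto intro!: poly_ring_uminus poly_ring_sum poly_ring.mult poly_ring.const)
  show "?l \<in> Der V" using v dP by (intro comb_Der poly_ring.mult L_poly)
  show "?l (y k) = 0" if "k \<in> K" for k using that by (rule comb_y)
  fix j x assume j: "j \<in> I" and x: "x \<in> V"
  let ?T = "\<lambda>i. pd (e i) (E ?n v j) x"
  have "?l (L v j) x = (\<Sum>i\<in>I. d i x * (L v i x * pd (e i) (E n v j) x))"
    using v j by (simp add: comb_L fun_app mult.assoc)
  also have "\<dots> = (\<Sum>i\<in>I - {v}. d i x * (L v i x * pd (e i) (E n v j) x))"
    using v finI by (simp add: sum.remove[of I v] L_app)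
  also have "\<dots> = (\<Sum>i\<in>I - {v}. d i x * ?T i - (\<kappa> i * d i x) * ?T v)"
    using v j x by (intro sum.cong) (simp_all add: pd_E_shift \<kappa>_def algebra_simps del: fun_upd_apply)
  also have "\<dots> = (\<Sum>i\<in>I - {v}. ?c i x * ?T i) + ?c v x * ?T v"
    using x by (simp add: sum_subtractf fun_app sum_distrib_right)
  also have "\<dots> = (\<Sum>i\<in>I. ?c i x * ?T i)"
    using v finI by (simp add: sum.remove[of I v])
  finally show "?l (L v j) x = (\<Sum>i\<in>I. ?c i x * ?T i)" .
qed

lemma comb_diff:
  assumes "\<And>i. i \<in> I \<Longrightarrow> c i \<in> poly_ring V" "\<And>i. i \<in> I \<Longrightarrow> c' i \<in> poly_ring V" "z \<in> I"
  shows "comb n c - comb n c' = comb n (\<lambda>i. c i - c' i)"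
proof
  fix h
  show "(comb n c - comb n c') h = comb n (\<lambda>i. c i - c' i) h"
    by (simp add: comb_def fun_app der_smult_def fun_eq_iff sum_subtractf left_diff_distrib)
qed

text \<open>The divisibilities for \<open>n\<close> provide coefficients \<open>c\<close>. The extra
  power on the pairs with \<open>v\<close> makes \<open>c i - c v\<close> a multiple of
  \<open>L v i\<close> by \<open>comb_pdvd\<close>; subtracting the constant family
  \<open>c v\<close> does not change the derivation, and \<open>comb_shift\<close> applies to the
  result.\<close>

lemma generates_Suc:
  assumes v: "v \<in> I" and gen: "generates n"
  shows "generates (n(v := Suc (n v)))"
  unfolding generates_def
proof (intro ballI impI)
  let ?n = "n(v := Suc (n v))"
  fix \<eta> assume \<eta>: "\<eta> \<in> Der V" and y: "\<forall>k\<in>K. \<eta> (y k) = 0"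
    and dvd: "\<forall>b\<in>I. \<forall>d\<in>I. b \<noteq> d \<longrightarrow> pdvd V (L b d ^ (?n b + ?n d)) (\<eta> (L b d))"
  have "pdvd V (L b d ^ (n b + n d)) (\<eta> (L b d))" if bd: "b \<in> I" "d \<in> I" "b \<noteq> d" for b d
  proof -
    obtain h where h: "h \<in> poly_ring V" "\<eta> (L b d) = L b d ^ (?n b + ?n d) * h"
      using dvd bd by (auto simp: pdvd_def)
    \<comment> \<open>\<open>r\<close> counts how often \<open>v\<close> occurs in the pair
      \<open>b\<close>, \<open>d\<close>.\<close>
    obtain r where r: "?n b + ?n d = (n b + n d) + r"
      by (rule that[of "(if b = v then 1 else 0) + (if d = v then 1 else 0)"]) auto
    have "\<eta> (L b d) = L b d ^ (n b + n d) * (L b d ^ r * h)"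
      unfolding h(2) r by (simp add: power_add mult.assoc)
    then show ?thesis using h bd by (auto simp: pdvd_def intro!: poly_ring_pow_mult L_poly)
  qed
  then have "\<exists>c. (\<forall>i. c i \<in> poly_ring V) \<and> \<eta> = comb n c"
    using y by (intro gen [unfolded generates_def, rule_format] \<eta>) auto
  then obtain c where c: "\<And>i. c i \<in> poly_ring V" "\<eta> = comb n c" by blast
  have "\<exists>d\<in>poly_ring V. c i - c v = L v i * d" if i: "i \<in> I" for i
  proof (cases "i = v")
    case True
    then show ?thesis using poly_ring_zero by (intro bexI[of _ 0]) auto
  next
    case False
    have "pdvd V (L v i ^ (n v + n i + 1)) (comb n c (L v i))"
      using dvd v i False c(2) by (auto simp: add_ac)
    then have "pdvd V (L v i) (c i - c v)" using comb_pdvd(2)[OF v i] False c(1) by blast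
    then show ?thesis by (auto simp: pdvd_def)
  qed
  then obtain d where d: "\<And>i. i \<in> I \<Longrightarrow> d i \<in> poly_ring V" "\<And>i. i \<in> I \<Longrightarrow> c i - c v = L v i * d i"
    by metis
  have "comb n c = comb n c - comb n (\<lambda>i. c v)"
    using comb_const[of "\<lambda>_. c v" "c v"] v c(1) by auto
  also have "\<dots> = comb n (\<lambda>i. c i - c v)" using v c(1) by (intro comb_diff) auto
  also have "\<dots> = comb n (\<lambda>i. d i * L v i)"
    unfolding comb_def using d by (intro sum.cong) (simp_all add: mult.commute)
  finally have eq: "\<eta> = comb n (\<lambda>i. d i * L v i)" using c by simp
  let ?c = "\<lambda>i. if i = v then - (\<Sum>i\<in>I - {v}. const_on V (of_nat (n i) / of_nat (Suc (n v))) * d i)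
      else d i"
  have "\<eta> = comb ?n ?c" unfolding eq using v d(1) by (rule comb_shift)
  also have "\<dots> = comb ?n (\<lambda>i. if i \<in> I then ?c i else 0)"
    unfolding comb_def by (intro sum.cong) auto
  finally have "\<eta> = comb ?n (\<lambda>i. if i \<in> I then ?c i else 0)" .
  moreover have "(if i \<in> I then ?c i else 0) \<in> poly_ring V" for i
    using d(1) by (auto intro!: poly_ring_uminus poly_ring_sum poly_ring.mult poly_ring.const poly_ring_zero)
  ultimately show "\<exists>c. (\<forall>i. c i \<in> poly_ring V) \<and> \<eta> = comb ?n c"
    by (intro exI[of _ "\<lambda>i. if i \<in> I then ?c i else 0"]) blast
qed

text \<open>Runs \<open>comb_shift\<close> backwards. A constant family \<open>s\<close> is
  subtracted so that the coefficient at \<open>v\<close> has the form that \<open>comb_shift\<close>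
  produces; independence for \<open>n\<close> then applies to the family of the
  \<open>(d i - s) * L v i\<close>, which is 0 at \<open>v\<close>.\<close>

lemma indep_Suc:
  assumes v: "v \<in> I" and ind: "indep n"
  shows "indep (n(v := Suc (n v)))"
  unfolding indep_def
proof (intro allI impI)
  let ?n = "n(v := Suc (n v))"
  fix c' assume c': "\<forall>i\<in>I. c' i \<in> poly_ring V" and 0: "comb ?n c' = 0"
  define \<kappa> :: "'i \<Rightarrow> complex" where "\<kappa> i = of_nat (n i) / of_nat (Suc (n v))" for i
  define \<sigma> where "\<sigma> = (\<Sum>i\<in>I - {v}. \<kappa> i)"
  have "of_nat (Suc (n v)) * \<sigma> = (\<Sum>i\<in>I - {v}. of_nat (n i))"
    unfolding \<sigma>_def \<kappa>_def sum_distrib_left by (intro sum.cong) (simp_all del: of_nat_Suc)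
  then have "of_nat (Suc (n v)) * (1 + \<sigma>) = of_nat (Suc (n v) + (\<Sum>i\<in>I - {v}. n i))"
    by (simp add: algebra_simps)
  \<comment> \<open>\<open>1 + \<sigma>\<close> is 1 plus the sum of all \<open>n i\<close>, divided
    by \<open>n v + 1\<close>, hence positive.\<close>
  then have \<sigma>: "1 + \<sigma> \<noteq> 0" by (metis add_Suc mult_zero_right nat.distinct(1) of_nat_eq_0_iff)
  define d where "d i = c' i - c' v" for i
  have dP: "d i \<in> poly_ring V" if "i \<in> I" for i
    using that c' v by (auto simp: d_def intro: poly_ring_minus)
  have dv: "d v = 0" by (simp add: d_def)
  \<comment> \<open>Solves \<open>- s = - (\<Sum>i\<in>I - {v}. \<kappa> i * (d i - s))\<close>,
    which says that \<open>d - s\<close>, with \<open>d v = 0\<close>, has the right coefficient at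
    \<open>v\<close>.\<close>
  define s where "s = const_on V (1 / (1 + \<sigma>)) * (\<Sum>i\<in>I - {v}. const_on V (\<kappa> i) * d i)"
  have sP: "s \<in> poly_ring V"
    unfolding s_def using dP by (intro poly_ring.mult poly_ring.const poly_ring_sum) auto
  have "comb ?n c' - comb ?n (\<lambda>i. c' v) = comb ?n d"
    using v c' unfolding d_def by (intro comb_diff) auto
  moreover have "comb ?n (\<lambda>i. c' v) = 0" using v c' by (intro comb_const) auto
  ultimately have d0: "comb ?n d = 0" using 0 by simp
  have dsP: "d i - s \<in> poly_ring V" if "i \<in> I" for i using dP sP that poly_ring_minus by blast
  let ?c = "\<lambda>i. if i = v then - (\<Sum>i\<in>I - {v}. const_on V (\<kappa> i) * (d i - s)) else d i - s"
  have "?c i = d i - s" if i: "i \<in> I" for i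
  proof (cases "i = v")
    case True
    have "- (\<Sum>i\<in>I - {v}. const_on V (\<kappa> i) * (d i - s)) = d v - s"
    proof (rule poly_ring_eqI[of _ V])
      show "- (\<Sum>i\<in>I - {v}. const_on V (\<kappa> i) * (d i - s)) \<in> poly_ring V"
        using dsP by (intro poly_ring_uminus poly_ring_sum poly_ring.mult poly_ring.const) auto
      show "d v - s \<in> poly_ring V" using dsP v by blast
      fix x assume x: "x \<in> V"
      have s: "(1 + \<sigma>) * s x = (\<Sum>i\<in>I - {v}. \<kappa> i * d i x)"
        using \<sigma> x by (simp add: s_def fun_app)
      have "(- (\<Sum>i\<in>I - {v}. const_on V (\<kappa> i) * (d i - s))) x = \<sigma> * s x - (\<Sum>i\<in>I - {v}. \<kappa> i * d i x)"
        using x by (simp add: fun_app \<sigma>_def right_diff_distrib sum_subtractf sum_distrib_right)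
      also have "\<dots> = - s x" using s by (simp add: algebra_simps)
      finally show "(- (\<Sum>i\<in>I - {v}. const_on V (\<kappa> i) * (d i - s))) x = (d v - s) x"
        by (simp add: dv fun_app)
    qed
    then show ?thesis using True by simp
  qed simp
  then have "comb ?n ?c = comb ?n (\<lambda>i. d i - s)" unfolding comb_def by (intro sum.cong) auto
  also have "\<dots> = comb ?n d - comb ?n (\<lambda>_. s)" using v dP sP by (intro comb_diff [symmetric]) auto
  also have "\<dots> = 0" using d0 comb_const[of "\<lambda>_. s" s ?n] v sP by auto
  finally have "comb ?n ?c = 0" .
  moreover have "comb n (\<lambda>i. (d i - s) * L v i) = comb ?n ?c"
    unfolding \<kappa>_def by (rule comb_shift[OF v dsP])
  ultimately have "comb n (\<lambda>i. (d i - s) * L v i) = 0" by simp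
  moreover have "\<forall>i\<in>I. (d i - s) * L v i \<in> poly_ring V" using dsP v by (auto intro: poly_ring.mult L_poly)
  ultimately have eq: "(d i - s) * L v i = (d v - s) * L v v" if "i \<in> I" for i
    using ind [unfolded indep_def, rule_format, of "\<lambda>i. (d i - s) * L v i" i v] that v by blast
  have ds: "d i = s" if "i \<in> I" "i \<noteq> v" for i
  proof -
    have "L v v = 0" by (simp add: L_def)
    then have "L v i * (d i - s) = 0" using eq[OF that(1)] by (simp add: mult.commute)
    then have "d i - s = 0"
      using poly_ring_domain[OF L_poly[OF v that(1)] dsP[OF that(1)]] L_nonzero[OF v that(1)] that by blast
    then show ?thesis by simp
  qed
  \<comment> \<open>All \<open>d i\<close> with \<open>i\<close> other than \<open>v\<close> now
    equal \<open>s\<close>, so the equation that defines \<open>s\<close> reads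
    \<open>(1 + \<sigma>) * s = \<sigma> * s\<close>.\<close>
  have "s = 0"
  proof (rule poly_ring_eqI[OF sP poly_ring_zero])
    fix x assume x: "x \<in> V"
    have s: "(1 + \<sigma>) * s x = (\<Sum>i\<in>I - {v}. \<kappa> i * d i x)"
      using \<sigma> x by (simp add: s_def fun_app)
    also have "\<dots> = (\<Sum>i\<in>I - {v}. \<kappa> i * s x)" using ds by (intro sum.cong) auto
    also have "\<dots> = \<sigma> * s x" by (simp add: \<sigma>_def sum_distrib_right)
    finally show "s x = 0 x" by (simp add: algebra_simps fun_app)
  qed
  then have "d i = 0" if "i \<in> I" for i using ds dv that by (cases "i = v") auto
  then show "\<forall>i\<in>I. \<forall>j\<in>I. c' i = c' j" by (auto simp: d_def)
qed

lemma generates_indep: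
  assumes "z \<in> I"
  shows "generates n \<and> indep n"
proof (induction "\<Sum>i\<in>I. n i" arbitrary: n)
  case 0
  then have "\<And>i. i \<in> I \<Longrightarrow> n i = 0" using finI by simp
  then show ?case using generates_zero indep_zero assms by blast
next
  case (Suc m)
  then obtain v where v: "v \<in> I" "n v \<noteq> 0" by (metis nat.distinct(1) sum.neutral)
  define n0 where "n0 = n(v := n v - 1)"
  have n: "n = n0(v := Suc (n0 v))" using v by (auto simp: n0_def)
  have "(\<Sum>i\<in>I. n i) = Suc (\<Sum>i\<in>I. n0 i)"
    using v finI by (simp add: sum.remove[of I v] n0_def)
  then have "m = (\<Sum>i\<in>I. n0 i)" using Suc by simp
  then have "generates n0 \<and> indep n0" using Suc by blast
  then show ?case using generates_Suc[OF v(1)] indep_Suc[OF v(1)] n by metis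
qed

end

section \<open>Perfect elimination orders\<close>

text \<open>The strict inequality of ranks discards loops, so \<open>G\<close> may be reflexive, as
  the complete graph in the last section is.\<close>

definition later :: "'i set \<Rightarrow> ('i \<Rightarrow> 'i \<Rightarrow> bool) \<Rightarrow> ('i \<Rightarrow> nat) \<Rightarrow> 'i \<Rightarrow> 'i set" where
  "later I G \<rho> u = {w \<in> I. G u w \<and> \<rho> u < \<rho> w}"

definition perfect_elim :: "'i set \<Rightarrow> ('i \<Rightarrow> 'i \<Rightarrow> bool) \<Rightarrow> ('i \<Rightarrow> nat) \<Rightarrow> bool" where
  "perfect_elim I G \<rho> \<longleftrightarrow> inj_on \<rho> I \<and> (\<forall>u\<in>I. \<forall>w\<in>I. G u w \<longrightarrow> G w u) \<and>
     (\<forall>u\<in>I. \<forall>w\<in>later I G \<rho> u. \<forall>w'\<in>later I G \<rho> u. w \<noteq> w' \<longrightarrow> G w w')"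

definition later_rel :: "'i set \<Rightarrow> ('i \<Rightarrow> 'i \<Rightarrow> bool) \<Rightarrow> ('i \<Rightarrow> nat) \<Rightarrow> 'i rel" where
  "later_rel I G \<rho> = {(i, w). i \<in> I \<and> w \<in> later I G \<rho> i}"

lemma later_subset: "later I G \<rho> u \<subseteq> I"
  by (auto simp: later_def)

text \<open>Follow a path from \<open>b\<close> to \<open>u\<close>. Its next vertex and
  \<open>d\<close> are both later neighbours of \<open>b\<close>, hence adjacent, and
  \<open>d\<close> cannot come first, since it would then reach \<open>u\<close>. So
  \<open>d\<close> is a later neighbour of each vertex of the path in turn.\<close>

lemma later_reach:
  assumes G: "perfect_elim I G \<rho>"
    and "(b, u) \<in> (later_rel I G \<rho>)\<^sup>*" "d \<in> later I G \<rho> b" "(d, u) \<notin> (later_rel I G \<rho>)\<^sup>*"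
  shows "d \<in> later I G \<rho> u"
  using assms(2-)
proof (induction arbitrary: d rule: converse_rtrancl_induct)
  case (step b b')
  have b: "b \<in> I" "b' \<in> later I G \<rho> b" using step.hyps by (auto simp: later_rel_def)
  have I: "b' \<in> I" "d \<in> I" using b step.prems by (auto simp: later_def)
  have ne: "d \<noteq> b'" using step by blast
  have cl: "G w w'" if "w \<in> later I G \<rho> b" "w' \<in> later I G \<rho> b" "w \<noteq> w'" for w w'
    using G b(1) that by (simp add: perfect_elim_def)
  have g: "G d b'" "G b' d" using cl[of d b'] cl[of b' d] b(2) step.prems(1) ne by simp_all
  have "\<rho> d \<noteq> \<rho> b'" using G I ne by (auto simp: perfect_elim_def inj_on_def)
  moreover have "\<not> \<rho> d < \<rho> b'"
  proof
    assume "\<rho> d < \<rho> b'"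
    then have "(d, b') \<in> later_rel I G \<rho>" using I g by (auto simp: later_rel_def later_def)
    then show False using step by (meson converse_rtrancl_into_rtrancl)
  qed
  ultimately have "d \<in> later I G \<rho> b'" using I g by (auto simp: later_def)
  then show ?case using step by blast
qed

lemma reach_rank: "(i, u) \<in> (later_rel I G \<rho>)\<^sup>* \<Longrightarrow> i = u \<or> \<rho> i < \<rho> u"
  by (induction rule: rtrancl_induct) (auto simp: later_rel_def later_def)

lemma sum_nth_distinct: "distinct xs \<Longrightarrow> (\<Sum>i<length xs. P (xs ! i)) = (\<Sum>x\<in>set xs. P x)"
  by (rule sum.reindex_bij_betw) (simp add: bij_betw_nth)

text \<open>The definition of a basis indexes by positions in a list; distinctness of
  \<open>ts\<close> allows sums over the set of its elements instead.\<close>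

lemma module_basis_mapI:
  assumes d: "distinct ts" and mem: "\<And>t. t \<in> set ts \<Longrightarrow> B t \<in> D"
    and span: "\<And>\<theta>. \<theta> \<in> D \<Longrightarrow> \<exists>h. (\<forall>t\<in>set ts. h t \<in> poly_ring V) \<and> \<theta> = (\<Sum>t\<in>set ts. der_smult (h t) (B t))"
    and ind: "\<And>h t. (\<And>t. t \<in> set ts \<Longrightarrow> h t \<in> poly_ring V) \<Longrightarrow>
       (\<Sum>t\<in>set ts. der_smult (h t) (B t)) = 0 \<Longrightarrow> t \<in> set ts \<Longrightarrow> h t = 0"
  shows "module_basis V D (map B ts)"
  unfolding module_basis_def
proof (intro conjI ballI allI impI)
  show "set (map B ts) \<subseteq> D" using mem by auto
next
  fix \<theta> assume "\<theta> \<in> D"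
  then obtain h where h: "\<forall>t\<in>set ts. h t \<in> poly_ring V" "\<theta> = (\<Sum>t\<in>set ts. der_smult (h t) (B t))"
    using span by blast
  show "\<exists>g. (\<forall>i<length (map B ts). g i \<in> poly_ring V) \<and>
      \<theta> = (\<Sum>i<length (map B ts). der_smult (g i) (map B ts ! i))"
    using h sum_nth_distinct[OF d, of "\<lambda>t. der_smult (h t) (B t)"]
    by (intro exI[of _ "\<lambda>i. h (ts ! i)"]) auto
next
  fix g i assume g: "(\<forall>i<length (map B ts). g i \<in> poly_ring V) \<and>
      (\<Sum>i<length (map B ts). der_smult (g i) (map B ts ! i)) = 0" and i: "i < length (map B ts)"
  define h where "h t = g (THE i. i < length ts \<and> ts ! i = t)" for t
  have h: "h (ts ! i) = g i" if "i < length ts" for i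
  proof -
    have "(THE k. k < length ts \<and> ts ! k = ts ! i) = i"
      using d that by (intro the_equality) (auto simp: nth_eq_iff_index_eq)
    then show ?thesis by (simp add: h_def)
  qed
  have "(\<Sum>t\<in>set ts. der_smult (h t) (B t)) = (\<Sum>i<length ts. der_smult (h (ts ! i)) (B (ts ! i)))"
    using sum_nth_distinct[OF d, of "\<lambda>t. der_smult (h t) (B t)"] by simp
  also have "\<dots> = 0" using g h by simp
  finally have "(\<Sum>t\<in>set ts. der_smult (h t) (B t)) = 0" .
  moreover have "h t \<in> poly_ring V" if "t \<in> set ts" for t
    using that g h by (auto simp: in_set_conv_nth)
  ultimately have "h (ts ! i) = 0" by (intro ind) (use i in auto)
  then show "g i = 0" using h i by simp
qed

context braid
begin

lemma pdvd_L_iff: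
  assumes "b \<in> I" "d \<in> I" "b \<noteq> d" "h \<in> poly_ring V"
  shows "pdvd V (L b d) h \<longleftrightarrow> (\<forall>x\<in>V. a b x = a d x \<longrightarrow> h x = 0)"
proof
  assume "pdvd V (L b d) h"
  then show "\<forall>x\<in>V. a b x = a d x \<longrightarrow> h x = 0" by (auto simp: pdvd_def fun_app L_app)
next
  assume "\<forall>x\<in>V. a b x = a d x \<longrightarrow> h x = 0"
  then show "pdvd V (L b d) h"
    using assms by (intro pdvd_if_vanishes L_dual L_nonzero) (auto simp: L_app)
qed

text \<open>The forms \<open>a u - a w\<close> are pairwise prime, as a generic point of one
  hyperplane avoids the others; so the factors can be divided out one after another.\<close>

lemma prod_L_dvd:
  assumes "finite S" "S \<subseteq> I - {u}" "u \<in> I" "h \<in> poly_ring V"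
    "\<And>w x. w \<in> S \<Longrightarrow> x \<in> V \<Longrightarrow> a w x = a u x \<Longrightarrow> h x = 0"
  shows "\<exists>r\<in>poly_ring V. \<forall>x\<in>V. h x = (\<Prod>w\<in>S. a u x - a w x) * r x"
  using assms(1,2,5)
proof (induction S rule: finite_induct)
  case empty
  then show ?case using assms(4) by auto
next
  case (insert w S)
  have "\<exists>r\<in>poly_ring V. \<forall>x\<in>V. h x = (\<Prod>w\<in>S. a u x - a w x) * r x"
    by (rule insert.IH) (use insert.prems in auto)
  then obtain r where r: "r \<in> poly_ring V" "\<And>x. x \<in> V \<Longrightarrow> h x = (\<Prod>w\<in>S. a u x - a w x) * r x"
    by blast
  let ?Q = "ext0 V (\<lambda>x. \<Prod>w\<in>S. a u x - a w x)"
  have Q: "?Q \<in> poly_ring V"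
    using insert.prems(1) assms(3) by (intro polyfun_ext0 polyfun_prod polyfun_diff polyfun_dual a_dual) auto
  have w: "w \<in> I" "w \<noteq> u" using insert by auto
  obtain x where x: "x \<in> V" "a w x = a u x" "\<forall>i\<in>I. \<forall>j\<in>I. a i x = a j x \<longrightarrow> i = j \<or> {i, j} = {w, u}"
    using generic_on[OF w(1) assms(3)] by blast
  have "a u x - a w' x \<noteq> 0" if "w' \<in> S" for w'
  proof -
    have "w' \<in> I" "w' \<noteq> u" "w' \<noteq> w" using that insert by auto
    then show ?thesis using x(3) assms(3) by (auto simp: doubleton_eq_iff)
  qed
  then have "?Q x \<noteq> 0" using x(1) insert(1) by simp
  moreover have "pdvd V (L w u ^ 1) (?Q * r)"
    using insert.prems(2)[of w] r Q w assms(3)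
    by (simp add: pdvd_L_iff poly_ring.mult fun_app)
  moreover have "L w u x = 0" using x by (simp add: L_app)
  ultimately have "pdvd V (L w u ^ 1) r"
    using pdvd_power_cancel[OF L_dual r(1) Q x(1) _ _ L_nonzero] w assms(3) by blast
  then obtain q where "q \<in> poly_ring V" "r = L w u * q" by (auto simp: pdvd_def)
  then show ?case using r(2) insert(1,2) by (auto simp: fun_app L_app mult_ac)
qed

section \<open>Splines on a chordal graph\<close>

text \<open>The set of all \<open>i\<close> from which \<open>u\<close> can be reached along later neighbours is the support
  of \<open>phi G \<rho> u\<close>; a later neighbour of a vertex of the support that leaves it lies in
  \<open>later I G \<rho> u\<close>, where the product vanishes.\<close>

definition phi :: "('i \<Rightarrow> 'i \<Rightarrow> bool) \<Rightarrow> ('i \<Rightarrow> nat) \<Rightarrow> 'i \<Rightarrow> 'i \<Rightarrow> 'k fn" where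
  "phi G \<rho> u i = (if (i, u) \<in> (later_rel I G \<rho>)\<^sup>*
     then ext0 V (\<lambda>x. \<Prod>w\<in>later I G \<rho> u. a i x - a w x) else 0)"

definition spline :: "('i \<Rightarrow> 'i \<Rightarrow> bool) \<Rightarrow> ('i \<Rightarrow> 'k fn) \<Rightarrow> bool" where
  "spline G c \<longleftrightarrow> (\<forall>b\<in>I. \<forall>d\<in>I. G b d \<longrightarrow> (\<forall>x\<in>V. a b x = a d x \<longrightarrow> c b x = c d x))"

lemma finite_later: "finite (later I G \<rho> u)"
  using finI later_subset finite_subset by metis

lemma phi_homogeneous: "i \<in> I \<Longrightarrow> homogeneous V (card (later I G \<rho> u)) (phi G \<rho> u i)"
proof -
  assume i: "i \<in> I"
  have "homfun V (\<Sum>w\<in>later I G \<rho> u. 1) (\<lambda>x. \<Prod>w\<in>later I G \<rho> u. a i x - a w x)"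
    using i later_subset[of I G \<rho> u] by (intro homfun_prod finite_later homfun_L) auto
  then show ?thesis by (simp add: phi_def homfun_def homogeneous_zero)
qed

lemma phi_poly: "i \<in> I \<Longrightarrow> phi G \<rho> u i \<in> poly_ring V"
  using phi_homogeneous homogeneous_poly_ring by blast

lemma phi_later: "\<rho> u < \<rho> i \<Longrightarrow> phi G \<rho> u i = 0"
  using reach_rank[of i u I G \<rho>] by (auto simp: phi_def)

lemma phi_self: "x \<in> V \<Longrightarrow> phi G \<rho> u u x = (\<Prod>w\<in>later I G \<rho> u. a u x - a w x)"
  by (simp add: phi_def)

lemma phi_self_nonzero:
  assumes "u \<in> I"
  shows "phi G \<rho> u u \<noteq> 0"
proof -
  obtain x where x: "x \<in> V" "\<forall>i\<in>I. \<forall>j\<in>I. a i x = a j x \<longrightarrow> i = j \<or> {i, j} = {u, u}"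
    using generic_on[OF assms assms] by blast
  have "a u x - a w x \<noteq> 0" if "w \<in> later I G \<rho> u" for w
    using x(2) that assms by (auto simp: later_def)
  then have "phi G \<rho> u u x \<noteq> 0" using x(1) finite_later by (simp add: phi_self)
  then show ?thesis by (auto simp: fun_app)
qed

lemma phi_spline:
  assumes G: "perfect_elim I G \<rho>"
  shows "spline G (phi G \<rho> u)"
proof -
  have *: "phi G \<rho> u b x = phi G \<rho> u d x"
    if bd: "b \<in> I" "d \<in> I" "G b d" "\<rho> b < \<rho> d" and x: "x \<in> V" "a b x = a d x" for b d x
  proof -
    have d: "d \<in> later I G \<rho> b" using bd by (simp add: later_def)
    consider "(d, u) \<in> (later_rel I G \<rho>)\<^sup>*"
      | "(d, u) \<notin> (later_rel I G \<rho>)\<^sup>*" "(b, u) \<in> (later_rel I G \<rho>)\<^sup>*"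
      | "(d, u) \<notin> (later_rel I G \<rho>)\<^sup>*" "(b, u) \<notin> (later_rel I G \<rho>)\<^sup>*" by blast
    then show ?thesis
    proof cases
      case 1
      have "(b, d) \<in> later_rel I G \<rho>" using bd d by (simp add: later_rel_def)
      then have "(b, u) \<in> (later_rel I G \<rho>)\<^sup>*" using 1 by (meson converse_rtrancl_into_rtrancl)
      then show ?thesis using 1 x by (simp add: phi_def)
    next
      case 2
      then have "d \<in> later I G \<rho> u" using later_reach[OF G 2(2) d] by blast
      then show ?thesis using 2 x finite_later by (auto simp: phi_def fun_app)
    qed (simp add: phi_def fun_app)
  qed
  show ?thesis unfolding spline_def
  proof (intro ballI impI)
    fix b d x assume bd: "b \<in> I" "d \<in> I" "G b d" and x: "x \<in> V" "a b x = a d x"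
    have "G d b" using G bd by (auto simp: perfect_elim_def)
    moreover have "b = d \<or> \<rho> b < \<rho> d \<or> \<rho> d < \<rho> b"
      using G bd by (metis inj_onD linorder_neqE_nat perfect_elim_def)
    ultimately show "phi G \<rho> u b x = phi G \<rho> u d x" using * bd x by metis
  qed
qed

text \<open>Triangular elimination from the top rank downwards. At the highest remaining vertex
  \<open>u\<close> all later neighbours carry 0, so the spline condition makes \<open>c u\<close> a
  multiple of \<open>phi G \<rho> u u\<close>; subtracting the same multiple of
  \<open>phi G \<rho> u\<close> clears \<open>u\<close> and leaves the higher ranks alone.\<close>

lemma spline_span:
  assumes G: "perfect_elim I G \<rho>"
    and c: "\<And>i. i \<in> I \<Longrightarrow> c i \<in> poly_ring V" "spline G c" "\<And>w. w \<in> I \<Longrightarrow> m \<le> \<rho> w \<Longrightarrow> c w = 0"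
  shows "\<exists>h. (\<forall>u. h u \<in> poly_ring V) \<and> (\<forall>i\<in>I. c i = (\<Sum>u\<in>{u \<in> I. \<rho> u < m}. h u * phi G \<rho> u i))"
  using c
proof (induction m arbitrary: c)
  case 0
  then show ?case by (intro exI[of _ "\<lambda>_. 0"]) (auto simp: poly_ring_zero)
next
  case (Suc m)
  show ?case
  proof (cases "\<exists>u\<in>I. \<rho> u = m")
    case False
    then have "c w = 0" if "w \<in> I" "m \<le> \<rho> w" for w
      using Suc.prems(3)[of w] that by (metis le_neq_implies_less Suc_leI)
    moreover have "{u \<in> I. \<rho> u < Suc m} = {u \<in> I. \<rho> u < m}" using False less_Suc_eq by auto
    ultimately show ?thesis using Suc.IH[OF Suc.prems(1,2)] by simp
  next
    case True
    then obtain u where u: "u \<in> I" "\<rho> u = m" by blast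
    have uniq: "w = u" if "w \<in> I" "\<rho> w = m" for w
      using G u that by (auto simp: perfect_elim_def inj_on_def)
    have "\<exists>r\<in>poly_ring V. \<forall>x\<in>V. c u x = (\<Prod>w\<in>later I G \<rho> u. a u x - a w x) * r x"
    proof (rule prod_L_dvd[OF finite_later _ u(1)])
      show "later I G \<rho> u \<subseteq> I - {u}" by (auto simp: later_def)
      show "c u \<in> poly_ring V" using Suc.prems(1) u by blast
      show "c u x = 0" if w: "w \<in> later I G \<rho> u" and x: "x \<in> V" "a w x = a u x" for w x
      proof -
        have "w \<in> I" "G u w" "c w = 0" using w Suc.prems(3)[of w] u by (auto simp: later_def)
        then show ?thesis using Suc.prems(2) u x by (auto simp: spline_def fun_app)
      qed
    qed
    then obtain r where r: "r \<in> poly_ring V" "\<And>x. x \<in> V \<Longrightarrow> c u x = phi G \<rho> u u x * r x"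
      by (auto simp: phi_self)
    define c' where "c' i = c i - r * phi G \<rho> u i" for i
    have c'P: "c' i \<in> poly_ring V" if "i \<in> I" for i
      unfolding c'_def using that r by (intro poly_ring_minus Suc.prems(1) poly_ring.mult phi_poly)
    have "spline G c'"
      using Suc.prems(2) phi_spline[OF G, of u] by (simp add: spline_def c'_def fun_app)
    moreover have "c' w = 0" if "w \<in> I" "m \<le> \<rho> w" for w
    proof (cases "w = u")
      case True
      show ?thesis unfolding True
        using r u by (intro poly_ring_eqI[OF c'P poly_ring_zero]) (simp_all add: c'_def fun_app)
    next
      case False
      then have "m < \<rho> w" using uniq that by (metis le_neq_implies_less)
      then show ?thesis using Suc.prems(3)[of w] that phi_later[of \<rho> u w G] u by (simp add: c'_def)
    qed
    ultimately have "\<exists>h. (\<forall>u. h u \<in> poly_ring V) \<and>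
        (\<forall>i\<in>I. c' i = (\<Sum>u\<in>{u \<in> I. \<rho> u < m}. h u * phi G \<rho> u i))"
      by (intro Suc.IH c'P)
    then obtain h where h: "\<And>u. h u \<in> poly_ring V"
      "\<And>i. i \<in> I \<Longrightarrow> c' i = (\<Sum>u\<in>{u \<in> I. \<rho> u < m}. h u * phi G \<rho> u i)"
      by blast
    have S: "{u \<in> I. \<rho> u < Suc m} = insert u {u \<in> I. \<rho> u < m}"
    proof (intro set_eqI)
      fix w
      show "w \<in> {u \<in> I. \<rho> u < Suc m} \<longleftrightarrow> w \<in> insert u {u \<in> I. \<rho> u < m}"
        using u uniq[of w] by (cases "\<rho> w = m") (auto simp: less_Suc_eq)
    qed
    have "c i = (\<Sum>v\<in>{u \<in> I. \<rho> u < Suc m}. (h(u := r)) v * phi G \<rho> v i)" if i: "i \<in> I" for i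
    proof -
      have "c i = r * phi G \<rho> u i + c' i" by (simp add: c'_def)
      also have "c' i = (\<Sum>v\<in>{u \<in> I. \<rho> u < m}. (h(u := r)) v * phi G \<rho> v i)"
        unfolding h(2)[OF i] using u by (intro sum.cong) auto
      finally show ?thesis unfolding S using finI u by (subst sum.insert) auto
    qed
    then show ?thesis using h(1) r by (intro exI[of _ "h(u := r)"]) auto
  qed
qed

lemma comb_sum:
  "comb n (\<lambda>i. \<Sum>u\<in>S. h u * F u i) = (\<Sum>u\<in>S. der_smult (h u) (comb n (F u)))"
proof (intro ext)
  fix q x
  have "(\<Sum>i\<in>I. (\<Sum>u\<in>S. h u x * F u i x) * th n i q x) = (\<Sum>i\<in>I. \<Sum>u\<in>S. h u x * (F u i x * th n i q x))"
    by (simp add: sum_distrib_right mult.assoc)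
  also have "\<dots> = (\<Sum>u\<in>S. \<Sum>i\<in>I. h u x * (F u i x * th n i q x))" by (rule sum.swap)
  finally show "comb n (\<lambda>i. \<Sum>u\<in>S. h u * F u i) q x = (\<Sum>u\<in>S. der_smult (h u) (comb n (F u))) q x"
    by (simp add: comb_def der_smult_def fun_app sum_distrib_left)
qed

lemma comb_cong: "(\<And>i. i \<in> I \<Longrightarrow> c i = c' i) \<Longrightarrow> comb n c = comb n c'"
  by (simp add: comb_def cong: sum.cong)

section \<open>Bases for chordal multiplicities\<close>

definition basis_elt where
  "basis_elt n G \<rho> t = (case t of Inl u \<Rightarrow> comb n (phi G \<rho> u) | Inr k \<Rightarrow> pd (f k))"

lemma pd_f_y: "k \<in> K \<Longrightarrow> l \<in> K \<Longrightarrow> pd (f k) (y l) = const_on V (of_bool (l = k))"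
  by (simp add: pd_linear y_dual y_f)

lemma sum_pd_f_y:
  assumes "l \<in> K" "x \<in> V"
  shows "(\<Sum>k\<in>K. h k x * pd (f k) (y l) x) = h l x"
proof -
  have "(\<Sum>k\<in>K. h k x * pd (f k) (y l) x) = (\<Sum>k\<in>K. if l = k then h k x else 0)"
    using assms by (intro sum.cong) (auto simp: pd_f_y)
  then show ?thesis using assms finK by simp
qed

lemma const_on_0: "const_on V 0 = 0"
  by (auto simp: const_on_def fun_app)

lemma pd_f_L: "b \<in> I \<Longrightarrow> c \<in> I \<Longrightarrow> pd (f k) (L b c) = 0"
  by (simp add: pd_linear L_dual L_f const_on_0)

text \<open>The relation among the universal derivations is used up by making coefficients 0 at the
  last vertex \<open>z\<close>; the splines that remain are spanned by \<open>phi G \<rho> u\<close>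
  with \<open>u\<close> other than \<open>z\<close>. The order of \<open>ts\<close> is left open
  because the Euler multiplicity distinguishes the first two elements of a basis.\<close>

lemma chordal_basis:
  assumes G: "perfect_elim I G \<rho>" and z: "z \<in> I" "\<And>u. u \<in> I \<Longrightarrow> \<rho> u \<le> \<rho> z"
    and A: "braid_arr V I a \<mu> A"
    and \<mu>: "\<And>b c. b \<in> I \<Longrightarrow> c \<in> I \<Longrightarrow> b \<noteq> c \<Longrightarrow> \<mu> b c = n b + n c + of_bool (G b c)"
    and ts: "distinct ts" "set ts = (I - {z}) <+> K"
  shows "module_basis V (log_der V A) (map (basis_elt n G \<rho>) ts)"
proof (rule module_basis_mapI[OF ts(1)])
  have Iz: "{u \<in> I. \<rho> u < \<rho> z} = I - {z}"
    using G z by (auto simp: perfect_elim_def inj_on_def order_less_le)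
  have fin: "finite (I - {z})" using finI by simp
  have mem_comb: "comb n c \<in> log_der V A" if c: "\<And>i. i \<in> I \<Longrightarrow> c i \<in> poly_ring V" "spline G c" for c
    unfolding log_der_iff[OF A]
  proof (intro conjI ballI impI comb_Der c(1))
    fix b d assume bd: "b \<in> I" "d \<in> I" "b \<noteq> d"
    show "pdvd V (L b d ^ \<mu> b d) (comb n c (L b d))"
    proof (cases "G b d")
      case True
      have "pdvd V (L b d) (c d - c b)"
        using True bd c by (subst pdvd_L_iff) (auto simp: poly_ring_minus spline_def fun_app)
      then have "pdvd V (L b d ^ (n b + n d + 1)) (comb n c (L b d))"
        using comb_pdvd(2)[of b d c n] bd c(1) by blast
      then show ?thesis using True \<mu>[OF bd] by simp
    next
      case False
      then show ?thesis using comb_pdvd(1)[OF bd c(1)] \<mu>[OF bd] by simp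
    qed
  qed
  show "basis_elt n G \<rho> t \<in> log_der V A" if t: "t \<in> set ts" for t
  proof (cases t)
    case (Inl u)
    then show ?thesis using mem_comb[OF phi_poly phi_spline[OF G]] by (simp add: basis_elt_def)
  next
    case (Inr k)
    have "pd (f k) \<in> log_der V A"
      unfolding log_der_iff[OF A] pdvd_def using poly_ring_zero
      by (auto simp: pd_Der pd_f_L intro!: bexI[of _ 0])
    then show ?thesis using Inr by (simp add: basis_elt_def)
  qed
  have sum_ts: "(\<Sum>t\<in>set ts. der_smult (h t) (basis_elt n G \<rho> t)) =
      comb n (\<lambda>i. \<Sum>u\<in>I - {z}. h (Inl u) * phi G \<rho> u i) + (\<Sum>k\<in>K. der_smult (h (Inr k)) (pd (f k)))" for h
    unfolding ts(2) by (subst sum.Plus[OF fin finK]) (simp add: basis_elt_def comp_def comb_sum)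
  show "\<exists>h. (\<forall>t\<in>set ts. h t \<in> poly_ring V) \<and> \<theta> = (\<Sum>t\<in>set ts. der_smult (h t) (basis_elt n G \<rho> t))"
    if \<theta>: "\<theta> \<in> log_der V A" for \<theta>
  proof -
    have \<theta>D: "\<theta> \<in> Der V" using \<theta> by (simp add: log_der_def)
    \<comment> \<open>\<eta>1 carries the values of \<theta> on the additional coordinates and kills
      every \<open>L b d\<close>, so the difference kills the \<open>y k\<close> and is open to
      \<open>generates\<close>.\<close>
    define \<eta>1 where "\<eta>1 = (\<Sum>k\<in>K. der_smult (\<theta> (y k)) (pd (f k)))"
    have yP: "\<theta> (y k) \<in> poly_ring V" if "k \<in> K" for k
      using that by (intro Der_poly[OF \<theta>D] poly_ring.linear y_dual)
    have \<eta>1D: "\<eta>1 \<in> Der V" unfolding \<eta>1_def by (intro Der_sum Der_smult pd_Der yP) auto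
    define \<eta> where "\<eta> = \<theta> + der_smult (const_on V (-1)) \<eta>1"
    have \<eta>D: "\<eta> \<in> Der V" unfolding \<eta>_def by (intro Der_plus Der_smult \<theta>D \<eta>1D poly_ring.const)
    have \<eta>1L: "\<eta>1 (L b d) = 0" if "b \<in> I" "d \<in> I" for b d
      using that by (auto simp: \<eta>1_def fun_app der_smult_def pd_f_L fun_eq_iff)
    have \<eta>1y: "\<eta>1 (y l) = \<theta> (y l)" if "l \<in> K" for l
    proof (rule poly_ring_eqI[of _ V])
      show "\<eta>1 (y l) x = \<theta> (y l) x" if "x \<in> V" for x
        using that \<open>l \<in> K\<close> sum_pd_f_y[of l x "\<lambda>k. \<theta> (y k)"]
        by (simp add: \<eta>1_def fun_app der_smult_def)
    qed (use that in \<open>auto intro!: Der_poly[OF \<eta>1D] yP poly_ring.linear[OF y_dual]\<close>)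
    have \<eta>L: "\<eta> (L b d) = \<theta> (L b d)" if "b \<in> I" "d \<in> I" for b d
      using that by (auto simp: \<eta>_def fun_app der_smult_def \<eta>1L fun_eq_iff)
    have \<eta>y: "\<eta> (y l) = 0" if "l \<in> K" for l
    proof (rule poly_ring_eqI[of _ V])
      show "\<eta> (y l) x = 0 x" if "x \<in> V" for x
        using that \<open>l \<in> K\<close> by (simp add: \<eta>_def fun_app der_smult_def \<eta>1y)
    qed (use that in \<open>auto intro!: Der_poly[OF \<eta>D] poly_ring.linear[OF y_dual] poly_ring_zero\<close>)
    have dvd: "pdvd V (L b d ^ \<mu> b d) (\<eta> (L b d))" if "b \<in> I" "d \<in> I" "b \<noteq> d" for b d
      using \<theta> that unfolding log_der_iff[OF A] by (simp add: \<eta>L)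
    have "pdvd V (L b d ^ (n b + n d)) (\<eta> (L b d))" if bd: "b \<in> I" "d \<in> I" "b \<noteq> d" for b d
    proof -
      obtain h where "h \<in> poly_ring V" "\<eta> (L b d) = L b d ^ (n b + n d) * (L b d ^ of_bool (G b d) * h)"
        using dvd[OF bd] \<mu>[OF bd] by (auto simp: pdvd_def power_add mult.assoc)
      then show ?thesis
        using poly_ring_pow_mult[OF L_poly[OF bd(1,2)]] unfolding pdvd_def by blast
    qed
    then have "\<exists>c. (\<forall>i. c i \<in> poly_ring V) \<and> \<eta> = comb n c"
      using generates_indep[OF z(1), of n] \<eta>y
      by (intro generates_def [THEN iffD1, rule_format] \<eta>D) auto
    then obtain c where c: "\<And>i. c i \<in> poly_ring V" "\<eta> = comb n c" by blast
    have "spline G (\<lambda>i. c i - c z)"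
      unfolding spline_def
    proof (intro ballI impI)
      fix b d x assume bd: "b \<in> I" "d \<in> I" "G b d" and x: "x \<in> V" "a b x = a d x"
      show "(c b - c z) x = (c d - c z) x"
      proof (cases "b = d")
        case False
        have "pdvd V (L b d ^ (n b + n d + 1)) (comb n c (L b d))"
          using dvd[OF bd(1,2) False] \<mu>[OF bd(1,2) False] bd c(2) by simp
        then have "pdvd V (L b d) (c d - c b)"
          using comb_pdvd(2)[of b d c n] bd(1,2) False c(1) by blast
        then have "(c d - c b) x = 0"
          using pdvd_L_iff[OF bd(1,2) False poly_ring_minus[OF c(1) c(1)]] x by blast
        then show ?thesis by (simp add: fun_app)
      qed simp
    qed
    moreover have "c w - c z = 0" if "w \<in> I" "\<rho> z \<le> \<rho> w" for w
      using that z G by (metis diff_self inj_onD le_antisym perfect_elim_def)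
    ultimately have "\<exists>h. (\<forall>u. h u \<in> poly_ring V) \<and>
        (\<forall>i\<in>I. c i - c z = (\<Sum>u\<in>{u \<in> I. \<rho> u < \<rho> z}. h u * phi G \<rho> u i))"
      by (intro spline_span[OF G] poly_ring_minus c(1))
    then obtain h where h: "\<And>u. h u \<in> poly_ring V"
      "\<And>i. i \<in> I \<Longrightarrow> c i - c z = (\<Sum>u\<in>I - {z}. h u * phi G \<rho> u i)"
      unfolding Iz by blast
    have "comb n c = comb n c - comb n (\<lambda>_. c z)"
      using comb_const[of "\<lambda>_. c z" "c z" n] z c(1) by auto
    also have "\<dots> = comb n (\<lambda>i. c i - c z)" using z c(1) by (intro comb_diff) auto
    also have "\<dots> = comb n (\<lambda>i. \<Sum>u\<in>I - {z}. h u * phi G \<rho> u i)" using h(2) by (rule comb_cong)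
    finally have \<eta>h: "\<eta> = comb n (\<lambda>i. \<Sum>u\<in>I - {z}. h u * phi G \<rho> u i)" using c(2) by simp
    have "\<theta> = \<eta> + \<eta>1"
    proof (rule Der_coord_eqI[OF z(1) \<theta>D Der_plus[OF \<eta>D \<eta>1D]])
      show "\<theta> (L z i) = (\<eta> + \<eta>1) (L z i)" if "i \<in> I" for i
        using that z by (simp add: plus_fun_apply \<eta>L \<eta>1L)
      show "\<theta> (y k) = (\<eta> + \<eta>1) (y k)" if "k \<in> K" for k
        using that by (simp add: plus_fun_apply \<eta>y \<eta>1y)
    qed
    then have "\<theta> = (\<Sum>t\<in>set ts. der_smult (case_sum h (\<lambda>k. \<theta> (y k)) t) (basis_elt n G \<rho> t))"
      unfolding sum_ts by (simp add: \<eta>h \<eta>1_def)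
    moreover have "case_sum h (\<lambda>k. \<theta> (y k)) t \<in> poly_ring V" if "t \<in> set ts" for t
      using that ts(2) h(1) yP by auto
    ultimately show ?thesis by blast
  qed
  show "h t = 0" if h: "\<And>t. t \<in> set ts \<Longrightarrow> h t \<in> poly_ring V"
    "(\<Sum>t\<in>set ts. der_smult (h t) (basis_elt n G \<rho> t)) = 0" and t: "t \<in> set ts" for h t
  proof -
    let ?c = "\<lambda>i. \<Sum>u\<in>I - {z}. h (Inl u) * phi G \<rho> u i"
    have hP: "h (Inl u) \<in> poly_ring V" if "u \<in> I - {z}" for u using h(1) that ts(2) by auto
    have cP: "?c i \<in> poly_ring V" if "i \<in> I" for i
      using that hP by (intro poly_ring_sum poly_ring.mult phi_poly) auto
    have hK: "h (Inr l) = 0" if l: "l \<in> K" for l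
    proof (rule poly_ring_eqI[of _ V])
      show "h (Inr l) \<in> poly_ring V" using h(1) l ts(2) by auto
      fix x assume x: "x \<in> V"
      have "0 = (comb n ?c + (\<Sum>k\<in>K. der_smult (h (Inr k)) (pd (f k)))) (y l) x"
        using h(2) unfolding sum_ts by (simp add: fun_app)
      also have "\<dots> = h (Inr l) x"
        using sum_pd_f_y[OF l x, of "\<lambda>k. h (Inr k)"] comb_y[OF l, of n ?c]
        by (simp add: fun_app der_smult_def)
      finally show "h (Inr l) x = 0 x" by (simp add: fun_app)
    qed (rule poly_ring_zero)
    have "(\<Sum>k\<in>K. der_smult (h (Inr k)) (pd (f k))) = 0"
      using hK by (auto intro!: sum.neutral simp: der_smult_def fun_eq_iff fun_app)
    then have "comb n ?c = 0" using h(2) unfolding sum_ts by simp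
    then have "?c i = ?c z" if "i \<in> I" for i
      by (rule generates_indep[OF z(1), of n, THEN conjunct2, unfolded indep_def, rule_format, rotated])
        (use cP that z(1) in auto)
    moreover have "?c z = 0"
    proof (intro sum.neutral ballI)
      fix u assume "u \<in> I - {z}"
      then have "\<rho> u < \<rho> z" using Iz by blast
      then show "h (Inl u) * phi G \<rho> u z = 0" by (simp add: phi_later)
    qed
    ultimately have c0: "?c i = 0" if "i \<in> I" for i using that by simp
    have hI: "h (Inl u) = 0" if "u \<in> I - {z}" for u
      using that
    \<comment> \<open>From high ranks to low: in the coefficient at \<open>u\<close>, the elements
      of lower rank vanish by \<open>phi_later\<close>, and those of higher rank have multiplier 0
      by induction.\<close>
    proof (induction "\<rho> z - \<rho> u" arbitrary: u rule: less_induct)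
      case less
      have u: "u \<in> I" using less.prems by blast
      have "?c u = h (Inl u) * phi G \<rho> u u + (\<Sum>v\<in>I - {z} - {u}. h (Inl v) * phi G \<rho> v u)"
        using less.prems fin by (rule sum.remove[rotated])
      also have "(\<Sum>v\<in>I - {z} - {u}. h (Inl v) * phi G \<rho> v u) = 0"
      proof (rule sum.neutral, rule ballI)
        fix v assume v: "v \<in> I - {z} - {u}"
        have "\<rho> v \<noteq> \<rho> u" using G v u by (auto simp: perfect_elim_def inj_on_def)
        moreover have "h (Inl v) = 0" if "\<rho> u < \<rho> v"
          using less.hyps[of v] v that z(2)[of v] z(2)[OF u] Iz by auto
        ultimately show "h (Inl v) * phi G \<rho> v u = 0"
          using phi_later[of \<rho> v u G] by (cases "\<rho> u < \<rho> v") auto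
      qed
      finally have "phi G \<rho> u u * h (Inl u) = 0" using c0[OF u] by (simp add: mult.commute)
      then show ?case
        using poly_ring_domain[OF phi_poly[OF u] hP[OF less.prems] _ phi_self_nonzero[OF u]] by blast
    qed
    show ?thesis using t ts(2) hI hK by auto
  qed
qed

text \<open>\<open>E n z j\<close> has degree one more than the sum of the \<open>n s\<close>, and
  one derivative is taken.\<close>

lemma comb_has_pdeg:
  assumes z: "z \<in> I" and c: "\<And>i. i \<in> I \<Longrightarrow> homogeneous V p (c i)"
  shows "has_pdeg V ((\<Sum>s\<in>I. n s) + p) (comb n c)"
proof (rule has_pdegI[OF z])
  show "comb n c \<in> Der V" using c homogeneous_poly_ring by (intro comb_Der) blast
  show "homogeneous V ((\<Sum>s\<in>I. n s) + p) (comb n c (L z j))" if j: "j \<in> I" for j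
  proof -
    have "comb n c (L z j) = (\<Sum>i\<in>I. c i * pd (e i) (E n z j))"
      using z j by (auto simp: comb_L fun_app fun_eq_iff)
    moreover have "homogeneous V (p + (\<Sum>s\<in>I. n s)) (c i * pd (e i) (E n z j))" if "i \<in> I" for i
      using pd_homogeneous[OF e_V[of i] E_homogeneous[OF z j, of n]] c[OF that]
      by (intro homogeneous_times) auto
    ultimately show ?thesis by (auto intro: homogeneous_sum simp: add.commute)
  qed
  show "homogeneous V ((\<Sum>s\<in>I. n s) + p) (comb n c (y k))" if "k \<in> K" for k
    using that by (simp add: comb_y homogeneous_zero)
qed

end

lemma (in braid) chordal_exponents:
  assumes G: "perfect_elim I G \<rho>" and z: "z \<in> I" "\<And>u. u \<in> I \<Longrightarrow> \<rho> u \<le> \<rho> z"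
    and A: "braid_arr V I a \<mu> A"
    and \<mu>: "\<And>b c. b \<in> I \<Longrightarrow> c \<in> I \<Longrightarrow> b \<noteq> c \<Longrightarrow> \<mu> b c = n b + n c + of_bool (G b c)"
    and K: "K = {}"
  shows "has_exponents V A (image_mset (\<lambda>u. (\<Sum>s\<in>I. n s) + card (later I G \<rho> u)) (mset_set (I - {z})))"
proof -
  obtain us where us: "distinct us" "set us = I - {z}"
    using finite_distinct_list[of "I - {z}"] finI by auto
  let ?ps = "map (\<lambda>u. (\<Sum>s\<in>I. n s) + card (later I G \<rho> u)) us"
  let ?ts = "map Inl us :: ('i + 'j) list"
  have "distinct ?ts" "set ?ts = (I - {z}) <+> K" using us K by (auto simp: distinct_map)
  then have "module_basis V (log_der V A) (map (basis_elt n G \<rho>) ?ts)"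
    by (intro chordal_basis[OF G z A] \<mu>)
  moreover have "list_all2 (has_pdeg V) ?ps (map (basis_elt n G \<rho>) ?ts)"
    unfolding list.map_comp list_all2_map1 list_all2_map2
    by (rule list.rel_refl_strong) (simp add: basis_elt_def comb_has_pdeg[OF z(1) phi_homogeneous])
  moreover have "mset ?ps = image_mset (\<lambda>u. (\<Sum>s\<in>I. n s) + card (later I G \<rho> u)) (mset_set (I - {z}))"
    using us by (metis mset_map mset_set_set)
  ultimately show ?thesis unfolding has_exponents_def by blast
qed

section \<open>Euler multiplicities\<close>

context poly_space
begin

text \<open>A form vanishing on \<open>Y\<close> is a combination of \<open>y1\<close> and
  \<open>y2\<close>, which the other partial derivatives annihilate.\<close>

lemma partials_vanish:
  assumes co: "coordinates V (y1 # y2 # ys)" and pa: "partials V (y1 # y2 # ys) (\<delta>1 # \<delta>2 # \<delta>s)"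
    and \<beta>: "\<beta> \<in> dual V" "\<And>x. x \<in> V \<Longrightarrow> y1 x = 0 \<Longrightarrow> y2 x = 0 \<Longrightarrow> \<beta> x = 0"
    and \<delta>: "\<delta> \<in> set \<delta>s"
  shows "\<delta> \<beta> = 0"
proof -
  let ?ev = "\<lambda>x. map (\<lambda>y. y x) (y1 # y2 # ys)"
  have y: "y1 \<in> dual V" "y2 \<in> dual V" using co by (auto simp: coordinates_def)
  have img: "?ev ` V = {cs. length cs = length (y1 # y2 # ys)}"
    using co by (simp add: coordinates_def bij_betw_def)
  have ex: "\<exists>x\<in>V. y1 x = p \<and> y2 x = q" for p q
  proof -
    have "p # q # replicate (length ys) 0 \<in> ?ev ` V" unfolding img by simp
    then show ?thesis by auto
  qed
  obtain x1 where x1: "x1 \<in> V" "y1 x1 = 1" "y2 x1 = 0" using ex by blast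
  obtain x2 where x2: "x2 \<in> V" "y1 x2 = 0" "y2 x2 = 1" using ex by blast
  have "\<beta> x = y1 x * \<beta> x1 + y2 x * \<beta> x2" if x: "x \<in> V" for x
  proof -
    let ?w = "x - (y1 x *s x1 + y2 x *s x2)"
    have V: "y1 x *s x1 \<in> V" "y2 x *s x2 \<in> V" "y1 x *s x1 + y2 x *s x2 \<in> V" "?w \<in> V"
      using x x1 x2 by (auto intro!: V_diff V_add V_scale)
    have ev: "\<alpha> ?w = \<alpha> x - (y1 x * \<alpha> x1 + y2 x * \<alpha> x2)" if "\<alpha> \<in> dual V" for \<alpha>
      using V x x1 x2 by (simp add: dual_diff_arg[OF that] dual_add[OF that] dual_scale[OF that])
    have "\<beta> ?w = 0" by (rule \<beta>(2)[OF V(4)]) (simp_all add: ev y x1 x2)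
    then show ?thesis by (simp add: ev \<beta>)
  qed
  then have "\<beta> = const_on V (\<beta> x1) * y1 + const_on V (\<beta> x2) * y2"
    using y \<beta>(1) by (intro poly_ring_eqI[of \<beta> V])
      (auto intro!: poly_ring.add poly_ring.mult poly_ring.const simp: poly_ring.linear fun_app mult.commute)
  moreover have "\<delta> \<in> Der V" using pa \<delta> by (auto simp: partials_def)
  then have "\<delta> (const_on V (\<beta> x1) * y1 + const_on V (\<beta> x2) * y2)
      = const_on V (\<beta> x1) * \<delta> y1 + const_on V (\<beta> x2) * \<delta> y2"
    using y by (simp add: Der_add Der_cmult poly_ring.mult poly_ring.const poly_ring.linear)
  ultimately have "\<delta> \<beta> = const_on V (\<beta> x1) * \<delta> y1 + const_on V (\<beta> x2) * \<delta> y2"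
    by metis
  moreover obtain i where i: "i < length \<delta>s" "\<delta> = \<delta>s ! i" using \<delta> by (auto simp: in_set_conv_nth)
  have len: "length \<delta>s = length ys" using pa by (simp add: partials_def)
  have pa': "((\<delta>1 # \<delta>2 # \<delta>s) ! k) ((y1 # y2 # ys) ! l) = const_on V (if k = l then 1 else 0)"
    if "k < Suc (Suc (length ys))" "l < Suc (Suc (length ys))" for k l
    using pa that by (simp add: partials_def)
  have "\<delta> y1 = const_on V 0" using pa'[of "Suc (Suc i)" 0] i len by simp
  moreover have "\<delta> y2 = const_on V 0" using pa'[of "Suc (Suc i)" 1] i len by simp
  moreover have "const_on V 0 = 0" by (auto simp: const_on_def fun_app)
  ultimately show ?thesis by simp
qed

text \<open>Applied with \<open>W\<close> the hyperplane of restriction: \<psi> vanishes there as a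
  multiple of its form, the \<open>\<delta>s\<close> kill \<beta>, and only the term with \<theta>
  is left.\<close>

lemma module_basis_restrict:
  assumes mb: "module_basis V D (\<theta> # \<psi> # \<delta>s)" and \<eta>: "\<eta> \<in> D"
    and \<delta>: "\<And>\<delta>. \<delta> \<in> set \<delta>s \<Longrightarrow> \<delta> \<beta> = 0" and \<psi>: "\<And>x. x \<in> W \<Longrightarrow> \<psi> \<beta> x = 0"
  shows "\<exists>g\<in>poly_ring V. \<forall>x\<in>W. \<eta> \<beta> x = g x * \<theta> \<beta> x"
proof -
  obtain g where g: "\<forall>i<length (\<theta> # \<psi> # \<delta>s). g i \<in> poly_ring V"
    "\<eta> = (\<Sum>i<length (\<theta> # \<psi> # \<delta>s). der_smult (g i) ((\<theta> # \<psi> # \<delta>s) ! i))"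
    using mb \<eta> unfolding module_basis_def by meson
  have "\<eta> \<beta> x = g 0 x * \<theta> \<beta> x" if x: "x \<in> W" for x
  proof -
    have "\<eta> \<beta> x = g 0 x * \<theta> \<beta> x + (g 1 x * \<psi> \<beta> x + (\<Sum>i<length \<delta>s. g (Suc (Suc i)) x * (\<delta>s ! i) \<beta> x))"
      unfolding g(2) by (simp add: fun_app der_smult_def sum.lessThan_Suc_shift del: sum.lessThan_Suc)
    moreover have "(\<Sum>i<length \<delta>s. g (Suc (Suc i)) x * (\<delta>s ! i) \<beta> x) = 0"
      by (intro sum.neutral ballI) (simp add: \<delta> fun_app)
    ultimately show ?thesis using \<psi>[OF x] by simp
  qed
  then show ?thesis using g(1) by auto
qed

lemma degree_compare:
  assumes "\<And>t. c * t ^ d = poly p t * (t ^ d' * c')" "(c :: complex) \<noteq> 0"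
  shows "d' \<le> d"
proof -
  have "poly (monom c d) t = poly (p * monom c' d') t" for t
    using assms(1)[of t] by (simp add: poly_monom mult_ac)
  then have eq: "monom c d = p * monom c' d'" using poly_eq_poly_eq_iff by blast
  have "p \<noteq> 0 \<and> monom c' d' \<noteq> 0"
    using eq assms(2) by (metis monom_eq_0_iff mult_zero_left mult_zero_right)
  then have "degree (monom c d) = degree p + degree (monom c' d')"
    unfolding eq by (intro degree_mult_eq) auto
  then show ?thesis using \<open>p \<noteq> 0 \<and> monom c' d' \<noteq> 0\<close> assms(2) by (simp add: degree_monom_eq)
qed

text \<open>Uniqueness of the degree: along a line through the origin of \<open>H0\<close> the values
  \<open>\<theta> \<beta>\<close> and \<open>\<theta>' \<beta>\<close> of two admissible derivations are polynomial multiples of each other.\<close>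

lemma euler_multI:
  assumes \<alpha>0: "\<alpha>0 \<in> dual V" "ker_on V \<alpha>0 = H0"
    and co: "coordinates V (y1 # y2 # ys)" and Y: "Y = {x \<in> V. y1 x = 0 \<and> y2 x = 0}"
    and pa: "partials V (y1 # y2 # ys) (\<delta>1 # \<delta>2 # \<delta>s)"
    and mb: "module_basis V (log_der V (localization A Y)) (\<theta> # \<psi> # \<delta>s)"
    and \<theta>: "has_pdeg V d \<theta>" and \<psi>: "has_pdeg V p \<psi>" "\<psi> \<in> der_smult \<alpha>0 ` Der V"
    and \<beta>: "\<beta> \<in> dual V" "\<And>x. x \<in> Y \<Longrightarrow> \<beta> x = 0"
    and x: "x \<in> H0" "\<theta> \<beta> x \<noteq> 0"
  shows "euler_mult V A H0 Y = d"
  unfolding euler_mult_def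
proof (rule the_equality)
  have ker: "\<alpha>0 x = 0" using x(1) \<alpha>0(2) by (auto simp: ker_on_def)
  have "\<theta> \<notin> der_smult \<alpha>0 ` Der V"
  proof
    assume "\<theta> \<in> der_smult \<alpha>0 ` Der V"
    then have "\<theta> \<beta> x = 0" using ker by (auto simp: der_smult_def fun_app)
    then show False using x by simp
  qed
  then have "\<alpha>0 \<in> dual V \<and> ker_on V \<alpha>0 = H0 \<and>
     coordinates V (y1 # y2 # ys) \<and> Y = {x \<in> V. y1 x = 0 \<and> y2 x = 0} \<and>
     partials V (y1 # y2 # ys) (\<delta>1 # \<delta>2 # \<delta>s) \<and>
     module_basis V (log_der V (localization A Y)) (\<theta> # \<psi> # \<delta>s) \<and>
     has_pdeg V d \<theta> \<and> (\<exists>p. has_pdeg V p \<psi>) \<and>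
     \<theta> \<notin> der_smult \<alpha>0 ` Der V \<and> \<psi> \<in> der_smult \<alpha>0 ` Der V"
    by (intro conjI \<alpha>0 co Y pa mb \<theta> \<psi>(2) exI[of _ p] \<psi>(1))
  then show "\<exists>\<alpha>0 y1 y2 ys \<delta>1 \<delta>2 \<delta>s \<theta> \<psi>. \<alpha>0 \<in> dual V \<and> ker_on V \<alpha>0 = H0 \<and>
     coordinates V (y1 # y2 # ys) \<and> Y = {x \<in> V. y1 x = 0 \<and> y2 x = 0} \<and>
     partials V (y1 # y2 # ys) (\<delta>1 # \<delta>2 # \<delta>s) \<and>
     module_basis V (log_der V (localization A Y)) (\<theta> # \<psi> # \<delta>s) \<and>
     has_pdeg V d \<theta> \<and> (\<exists>p. has_pdeg V p \<psi>) \<and>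
     \<theta> \<notin> der_smult \<alpha>0 ` Der V \<and> \<psi> \<in> der_smult \<alpha>0 ` Der V"
    by - (rule exI[of _ \<alpha>0], rule exI[of _ y1], rule exI[of _ y2], rule exI[of _ ys],
        rule exI[of _ \<delta>1], rule exI[of _ \<delta>2], rule exI[of _ \<delta>s],
        rule exI[of _ \<theta>], rule exI[of _ \<psi>], assumption)
next
  fix d'
  assume "\<exists>\<alpha>0 y1 y2 ys \<delta>1 \<delta>2 \<delta>s \<theta> \<psi>. \<alpha>0 \<in> dual V \<and> ker_on V \<alpha>0 = H0 \<and>
     coordinates V (y1 # y2 # ys) \<and> Y = {x \<in> V. y1 x = 0 \<and> y2 x = 0} \<and>
     partials V (y1 # y2 # ys) (\<delta>1 # \<delta>2 # \<delta>s) \<and>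
     module_basis V (log_der V (localization A Y)) (\<theta> # \<psi> # \<delta>s) \<and>
     has_pdeg V d' \<theta> \<and> (\<exists>p. has_pdeg V p \<psi>) \<and>
     \<theta> \<notin> der_smult \<alpha>0 ` Der V \<and> \<psi> \<in> der_smult \<alpha>0 ` Der V"
  then obtain \<alpha>0' y1' y2' ys' \<delta>1' \<delta>2' \<delta>s' \<theta>' \<psi>' where
    \<alpha>0': "\<alpha>0' \<in> dual V" "ker_on V \<alpha>0' = H0" and
    co': "coordinates V (y1' # y2' # ys')" and Y': "Y = {x \<in> V. y1' x = 0 \<and> y2' x = 0}" and
    pa': "partials V (y1' # y2' # ys') (\<delta>1' # \<delta>2' # \<delta>s')" and
    mb': "module_basis V (log_der V (localization A Y)) (\<theta>' # \<psi>' # \<delta>s')" and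
    \<theta>': "has_pdeg V d' \<theta>'" and \<psi>': "\<psi>' \<in> der_smult \<alpha>0' ` Der V"
    by (elim exE conjE)
  let ?D = "log_der V (localization A Y)"
  have mem: "\<theta> \<in> ?D" "\<theta>' \<in> ?D"
    using conjunct1[OF mb[unfolded module_basis_def]] conjunct1[OF mb'[unfolded module_basis_def]]
    by simp_all
  have xV: "x \<in> V" using x \<alpha>0 by (auto simp: ker_on_def)
  have tx: "t *s x \<in> H0" for t
    using ker_subspace[OF \<alpha>0(1)] x(1) \<alpha>0(2) by (simp add: vec.subspace_scale)
  have hom: "\<theta> \<beta> (t *s x) = t ^ d * \<theta> \<beta> x" "\<theta>' \<beta> (t *s x) = t ^ d' * \<theta>' \<beta> x" for t
    using \<theta> \<theta>' \<beta>(1) homogeneous_scale[OF _ xV] by (auto simp: has_pdeg_def)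
  have \<psi>0: "\<psi> \<beta> w = 0" "\<psi>' \<beta> w = 0" if "w \<in> H0" for w
    using that \<psi>(2) \<psi>' \<alpha>0 \<alpha>0' by (auto simp: der_smult_def fun_app ker_on_def)
  have \<delta>0: "\<delta> \<beta> = 0" if "\<delta> \<in> set \<delta>s" for \<delta>
    using that \<beta> Y by (intro partials_vanish[OF co pa]) auto
  have \<delta>0': "\<delta> \<beta> = 0" if "\<delta> \<in> set \<delta>s'" for \<delta>
    using that \<beta> Y' by (intro partials_vanish[OF co' pa']) auto
  have "\<exists>g\<in>poly_ring V. \<forall>w\<in>H0. \<theta>' \<beta> w = g w * \<theta> \<beta> w"
    by (rule module_basis_restrict[OF mb mem(2)]) (simp_all add: \<delta>0 \<psi>0)
  then obtain g where g: "g \<in> poly_ring V" "\<And>w. w \<in> H0 \<Longrightarrow> \<theta>' \<beta> w = g w * \<theta> \<beta> w"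
    by blast
  have "\<exists>g\<in>poly_ring V. \<forall>w\<in>H0. \<theta> \<beta> w = g w * \<theta>' \<beta> w"
    by (rule module_basis_restrict[OF mb' mem(1)]) (simp_all add: \<delta>0' \<psi>0)
  then obtain h where h: "h \<in> poly_ring V" "\<And>w. w \<in> H0 \<Longrightarrow> \<theta> \<beta> w = h w * \<theta>' \<beta> w"
    by blast
  have ne: "\<theta>' \<beta> x \<noteq> 0" using h(2)[OF x(1)] x(2) by auto
  obtain pg where pg: "\<And>t. g (0 + t *s x) = poly pg t" using poly_on_line[OF g(1) V_0 xV] by blast
  obtain ph where ph: "\<And>t. h (0 + t *s x) = poly ph t" using poly_on_line[OF h(1) V_0 xV] by blast
  have "\<theta>' \<beta> x * t ^ d' = poly pg t * (t ^ d * \<theta> \<beta> x)" for t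
    using g(2)[OF tx, of t] pg[of t] by (simp add: hom mult.commute)
  then have "d \<le> d'" using ne by (rule degree_compare)
  moreover have "\<theta> \<beta> x * t ^ d = poly ph t * (t ^ d' * \<theta>' \<beta> x)" for t
    using h(2)[OF tx, of t] ph[of t] by (simp add: hom mult.commute)
  then have "d' \<le> d" using x(2) by (rule degree_compare)
  ultimately show "d' = d" by simp
qed

end

section \<open>Linear coordinates adapted to a braid arrangement\<close>

context braid
begin

text \<open>As \<open>L z z\<close> is 0, the coordinates are indexed by
  \<open>(I - {z}) <+> K\<close>; \<open>dv\<close> gives the dual partial derivatives.\<close>

definition yc :: "'i \<Rightarrow> 'i + 'j \<Rightarrow> 'k fn" where
  "yc z t = (case t of Inl u \<Rightarrow> L z u | Inr k \<Rightarrow> y k)"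

definition dv :: "'i + 'j \<Rightarrow> 'k fn \<Rightarrow> 'k fn" where
  "dv t = (case t of Inl u \<Rightarrow> pd (e u) | Inr k \<Rightarrow> pd (f k))"

lemma dv_Der: "dv t \<in> Der V"
  by (auto simp: dv_def pd_Der split: sum.split)

lemma yc_dual: "z \<in> I \<Longrightarrow> t \<in> (I - {z}) <+> K \<Longrightarrow> yc z t \<in> dual V"
  by (auto simp: yc_def L_dual y_dual)

lemma dv_yc:
  assumes "z \<in> I" "s \<in> (I - {z}) <+> K" "t \<in> (I - {z}) <+> K"
  shows "dv s (yc z t) = const_on V (if s = t then 1 else 0)"
  using assms by (auto simp: dv_def yc_def pd_linear L_dual y_dual L_e L_f y_e y_f)

lemma Der_yc_eqI:
  assumes "z \<in> I" "\<theta> \<in> Der V" "\<eta> \<in> Der V" "\<And>t. t \<in> (I - {z}) <+> K \<Longrightarrow> \<theta> (yc z t) = \<eta> (yc z t)"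
  shows "\<theta> = \<eta>"
proof (rule Der_coord_eqI[OF assms(1-3)])
  show "\<theta> (L z i) = \<eta> (L z i)" if "i \<in> I" for i
  proof (cases "i = z")
    case True
    then have "L z i = const_on V 0" by (simp add: L_def const_on_0)
    then show ?thesis using assms Der_const by metis
  next
    case False
    then show ?thesis using assms(4)[of "Inl i"] that by (auto simp: yc_def)
  qed
  show "\<theta> (y k) = \<eta> (y k)" if "k \<in> K" for k
    using assms(4)[of "Inr k"] that by (auto simp: yc_def)
qed

lemma coordinates_yc:
  assumes z: "z \<in> I" and ts: "distinct ts" "set ts = (I - {z}) <+> K"
  shows "coordinates V (map (yc z) ts)" "partials V (map (yc z) ts) (map dv ts)"
proof -
  have bij: "bij_betw (\<lambda>x. map (\<lambda>y. y x) (map (yc z) ts)) V {cs. length cs = length (map (yc z) ts)}"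
    unfolding bij_betw_def
  proof (intro conjI)
    show "inj_on (\<lambda>x. map (\<lambda>y. y x) (map (yc z) ts)) V"
    proof (rule inj_onI)
      fix x x' assume x: "x \<in> V" "x' \<in> V" "map (\<lambda>y. y x) (map (yc z) ts) = map (\<lambda>y. y x') (map (yc z) ts)"
      then have eq: "yc z t x = yc z t x'" if "t \<in> (I - {z}) <+> K" for t using that ts(2) by auto
      have "x - x' = 0"
      proof (rule sep)
        show "x - x' \<in> V" using x V_diff by blast
        have "L z i x = L z i x'" if "i \<in> I" for i
          using eq[of "Inl i"] that by (cases "i = z") (auto simp: yc_def L_app)
        then have *: "a i (x - x') = a z (x - x')" if "i \<in> I" for i
          using that z x by (simp add: dual_diff_arg[OF a_dual] L_app algebra_simps)
        show "a i (x - x') = a j (x - x')" if "i \<in> I" "j \<in> I" for i j using that *[of i] *[of j] by simp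
        show "y k (x - x') = 0" if "k \<in> K" for k
          using that x eq[of "Inr k"] by (auto simp: dual_diff_arg[OF y_dual] yc_def)
      qed
      then show "x = x'" by simp
    qed
    show "(\<lambda>x. map (\<lambda>y. y x) (map (yc z) ts)) ` V = {cs. length cs = length (map (yc z) ts)}"
    proof (intro equalityI subsetI)
      fix cs :: "complex list" assume "cs \<in> {cs. length cs = length (map (yc z) ts)}"
      then have len: "length cs = length ts" by simp
      define val where "val t = the (map_of (zip ts cs) t)" for t
      have val: "val (ts ! i) = cs ! i" if "i < length ts" for i
        unfolding val_def using map_of_zip_nth[OF len[symmetric] ts(1)] that len by simp
      obtain x where x: "x \<in> V"
        "\<forall>i\<in>I. \<forall>j\<in>I. a i x - a j x = (if i = z then 0 else val (Inl i)) - (if j = z then 0 else val (Inl j))"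
        "\<forall>k\<in>K. y k x = val (Inr k)"
        using surj[of "\<lambda>i. if i = z then 0 else val (Inl i)" "\<lambda>k. val (Inr k)"] by blast
      have "yc z t x = val t" if "t \<in> (I - {z}) <+> K" for t
        using that x(2,3) z by (auto simp: yc_def L_app split: if_splits)
      then have "yc z (ts ! i) x = cs ! i" if "i < length ts" for i
        using val[OF that] nth_mem[OF that] ts(2) by simp
      then have "map (\<lambda>y. y x) (map (yc z) ts) = cs"
        using len by (intro nth_equalityI) auto
      then show "cs \<in> (\<lambda>x. map (\<lambda>y. y x) (map (yc z) ts)) ` V" using x(1) by blast
    qed auto
  qed
  then show "coordinates V (map (yc z) ts)"
    unfolding coordinates_def using yc_dual[OF z] ts(2) by auto
  show "partials V (map (yc z) ts) (map dv ts)"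
    unfolding partials_def
  proof (intro conjI allI impI)
    fix i j assume ij: "i < length (map (yc z) ts)" "j < length (map (yc z) ts)"
    then have "ts ! i \<in> (I - {z}) <+> K" "ts ! j \<in> (I - {z}) <+> K" using ts(2) by (metis length_map nth_mem)+
    then show "(map dv ts ! i) (map (yc z) ts ! j) = const_on V (if i = j then 1 else 0)"
      using ij ts(1) by (simp add: dv_yc[OF z] nth_eq_iff_index_eq)
  qed (auto simp: dv_Der)
qed

lemma der_smult_pd_1: "der_smult (const_on V 1) (pd x) = pd x" if "x \<in> V"
proof
  fix h show "der_smult (const_on V 1) (pd x) h = pd x h"
  proof (cases "h \<in> poly_ring V")
    case True
    then show ?thesis by (simp add: der_smult_def const_mult_poly pd_poly that)
  qed (simp add: der_smult_def pd_def)
qed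

text \<open>Conditions on separate coordinates describe products of rank-one multiarrangements,
  which are the localizations at flats given by two disjoint pairs.\<close>

lemma diagonal_basis:
  assumes z: "z \<in> I" and ts: "distinct ts" "set ts = (I - {z}) <+> K"
    and q: "\<And>t. t \<in> set ts \<Longrightarrow> q t \<in> poly_ring V" "\<And>t. t \<in> set ts \<Longrightarrow> q t \<noteq> 0"
  shows "module_basis V {\<eta> \<in> Der V. \<forall>t\<in>set ts. pdvd V (q t) (\<eta> (yc z t))} (map (\<lambda>t. der_smult (q t) (dv t)) ts)"
    (is "module_basis V ?D _")
proof (rule module_basis_mapI[OF ts(1)])
  have ev: "(\<Sum>t\<in>set ts. der_smult (h t) (der_smult (q t) (dv t))) (yc z s) = q s * h s"
    if s: "s \<in> set ts" and h: "\<And>t. t \<in> set ts \<Longrightarrow> h t \<in> poly_ring V" for h s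
  proof (rule poly_ring_eqI[of _ V])
    have "yc z s \<in> poly_ring V" using s ts(2) by (intro poly_ring.linear yc_dual z) simp
    then show "(\<Sum>t\<in>set ts. der_smult (h t) (der_smult (q t) (dv t))) (yc z s) \<in> poly_ring V"
      by (intro Der_poly[OF Der_sum] Der_smult dv_Der h q(1))
    show "q s * h s \<in> poly_ring V" by (intro poly_ring.mult q(1) h s)
    fix x assume x: "x \<in> V"
    have "(\<Sum>t\<in>set ts. der_smult (h t) (der_smult (q t) (dv t))) (yc z s) x
        = (\<Sum>t\<in>set ts. if t = s then q s x * h s x else 0)"
      unfolding fun_app der_smult_def using s x ts(2) dv_yc[OF z] by (intro sum.cong) auto
    then show "(\<Sum>t\<in>set ts. der_smult (h t) (der_smult (q t) (dv t))) (yc z s) x = (q s * h s) x"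
      using s by (simp add: fun_app)
  qed
  show "der_smult (q t) (dv t) \<in> ?D" if t: "t \<in> set ts" for t
  proof -
    have "pdvd V (q s) (der_smult (q t) (dv t) (yc z s))" if s: "s \<in> set ts" for s
    proof -
      have "der_smult (q t) (dv t) (yc z s) = q s * const_on V (if t = s then 1 else 0)"
        using s t ts(2) dv_yc[OF z, of t s] by (auto simp: der_smult_def const_on_0)
      then show ?thesis unfolding pdvd_def using poly_ring.const by blast
    qed
    then show ?thesis using q t by (auto intro: Der_smult dv_Der)
  qed
  show "\<exists>h. (\<forall>t\<in>set ts. h t \<in> poly_ring V) \<and> \<theta> = (\<Sum>t\<in>set ts. der_smult (h t) (der_smult (q t) (dv t)))"
    if \<theta>: "\<theta> \<in> ?D" for \<theta>
  proof -
    have "\<forall>t\<in>set ts. \<exists>h. h \<in> poly_ring V \<and> \<theta> (yc z t) = q t * h" using \<theta> by (auto simp: pdvd_def)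
    then obtain h where h: "\<And>t. t \<in> set ts \<Longrightarrow> h t \<in> poly_ring V"
      "\<And>t. t \<in> set ts \<Longrightarrow> \<theta> (yc z t) = q t * h t" by metis
    have "\<theta> = (\<Sum>t\<in>set ts. der_smult (h t) (der_smult (q t) (dv t)))"
    proof (rule Der_yc_eqI[OF z])
      show "(\<Sum>t\<in>set ts. der_smult (h t) (der_smult (q t) (dv t))) \<in> Der V"
        using h q by (intro Der_sum Der_smult dv_Der) auto
      show "\<theta> (yc z t) = (\<Sum>t\<in>set ts. der_smult (h t) (der_smult (q t) (dv t))) (yc z t)"
        if "t \<in> (I - {z}) <+> K" for t
        using that ts(2) h(2)[of t] ev[of t h] h(1) by simp
    qed (use \<theta> in auto)
    then show ?thesis using h(1) by blast
  qed
  show "h t = 0" if h: "\<And>t. t \<in> set ts \<Longrightarrow> h t \<in> poly_ring V"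
    "(\<Sum>t\<in>set ts. der_smult (h t) (der_smult (q t) (dv t))) = 0" and t: "t \<in> set ts" for h t
  proof -
    have "q t * h t = 0" using ev[of t h] h t by (simp add: fun_app)
    then show ?thesis using poly_ring_domain[OF q(1)[OF t] h(1)[OF t] _ q(2)[OF t]] by blast
  qed
qed

lemma pdvd_L_sym:
  assumes "b \<in> I" "c \<in> I"
  shows "pdvd V (L b c ^ m) h \<Longrightarrow> pdvd V (L c b ^ m) h"
proof -
  assume "pdvd V (L b c ^ m) h"
  then obtain r where r: "r \<in> poly_ring V" "h = L b c ^ m * r" by (auto simp: pdvd_def)
  have "h = L c b ^ m * (const_on V ((-1) ^ m) * r)"
    unfolding r(2)
  proof (rule poly_ring_eqI[of _ V])
    show "(L b c ^ m * r) x = (L c b ^ m * (const_on V ((-1) ^ m) * r)) x" if "x \<in> V" for x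
    proof -
      have "L b c x ^ m = L c b x ^ m * (-1) ^ m"
        unfolding power_mult_distrib [symmetric] by (simp add: L_app)
      then show ?thesis using that by (simp add: fun_app)
    qed
  qed (intro poly_ring_pow_mult poly_ring.mult[OF poly_ring.const] L_poly assms r(1))+
  then show ?thesis using r poly_ring.mult[OF poly_ring.const r(1)] unfolding pdvd_def by blast
qed

end

section \<open>Restriction to a hyperplane\<close>

text \<open>The essential case: the hyperplanes \<open>bhyp V a i j\<close> meet only in 0.
  Restrictions stay in it, while localizations need additional coordinates.\<close>

locale ess_braid = braid V I a "{} :: 'i set" "\<lambda>_. 0"
  for V :: "(complex ^ 'k) set" and I :: "'i set" and a
begin

lemma ess_sep: "x \<in> V \<Longrightarrow> (\<And>i j. i \<in> I \<Longrightarrow> j \<in> I \<Longrightarrow> a i x = a j x) \<Longrightarrow> x = 0"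
  using sep by blast

lemma ess_surj: "\<exists>x\<in>V. \<forall>i\<in>I. \<forall>j\<in>I. a i x - a j x = c i - c j"
  using surj by blast

lemma restricted_braid:
  assumes "v \<in> I" "j \<in> I" "v \<noteq> j"
  shows "ess_braid (bhyp V a v j) (I - {v}) (\<lambda>i. ext0 (bhyp V a v j) (a i))"
proof unfold_locales
  let ?H = "bhyp V a v j"
  have sub: "?H \<subseteq> V" by (auto simp: bhyp_def)
  show "vec.subspace ?H" using assms by (simp add: bhyp_ker ker_subspace L_dual)
  then have H: "x + x' \<in> ?H" "c *s x \<in> ?H" if "x \<in> ?H" "x' \<in> ?H" for x x' c
    using that by (auto simp: vec.subspace_add vec.subspace_scale)
  show "finite (I - {v})" using finI by simp
  show "ext0 ?H (a i) \<in> dual ?H" if "i \<in> I - {v}" for i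
    using that H sub a_dual[of i] by (auto simp: dual_def subset_iff ext0_def)
  show "x = 0" if x: "x \<in> ?H" and eq: "\<And>i k. i \<in> I - {v} \<Longrightarrow> k \<in> I - {v} \<Longrightarrow> ext0 ?H (a i) x = ext0 ?H (a k) x"
    for x
  proof (rule ess_sep)
    have eq': "a i x = a j x" if "i \<in> I" for i
      using x eq[of i j] that assms by (cases "i = v") (auto simp: bhyp_def)
    show "a i x = a k x" if "i \<in> I" "k \<in> I" for i k using eq'[OF that(1)] eq'[OF that(2)] by simp
  qed (use x sub in auto)
  show "\<exists>x\<in>?H. (\<forall>i\<in>I - {v}. \<forall>k\<in>I - {v}. ext0 ?H (a i) x - ext0 ?H (a k) x = c i - c k) \<and>
      (\<forall>k\<in>{}. (0 :: 'k fn) x = d k)" for c d :: "'i \<Rightarrow> complex"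
  proof -
    obtain x where x: "x \<in> V" "\<And>i k. i \<in> I \<Longrightarrow> k \<in> I \<Longrightarrow> a i x - a k x = (c(v := c j)) i - (c(v := c j)) k"
      using ess_surj[of "c(v := c j)"] by blast
    have "x \<in> ?H" using x(2)[OF assms(1,2)] assms x(1) by (simp add: bhyp_def)
    then show ?thesis using x(2) by (intro bexI[of _ x]) auto
  qed
qed auto

text \<open>The localization at the flat where all of \<open>J\<close> coincide still lives in
  \<open>V\<close>; the forms \<open>L j i\<close> with \<open>i\<close> outside \<open>J\<close>
  complete the coordinates.\<close>

lemma triangle_braid:
  assumes "J \<subseteq> I" "j \<in> J"
  shows "braid V J a (I - J) (\<lambda>i. L j i)"
proof unfold_locales
  show "finite J" "finite (I - J)" using finI assms finite_subset by auto
  show "a i \<in> dual V" if "i \<in> J" for i using that assms a_dual by blast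
  show "L j k \<in> dual V" if "k \<in> I - J" for k using that assms by (intro L_dual) auto
  show "x = 0" if x: "x \<in> V" and eq: "\<And>i k. i \<in> J \<Longrightarrow> k \<in> J \<Longrightarrow> a i x = a k x"
    and 0: "\<And>k. k \<in> I - J \<Longrightarrow> L j k x = 0" for x
  proof (rule ess_sep[OF x])
    have "a i x = a j x" if "i \<in> I" for i
      using eq[of i j] 0[of i] that assms by (cases "i \<in> J") (auto simp: L_app)
    then show "a i x = a k x" if "i \<in> I" "k \<in> I" for i k using that by simp
  qed
  show "\<exists>x\<in>V. (\<forall>i\<in>J. \<forall>k\<in>J. a i x - a k x = c i - c k) \<and> (\<forall>k\<in>I - J. L j k x = d k)"
    for c d :: "'i \<Rightarrow> complex"
  proof -
    let ?c = "\<lambda>i. if i \<in> J then c i else d i + c j"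
    obtain x where x: "x \<in> V" "\<And>i k. i \<in> I \<Longrightarrow> k \<in> I \<Longrightarrow> a i x - a k x = ?c i - ?c k"
      using ess_surj[of ?c] by blast
    show ?thesis
    proof (intro bexI[OF _ x(1)] conjI ballI)
      show "a i x - a k x = c i - c k" if "i \<in> J" "k \<in> J" for i k
        using x(2)[of i k] that assms by auto
      show "L j k x = d k" if "k \<in> I - J" for k
        using x(2)[of k j] that assms by (auto simp: L_app)
    qed
  qed
qed

text \<open>For a flat given by two disjoint pairs only \<open>v\<close>, \<open>j\<close> are kept
  as a braid arrangement. Replacing one additional coordinate by \<open>L q p\<close> makes both
  defining forms of the flat coordinates.\<close>

lemma square_braid:
  assumes "v \<in> I" "j \<in> I" "v \<noteq> j" "p \<in> I - {v, j}" "q \<in> I - {v, j}" "p \<noteq> q"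
  shows "braid V {v, j} a (I - {v, j}) (\<lambda>i. if i = p then L q p else L j i)"
proof unfold_locales
  show "finite {v, j}" "finite (I - {v, j})" using finI by auto
  show "a i \<in> dual V" if "i \<in> {v, j}" for i using that assms a_dual by blast
  show "(if k = p then L q p else L j k) \<in> dual V" if "k \<in> I - {v, j}" for k
    using that assms by (auto intro: L_dual)
  show "x = 0" if x: "x \<in> V" and eq: "\<And>i k. i \<in> {v, j} \<Longrightarrow> k \<in> {v, j} \<Longrightarrow> a i x = a k x"
    and 0: "\<And>k. k \<in> I - {v, j} \<Longrightarrow> (if k = p then L q p else L j k) x = 0" for x
  proof (rule ess_sep[OF x])
    have q: "a q x = a j x" using 0[of q] assms by (auto simp: L_app)
    have "a i x = a j x" if "i \<in> I" for i
      using eq[of v j] 0[of i] that assms q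
      by (cases "i = v"; cases "i = j"; cases "i = p") (auto simp: L_app)
    then show "a i x = a k x" if "i \<in> I" "k \<in> I" for i k using that by simp
  qed
  show "\<exists>x\<in>V. (\<forall>i\<in>{v, j}. \<forall>k\<in>{v, j}. a i x - a k x = c i - c k) \<and>
      (\<forall>k\<in>I - {v, j}. (if k = p then L q p else L j k) x = d k)"
    for c d :: "'i \<Rightarrow> complex"
  proof -
    \<comment> \<open>The coordinate of \<open>q\<close> is \<open>d q + c j\<close>, and
      \<open>p\<close> has to lie another \<open>d p\<close> above it.\<close>
    let ?c = "\<lambda>i. if i \<in> {v, j} then c i else if i = p then d p + d q + c j else d i + c j"
    obtain x where x: "x \<in> V" "\<And>i k. i \<in> I \<Longrightarrow> k \<in> I \<Longrightarrow> a i x - a k x = ?c i - ?c k"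
      using ess_surj[of ?c] by blast
    show ?thesis
    proof (intro bexI[OF _ x(1)] conjI ballI)
      show "a i x - a k x = c i - c k" if "i \<in> {v, j}" "k \<in> {v, j}" for i k
        using x(2)[of i k] that assms by auto
      show "(if k = p then L q p else L j k) x = d k" if "k \<in> I - {v, j}" for k
        using x(2)[of k j] x(2)[of p q] that assms by (auto simp: L_app)
    qed
  qed
qed

text \<open>The map \<open>r\<close> identifies the members of each pair in \<open>ps\<close>. A
  point whose coordinates coincide exactly as \<open>r\<close> prescribes lies on the flat, hence on
  the hyperplane.\<close>

lemma bhyp_contains:
  assumes "b \<in> I" "c \<in> I" "b \<noteq> c"
    and sub: "{x \<in> V. \<forall>(s, t)\<in>set ps. a s x = a t x} \<subseteq> bhyp V a b c"
    and r: "\<And>s t. (s, t) \<in> set ps \<Longrightarrow> s \<in> I \<and> t \<in> I \<and> r s = r t"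
  shows "r b = (r c :: 'i)"
proof -
  obtain h :: "'i \<Rightarrow> nat" where h: "inj_on h (r ` I)"
    using finite_imp_inj_to_nat_seg[of "r ` I"] finI by blast
  obtain x where x: "x \<in> V" "\<And>i k. i \<in> I \<Longrightarrow> k \<in> I \<Longrightarrow> a i x = a k x \<longleftrightarrow> h (r i) = h (r k)"
    using generic_point[of "\<lambda>i. h (r i)"] by blast
  have "x \<in> {x \<in> V. \<forall>(s, t)\<in>set ps. a s x = a t x}" using x r by fastforce
  then have "a b x = a c x" using sub by (auto simp: bhyp_def)
  then have "h (r b) = h (r c)" using x(2) assms by blast
  then show ?thesis using h assms by (auto simp: inj_on_def)
qed

lemma bhyp_eq_iff:
  assumes "b \<in> I" "c \<in> I" "b \<noteq> c" "p \<in> I" "q \<in> I" "p \<noteq> q" "bhyp V a b c = bhyp V a p q"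
  shows "{b, c} = {p, q}"
proof -
  have "{x \<in> V. \<forall>(s, t)\<in>set [(p, q)]. a s x = a t x} \<subseteq> bhyp V a b c"
    using assms(7) by (auto simp: bhyp_def)
  then have "(if b = p then q else b) = (if c = p then q else c)"
    by (rule bhyp_contains[OF assms(1-3), of _ "\<lambda>i. if i = p then q else i"]) (use assms in auto)
  then show ?thesis using assms(3) by (auto split: if_splits)
qed

lemma triangle_contains:
  assumes "b \<in> I" "c \<in> I" "b \<noteq> c" "v \<in> I" "j \<in> I" "w \<in> I"
    "{x \<in> V. a v x = a j x \<and> a w x = a j x} \<subseteq> bhyp V a b c"
  shows "b \<in> {v, j, w} \<and> c \<in> {v, j, w}"
proof -
  have "{x \<in> V. \<forall>(s, t)\<in>set [(v, j), (w, j)]. a s x = a t x} \<subseteq> bhyp V a b c"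
    using assms(7) by auto
  then have "(if b \<in> {v, w} then j else b) = (if c \<in> {v, w} then j else c)"
    by (rule bhyp_contains[OF assms(1-3), of _ "\<lambda>i. if i \<in> {v, w} then j else i"])
      (use assms(4-6) in auto)
  then show ?thesis using assms(3) by (auto split: if_splits)
qed

lemma square_contains:
  assumes "b \<in> I" "c \<in> I" "b \<noteq> c" "v \<in> I" "j \<in> I" "p \<in> I - {v, j}" "q \<in> I - {v, j}" "p \<noteq> q"
    "{x \<in> V. a v x = a j x \<and> a p x = a q x} \<subseteq> bhyp V a b c"
  shows "{b, c} = {v, j} \<or> {b, c} = {p, q}"
proof -
  have "{x \<in> V. \<forall>(s, t)\<in>set [(v, j), (p, q)]. a s x = a t x} \<subseteq> bhyp V a b c"
    using assms(9) by auto
  then have "(if b = v then j else if b = p then q else b) = (if c = v then j else if c = p then q else c)"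
    by (rule bhyp_contains[OF assms(1-3), of _ "\<lambda>i. if i = v then j else if i = p then q else i"])
      (use assms(4-8) in auto)
  then show ?thesis using assms(3,6-8) by (auto split: if_splits)
qed

lemma braid_arr_localization:
  assumes A: "braid_arr V I a \<mu> A"
  shows "braid_arr V I a (\<lambda>b c. if Y \<subseteq> bhyp V a b c then \<mu> b c else 0) (localization A Y)"
  using A by (auto simp: braid_arr_def localization_def)

lemma triangle_localization:
  assumes A: "braid_arr V I a \<mu> A" and I: "v \<in> I" "j \<in> I" "w \<in> I"
    and Y: "Y = {x \<in> V. a v x = a j x \<and> a w x = a j x}"
  shows "braid_arr V {v, j, w} a \<mu> (localization A Y)"
  unfolding braid_arr_def
proof (intro conjI ballI impI)
  fix i k assume ik: "i \<in> {v, j, w}" "k \<in> {v, j, w}" "i \<noteq> k"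
  then have "Y \<subseteq> bhyp V a i k" unfolding Y bhyp_def by auto
  then show "count (localization A Y) (bhyp V a i k) = \<mu> i k"
    using A ik I unfolding localization_def braid_arr_def by auto
next
  fix H assume "H \<in># localization A Y"
  then have H: "H \<in># A" "Y \<subseteq> H" by (auto simp: localization_def)
  then obtain b c where bc: "b \<in> I" "c \<in> I" "b \<noteq> c" "H = bhyp V a b c"
    using A by (auto simp: braid_arr_def)
  then have "b \<in> {v, j, w} \<and> c \<in> {v, j, w}"
    using triangle_contains[OF bc(1-3) I] H(2) unfolding Y by blast
  then show "\<exists>i\<in>{v, j, w}. \<exists>k\<in>{v, j, w}. i \<noteq> k \<and> H = bhyp V a i k" using bc by blast
qed

text \<open>The localization is a product of two rank-one multiarrangements, with powers of
  \<open>L j v\<close> and \<open>L q p\<close> times the dual partial derivatives in its basis. As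
  \<open>\<mu> v j > 0\<close>, the first is a multiple of \<open>L j v\<close>; the second is
  nonzero at a generic point of the hyperplane, so its degree is the multiplicity.\<close>

lemma euler_square:
  assumes A: "braid_arr V I a \<mu> A" and vj: "v \<in> I" "j \<in> I" "v \<noteq> j"
    and pq: "p \<in> I - {v, j}" "q \<in> I - {v, j}" "p \<noteq> q"
    and Y: "Y = {x \<in> V. a v x = a j x \<and> a p x = a q x}"
    and \<mu>: "\<mu> v j > 0" "\<And>b c. b \<in> I \<Longrightarrow> c \<in> I \<Longrightarrow> b \<noteq> c \<Longrightarrow> \<mu> b c = \<mu> c b"
  shows "euler_mult V A (bhyp V a v j) Y = \<mu> p q"
proof -
  let ?y = "\<lambda>i. if i = p then L q p else L j i"
  interpret T: braid V "{v, j}" a "I - {v, j}" ?y by (rule square_braid) (use vj pq in auto)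
  obtain ks where ks: "distinct ks" "set ks = I - {v, j} - {p}"
    using finite_distinct_list[of "I - {v, j} - {p}"] finI by auto
  define ts where "ts = Inl v # Inr p # map Inr ks"
  have ts: "distinct ts" "set ts = ({v, j} - {j}) <+> (I - {v, j})"
    using ks vj pq by (auto simp: ts_def distinct_map)
  \<comment> \<open>The factor \<open>const_on V 1\<close> keeps the powers in
    \<open>poly_ring V\<close> when the exponent is 0.\<close>
  define q' where "q' t = (case t of Inl _ \<Rightarrow> L j v ^ \<mu> v j * const_on V 1
     | Inr k \<Rightarrow> if k = p then L q p ^ \<mu> p q * const_on V 1 else const_on V 1)" for t :: "'i + 'i"
  have I: "p \<in> I" "q \<in> I" using pq by auto
  have q'P: "q' t \<in> poly_ring V" for t
    unfolding q'_def using vj I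
    by (auto split: sum.split intro!: poly_ring_pow_mult L_poly poly_ring.const)
  have nz: "L b c ^ m * const_on V 1 \<noteq> 0" if bc: "b \<in> I" "c \<in> I" "b \<noteq> c" for b c m
  proof
    assume "L b c ^ m * const_on V 1 = 0"
    then have "(L b c ^ m * const_on V 1) (e c) = 0" by (simp add: fun_app)
    then show False using bc by (simp add: fun_app L_e)
  qed
  have "const_on V 1 \<noteq> 0" using V_0 by (metis const_on_in zero_fun_apply zero_neq_one)
  then have q'0: "q' t \<noteq> 0" for t
    unfolding q'_def using nz[of j v] nz[of q p] vj pq by (auto split: sum.split)
  have vjH: "Y \<subseteq> bhyp V a b c \<longleftrightarrow> {b, c} = {v, j} \<or> {b, c} = {p, q}"
    if "b \<in> I" "c \<in> I" "b \<noteq> c" for b c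
  proof
    assume "Y \<subseteq> bhyp V a b c"
    then show "{b, c} = {v, j} \<or> {b, c} = {p, q}"
      using square_contains[OF that vj(1,2) pq] Y by simp
  next
    assume "{b, c} = {v, j} \<or> {b, c} = {p, q}"
    then show "Y \<subseteq> bhyp V a b c" unfolding Y bhyp_def by (auto simp: doubleton_eq_iff)
  qed
  have p1: "pdvd V (const_on V 1) h" if "h \<in> poly_ring V" for h
    unfolding pdvd_def using that const_mult_poly[OF that] by (intro bexI[of _ h]) auto
  have pc: "pdvd V (L b c ^ m * const_on V 1) h \<longleftrightarrow> pdvd V (L b c ^ m) h" for b c m h
    unfolding pdvd_def mult.assoc by (intro bex_cong refl) (simp add: const_mult_poly)
  have yc: "T.yc j (Inl v) = L j v" "T.yc j (Inr p) = L q p" by (simp_all add: T.yc_def)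
  have log: "log_der V (localization A Y) = {\<eta> \<in> Der V. \<forall>t\<in>set ts. pdvd V (q' t) (\<eta> (T.yc j t))}"
  proof (intro set_eqI)
    fix \<eta>
    let ?\<mu> = "\<lambda>b c. if Y \<subseteq> bhyp V a b c then \<mu> b c else 0"
    have "\<eta> \<in> log_der V (localization A Y) \<longleftrightarrow>
        \<eta> \<in> Der V \<and> (\<forall>b\<in>I. \<forall>c\<in>I. b \<noteq> c \<longrightarrow> pdvd V (L b c ^ ?\<mu> b c) (\<eta> (L b c)))"
      by (rule log_der_iff[OF braid_arr_localization[OF A]])
    also have "\<dots> \<longleftrightarrow> \<eta> \<in> Der V \<and> pdvd V (L j v ^ \<mu> v j) (\<eta> (L j v)) \<and> pdvd V (L q p ^ \<mu> p q) (\<eta> (L q p))"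
    proof (intro conj_cong refl iffI conjI ballI impI)
      assume *: "\<forall>b\<in>I. \<forall>c\<in>I. b \<noteq> c \<longrightarrow> pdvd V (L b c ^ ?\<mu> b c) (\<eta> (L b c))"
      show "pdvd V (L j v ^ \<mu> v j) (\<eta> (L j v))"
        using *[rule_format, of j v] vj vjH[of j v] \<mu>(2)[of j v] by (auto simp: insert_commute)
      show "pdvd V (L q p ^ \<mu> p q) (\<eta> (L q p))"
        using *[rule_format, of q p] I pq vjH[of q p] \<mu>(2)[of q p] by (auto simp: insert_commute)
    next
      fix b c assume \<eta>: "\<eta> \<in> Der V" and *: "pdvd V (L j v ^ \<mu> v j) (\<eta> (L j v)) \<and> pdvd V (L q p ^ \<mu> p q) (\<eta> (L q p))"
        and bc: "b \<in> I" "c \<in> I" "b \<noteq> c"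
      have sym: "pdvd V (L s t ^ \<mu> s t) (\<eta> (L s t))"
        if st: "pdvd V (L t s ^ \<mu> s t) (\<eta> (L t s))" "s \<in> I" "t \<in> I" for s t
      proof -
        have "L s t = const_on V (-1) * L t s"
          using st by (intro poly_ring_eqI[of _ V])
            (auto simp: fun_app L_app intro: L_poly poly_ring.mult poly_ring.const)
        then have "\<eta> (L s t) = const_on V (-1) * \<eta> (L t s)"
          using \<eta> st by (simp add: Der_cmult L_poly)
        moreover obtain r where r: "r \<in> poly_ring V" "\<eta> (L t s) = L t s ^ \<mu> s t * r"
          using st by (auto simp: pdvd_def)
        ultimately have "\<eta> (L s t) = L t s ^ \<mu> s t * (const_on V (-1) * r)"
          by (simp only: mult.left_commute)
        then have "pdvd V (L t s ^ \<mu> s t) (\<eta> (L s t))"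
          unfolding pdvd_def using poly_ring.mult[OF poly_ring.const r(1)] by blast
        then show ?thesis using pdvd_L_sym st by blast
      qed
      show "pdvd V (L b c ^ ?\<mu> b c) (\<eta> (L b c))"
      proof (cases "Y \<subseteq> bhyp V a b c")
        case False
        have "\<eta> (L b c) \<in> poly_ring V" by (intro Der_poly[OF \<eta>] L_poly bc)
        then show ?thesis using False unfolding pdvd_def by simp
      next
        case True
        then consider "b = v" "c = j" | "b = j" "c = v" | "b = p" "c = q" | "b = q" "c = p"
          using vjH[OF bc] by (auto simp: doubleton_eq_iff)
        moreover have "pdvd V (L v j ^ \<mu> v j) (\<eta> (L v j))" "pdvd V (L p q ^ \<mu> p q) (\<eta> (L p q))"
          using * by (auto intro!: sym vj I)
        ultimately show ?thesis
          using True * vj I \<mu>(2)[of j v] \<mu>(2)[of q p] pq by cases auto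
      qed
    qed
    also have "\<dots> \<longleftrightarrow> \<eta> \<in> {\<eta> \<in> Der V. \<forall>t\<in>set ts. pdvd V (q' t) (\<eta> (T.yc j t))}"
    proof -
      have "pdvd V (const_on V 1) (\<eta> (T.yc j (Inr k)))" if "\<eta> \<in> Der V" "k \<in> set ks" for k
        using that ks(2) p1[OF Der_poly[OF that(1) poly_ring.linear[OF T.y_dual[of k]]]]
        by (auto simp: T.yc_def)
      moreover have "p \<notin> set ks" using ks(2) by simp
      ultimately show ?thesis using yc by (auto simp: ts_def q'_def pc)
    qed
    finally show "\<eta> \<in> log_der V (localization A Y) \<longleftrightarrow>
      \<eta> \<in> {\<eta> \<in> Der V. \<forall>t\<in>set ts. pdvd V (q' t) (\<eta> (T.yc j t))}" .
  qed
  \<comment> \<open>The element along \<open>L q p\<close> has to come first, since the Euler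
    multiplicity is the degree of the first basis element.\<close>
  define ts' where "ts' = Inr p # Inl v # map Inr ks"
  have ts': "distinct ts'" "set ts' = ({v, j} - {j}) <+> (I - {v, j})" "set ts' = set ts"
    using ts by (auto simp: ts_def ts'_def)
  have "map (\<lambda>t. der_smult (q' t) (T.dv t)) (map Inr ks) = map T.dv (map Inr ks)"
    using ks(2) by (auto simp: q'_def T.dv_def der_smult_pd_1)
  then have map_ts': "map (\<lambda>t. der_smult (q' t) (T.dv t)) ts' =
      der_smult (q' (Inr p)) (T.dv (Inr p)) # der_smult (q' (Inl v)) (T.dv (Inl v)) # map T.dv (map Inr ks)"
    unfolding ts'_def by (simp only: list.map)
  have "module_basis V (log_der V (localization A Y)) (map (\<lambda>t. der_smult (q' t) (T.dv t)) ts')"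
    unfolding log ts'(3) [symmetric] by (intro T.diagonal_basis[OF _ ts'(1,2)] q'P q'0) simp
  then have mb: "module_basis V (log_der V (localization A Y))
      (der_smult (q' (Inr p)) (T.dv (Inr p)) # der_smult (q' (Inl v)) (T.dv (Inl v)) # map T.dv (map Inr ks))"
    unfolding map_ts' .
  have hom: "has_pdeg V (\<mu> p q) (der_smult (q' (Inr p)) (T.dv (Inr p)))"
    "has_pdeg V (\<mu> v j) (der_smult (q' (Inl v)) (T.dv (Inl v)))"
  proof -
    have h: "homogeneous V m (L b c ^ m * const_on V 1 * const_on V r)" if "b \<in> I" "c \<in> I" for b c m r
    proof -
      have "homfun V (m * 1 + 0 + 0) (\<lambda>x. L b c x ^ m * 1 * r)"
        using that by (intro homfun_mult homfun_power homfun_const homfun_dual L_dual)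
      then have "homfun V m (L b c ^ m * const_on V 1 * const_on V r)"
        by (subst homfun_cong[of V _ "\<lambda>x. L b c x ^ m * 1 * r"]) (auto simp: fun_app)
      then show ?thesis by (rule homogeneous_of_homfun) (simp add: fun_app const_on_outside)
    qed
    show "has_pdeg V (\<mu> p q) (der_smult (q' (Inr p)) (T.dv (Inr p)))"
      using h[OF I(2,1)] q'P T.dv_Der unfolding has_pdeg_def
      by (auto simp: Der_smult) (auto simp: der_smult_def q'_def T.dv_def pd_linear mult.assoc)
    show "has_pdeg V (\<mu> v j) (der_smult (q' (Inl v)) (T.dv (Inl v)))"
      using h[OF vj(2,1)] q'P T.dv_Der unfolding has_pdeg_def
      by (auto simp: Der_smult) (auto simp: der_smult_def q'_def T.dv_def pd_linear mult.assoc)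
  qed
  have co: "coordinates V (L j v # L q p # map (T.yc j) (map Inr ks))"
    "partials V (L j v # L q p # map (T.yc j) (map Inr ks)) (T.dv (Inl v) # T.dv (Inr p) # map T.dv (map Inr ks))"
    using T.coordinates_yc[OF _ ts] yc by (simp_all add: ts_def)
  obtain x where x: "x \<in> V" "a v x = a j x" "\<forall>i\<in>I. \<forall>k\<in>I. a i x = a k x \<longrightarrow> i = k \<or> {i, k} = {v, j}"
    using generic_on[OF vj(1,2)] by blast
  show ?thesis
  proof (rule euler_multI[OF _ _ co(1) _ co(2) mb hom])
    show "L j v \<in> dual V" using vj by (intro L_dual)
    show "ker_on V (L j v) = bhyp V a v j" using vj by (auto simp: ker_on_def bhyp_def L_app)
    show "Y = {x \<in> V. L j v x = 0 \<and> L q p x = 0}" unfolding Y by (auto simp: L_app)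
    show "L q p \<in> dual V" using I by (intro L_dual)
    show "L q p x = 0" if "x \<in> Y" for x using that by (simp add: Y L_app)
    show "x \<in> bhyp V a v j" using x by (simp add: bhyp_def)
    have "T.dv (Inr p) (L q p) = const_on V 1"
      using T.dv_yc[of j "Inr p" "Inr p"] pq yc by auto
    moreover have "L q p x \<noteq> 0" using x(3) I pq by (auto simp: L_app)
    ultimately show "der_smult (q' (Inr p)) (T.dv (Inr p)) (L q p) x \<noteq> 0"
      using x(1) by (simp add: der_smult_def q'_def fun_app)
    obtain m where m: "\<mu> v j = Suc m" using \<mu>(1) by (cases "\<mu> v j") auto
    have "der_smult (q' (Inl v)) (T.dv (Inl v)) =
        der_smult (L j v) (der_smult (L j v ^ m * const_on V 1) (T.dv (Inl v)))"
      by (simp add: der_smult_def q'_def m mult.assoc)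
    moreover have "der_smult (L j v ^ m * const_on V 1) (T.dv (Inl v)) \<in> Der V"
      using vj by (intro Der_smult T.dv_Der poly_ring_pow_mult L_poly poly_ring.const)
    ultimately show "der_smult (q' (Inl v)) (T.dv (Inl v)) \<in> der_smult (L j v) ` Der V" by blast
  qed
qed

end

context ess_braid
begin

text \<open>In the order \<open>v\<close>, \<open>w\<close>, \<open>j\<close> the basis of the
  localization comes from \<open>phi G \<rho> w\<close> and \<open>phi G \<rho> v\<close>. The
  latter is supported at \<open>v\<close> alone and contains the factor of the edge to
  \<open>j\<close>, so its derivation is a multiple of \<open>L j v\<close>; the multiplicity is the
  degree of the former.\<close>

lemma euler_triangle:
  assumes A: "braid_arr V I a \<mu> A"
    and I: "v \<in> I" "j \<in> I" "w \<in> I" "v \<noteq> j" "v \<noteq> w" "w \<noteq> j"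
    and Y: "Y = {x \<in> V. a v x = a j x \<and> a w x = a j x}"
    and G: "perfect_elim {v, j, w} G \<rho>" and \<rho>: "\<rho> v < \<rho> w" "\<rho> w < \<rho> j" and Gvj: "G v j"
    and \<mu>: "\<And>b c. b \<in> I \<Longrightarrow> c \<in> I \<Longrightarrow> b \<noteq> c \<Longrightarrow> \<mu> b c = n b + n c + of_bool (G b c)"
  shows "euler_mult V A (bhyp V a v j) Y = n v + n j + n w + of_bool (G w j)"
proof -
  let ?J = "{v, j, w}"
  interpret T: braid V ?J a "I - ?J" "\<lambda>i. L j i" by (rule triangle_braid) (use I in auto)
  obtain ks where ks: "distinct ks" "set ks = I - ?J"
    using finite_distinct_list[of "I - ?J"] finI by auto
  define ts where "ts = Inl w # Inl v # map Inr ks"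
  have ts: "distinct ts" "set ts = (?J - {j}) <+> (I - ?J)"
    using ks I by (auto simp: ts_def distinct_map)
  have loc: "braid_arr V ?J a \<mu> (localization A Y)"
    by (rule triangle_localization[OF A I(1-3) Y])
  have \<mu>J: "\<mu> b c = n b + n c + of_bool (G b c)" if "b \<in> ?J" "c \<in> ?J" "b \<noteq> c" for b c
    using that I \<mu> by auto
  have symG: "G b c = G c b" if "b \<in> ?J" "c \<in> ?J" for b c
    using G that unfolding perfect_elim_def by blast
  have \<mu>sym: "\<mu> b c = \<mu> c b" if "b \<in> ?J" "c \<in> ?J" "b \<noteq> c" for b c
    using \<mu>J[of b c] \<mu>J[of c b] symG that by simp
  have zmax: "\<rho> u \<le> \<rho> j" if "u \<in> ?J" for u using that \<rho> by auto
  let ?\<theta> = "T.comb n (T.phi G \<rho> w)" and ?\<psi> = "T.comb n (T.phi G \<rho> v)"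
  have "module_basis V (log_der V (localization A Y)) (map (T.basis_elt n G \<rho>) ts)"
    by (rule T.chordal_basis[OF G _ zmax loc \<mu>J ts]) auto
  then have mb: "module_basis V (log_der V (localization A Y)) (?\<theta> # ?\<psi> # map T.dv (map Inr ks))"
    by (simp add: ts_def T.basis_elt_def T.dv_def comp_def)
  have yc: "T.yc j (Inl v) = L j v" "T.yc j (Inl w) = L j w" by (simp_all add: T.yc_def)
  have co: "coordinates V (L j w # L j v # map (T.yc j) (map Inr ks))"
    "partials V (L j w # L j v # map (T.yc j) (map Inr ks)) (T.dv (Inl w) # T.dv (Inl v) # map T.dv (map Inr ks))"
    using T.coordinates_yc[OF _ ts] yc by (simp_all add: ts_def)
  have later_w: "card (later ?J G \<rho> w) = of_bool (G w j)"
  proof -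
    have "later ?J G \<rho> w = (if G w j then {j} else {})" using \<rho> by (auto simp: later_def)
    then show ?thesis by simp
  qed
  have N: "(\<Sum>s\<in>?J. n s) = n v + n j + n w" using I by simp
  have deg: "has_pdeg V (n v + n j + n w + of_bool (G w j)) ?\<theta>"
    "has_pdeg V ((\<Sum>s\<in>?J. n s) + card (later ?J G \<rho> v)) ?\<psi>"
    unfolding N [symmetric] later_w [symmetric]
    by (intro T.comb_has_pdeg[of j] T.phi_homogeneous; simp)+
  define Q where "Q = ext0 V (\<lambda>x. - (\<Prod>u\<in>later ?J G \<rho> v - {j}. a v x - a u x))"
  have QP: "Q \<in> poly_ring V"
    unfolding Q_def using I later_subset[of ?J G \<rho> v]
    by (intro polyfun_ext0 polyfun_uminus polyfun_prod polyfun_diff polyfun_dual a_dual) auto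
  have \<psi>eq: "?\<psi> = der_smult (L j v) (der_smult (const_on V (-1) * Q) (T.th n v))"
  proof -
    have jl: "j \<in> later ?J G \<rho> v" using \<rho> Gvj by (auto simp: later_def)
    have "T.phi G \<rho> v v = L j v * (const_on V (-1) * Q)"
    proof (rule poly_ring_eqI[of _ V])
      show "T.phi G \<rho> v v \<in> poly_ring V" by (rule T.phi_poly) simp
      show "L j v * (const_on V (-1) * Q) \<in> poly_ring V"
        using I QP by (intro poly_ring.mult L_poly poly_ring.const)
      show "T.phi G \<rho> v v x = (L j v * (const_on V (-1) * Q)) x" if "x \<in> V" for x
        using that T.finite_later jl by (simp add: T.phi_self Q_def fun_app L_app prod.remove)
    qed
    moreover have "T.phi G \<rho> v i = 0" if "i \<in> ?J" "i \<noteq> v" for i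
      using that \<rho> by (intro T.phi_later) auto
    then have "T.comb n (T.phi G \<rho> v) = der_smult (T.phi G \<rho> v v) (T.th n v)"
      using I by (auto simp: T.comb_def der_smult_def fun_app fun_eq_iff)
    ultimately show ?thesis by (simp add: der_smult_def mult.assoc)
  qed
  have \<psi>: "?\<psi> \<in> der_smult (L j v) ` Der V"
    unfolding \<psi>eq using QP by (intro imageI Der_smult T.th_Der poly_ring.mult poly_ring.const)
  obtain x where x: "x \<in> V" "a v x = a j x" "\<forall>i\<in>I. \<forall>k\<in>I. a i x = a k x \<longrightarrow> i = k \<or> {i, k} = {v, j}"
    using generic_on[OF I(1,2)] by blast
  \<comment> \<open>Gives a logarithmic derivation along \<open>w\<close> whose value on
    \<open>L j w\<close> is visibly nonzero at a generic point of the hyperplane. On the hyperplane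
    this value is a multiple of that of the first basis element, which is therefore nonzero as
    well.\<close>
  define q where "q = L v w ^ \<mu> v w * (L j w ^ \<mu> j w * const_on V 1)"
  have qP: "q \<in> poly_ring V"
    unfolding q_def using I by (intro poly_ring_pow_mult L_poly poly_ring.const)
  define \<eta> where "\<eta> = der_smult q (T.dv (Inl w))"
  have \<eta>D: "\<eta> \<in> Der V" unfolding \<eta>_def by (intro Der_smult T.dv_Der qP)
  have \<eta>L: "\<eta> (L b c) = q * const_on V (of_bool (c = w) - of_bool (b = w))" if "b \<in> ?J" "c \<in> ?J" for b c
  proof -
    have "b \<in> I" "c \<in> I" using that I by auto
    then show ?thesis using that by (simp add: \<eta>_def der_smult_def T.dv_def pd_linear L_dual T.L_e)
  qed
  have dv: "pdvd V (L u w ^ \<mu> u w) (q * const_on V k)" if "u \<in> {v, j}" for u k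
  proof -
    have "q * const_on V k = L v w ^ \<mu> v w * (L j w ^ \<mu> j w * (const_on V 1 * const_on V k))"
      "q * const_on V k = L j w ^ \<mu> j w * (L v w ^ \<mu> v w * (const_on V 1 * const_on V k))"
      by (simp_all add: q_def mult_ac)
    moreover have "L b w ^ m * (const_on V 1 * const_on V k) \<in> poly_ring V" if "b \<in> {v, j}" for b m
      using that I by (intro poly_ring_pow_mult L_poly poly_ring.mult poly_ring.const) auto
    ultimately show ?thesis using that unfolding pdvd_def by blast
  qed
  have \<eta>: "\<eta> \<in> log_der V (localization A Y)"
    unfolding T.log_der_iff[OF loc]
  proof (intro conjI ballI impI \<eta>D)
    fix b c assume bc: "b \<in> ?J" "c \<in> ?J" "b \<noteq> c"
    consider "c = w" | "b = w" | "b \<noteq> w" "c \<noteq> w" by blast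
    then show "pdvd V (L b c ^ \<mu> b c) (\<eta> (L b c))"
    proof cases
      case 1
      then show ?thesis using dv[of b] bc by (auto simp: \<eta>L)
    next
      case 2
      then have "pdvd V (L c w ^ \<mu> c w) (\<eta> (L b c))" using dv[of c] bc by (auto simp: \<eta>L)
      then have "pdvd V (L w c ^ \<mu> c w) (\<eta> (L b c))" using bc I pdvd_L_sym[of c w] by auto
      then show ?thesis using 2 \<mu>sym[of c w] bc by auto
    next
      case 3
      then have "\<eta> (L b c) = 0" using bc by (simp add: \<eta>L const_on_0)
      then show ?thesis unfolding pdvd_def using poly_ring_zero by (intro bexI[of _ 0]) auto
    qed
  qed
  have "\<exists>g\<in>poly_ring V. \<forall>x\<in>bhyp V a v j. \<eta> (L j w) x = g x * ?\<theta> (L j w) x"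
  proof (rule module_basis_restrict[OF mb \<eta>])
    show "\<delta> (L j w) = 0" if "\<delta> \<in> set (map T.dv (map Inr ks))" for \<delta>
      using that T.pd_f_L[of j w] by (auto simp: T.dv_def)
    show "?\<psi> (L j w) x = 0" if "x \<in> bhyp V a v j" for x
      unfolding \<psi>eq using that by (simp add: der_smult_def fun_app bhyp_def L_app)
  qed
  moreover have "x \<in> bhyp V a v j" using x by (simp add: bhyp_def)
  ultimately obtain g where g: "\<eta> (L j w) x = g x * ?\<theta> (L j w) x" by blast
  have "L v w x \<noteq> 0" "L j w x \<noteq> 0" using x(3) I by (auto simp: L_app doubleton_eq_iff)
  then have "\<eta> (L j w) x \<noteq> 0" using x(1) I by (simp add: \<eta>L q_def fun_app)
  then have nz: "?\<theta> (L j w) x \<noteq> 0" using g by auto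
  show ?thesis
  proof (rule euler_multI[OF _ _ co(1) _ co(2) mb deg \<psi> _ _ _ nz])
    show "L j v \<in> dual V" "L j w \<in> dual V" using I by (auto intro: L_dual)
    show "ker_on V (L j v) = bhyp V a v j" by (auto simp: ker_on_def bhyp_def L_app)
    show "Y = {x \<in> V. L j w x = 0 \<and> L j v x = 0}" unfolding Y by (auto simp: L_app)
    show "L j w x = 0" if "x \<in> Y" for x using that by (simp add: Y L_app)
    show "x \<in> bhyp V a v j" using x by (simp add: bhyp_def)
  qed
qed

lemma count_restriction:
  "count (restriction V A H0) Y =
    (if Y \<in> (\<lambda>H. H \<inter> H0) ` (set_mset A - {H0}) then euler_mult V A H0 Y else 0)"
proof -
  have "count (restriction V A H0) Y = (\<Sum>Z\<in>(\<lambda>H. H \<inter> H0) ` (set_mset A - {H0}).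
      if Z = Y then euler_mult V A H0 Z else 0)"
    unfolding restriction_def count_sum by (intro sum.cong) (auto simp: count_replicate_mset)
  also have "\<dots> = (if Y \<in> (\<lambda>H. H \<inter> H0) ` (set_mset A - {H0}) then euler_mult V A H0 Y else 0)"
    by (subst sum.delta) auto
  finally show ?thesis .
qed

text \<open>The flats are of two kinds: where \<open>v\<close>, \<open>j\<close>, \<open>w\<close>
  agree, \<open>euler_triangle\<close> lets \<open>n v\<close> join \<open>n j\<close>; for two
  disjoint pairs, \<open>euler_square\<close> keeps the multiplicity. The assumption
  \<open>simplicial\<close> makes the order \<open>v\<close>, \<open>w\<close>, \<open>j\<close>
  perfect on every triangle.\<close>

lemma restriction_arr:
  fixes n :: "'i \<Rightarrow> nat"
  assumes A: "braid_arr V I a \<mu> A" and vj: "v \<in> I" "j \<in> I" "v \<noteq> j"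
    and \<mu>: "\<And>b c. b \<in> I \<Longrightarrow> c \<in> I \<Longrightarrow> b \<noteq> c \<Longrightarrow> \<mu> b c = n b + n c + of_bool (G b c)"
    and symG: "\<And>b c. b \<in> I \<Longrightarrow> c \<in> I \<Longrightarrow> G b c \<Longrightarrow> G c b"
    and Gvj: "G v j" and simplicial: "\<And>w. w \<in> I \<Longrightarrow> w \<noteq> v \<Longrightarrow> w \<noteq> j \<Longrightarrow> G v w \<Longrightarrow> G w j"
  defines "H0 \<equiv> bhyp V a v j" and "n' \<equiv> n(j := n j + n v)"
  shows "braid_arr H0 (I - {v}) (\<lambda>i. ext0 H0 (a i)) (\<lambda>p q. n' p + n' q + of_bool (G p q)) (restriction V A H0)"
proof -
  have symG': "G b c = G c b" if "b \<in> I" "c \<in> I" for b c using symG that by blast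
  have \<mu>sym: "\<mu> b c = \<mu> c b" if "b \<in> I" "c \<in> I" "b \<noteq> c" for b c
    using \<mu>[of b c] \<mu>[of c b] symG' that by simp
  have bh: "bhyp H0 (\<lambda>i. ext0 H0 (a i)) p q = bhyp V a p q \<inter> H0" for p q
    by (auto simp: bhyp_def H0_def ext0_def)
  have inA: "bhyp V a b c \<in># A \<longleftrightarrow> \<mu> b c > 0" if "b \<in> I" "c \<in> I" "b \<noteq> c" for b c
    using A that unfolding braid_arr_def by (metis count_greater_zero_iff)
  have ne: "bhyp V a b c \<noteq> H0" if "b \<in> I" "c \<in> I" "b \<noteq> c" "{b, c} \<noteq> {v, j}" for b c
    using bhyp_eq_iff[OF that(1-3) vj] that(4) by (auto simp: H0_def)
  let ?im = "(\<lambda>H. H \<inter> H0) ` (set_mset A - {H0})"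
  have im: "bhyp V a p q \<inter> H0 \<in> ?im"
    if pq: "p \<in> I - {v}" "q \<in> I - {v}" "p \<noteq> q" and bc: "b \<in> I" "c \<in> I" "b \<noteq> c" "\<mu> b c > 0"
      "{if b = v then j else b, if c = v then j else c} = {p, q}" for p q b c
  proof -
    have "{b, c} \<noteq> {v, j}" using bc(3,5) pq vj by (auto simp: doubleton_eq_iff split: if_splits)
    moreover have "bhyp V a b c \<inter> H0 = bhyp V a p q \<inter> H0"
      using bc(5) by (auto simp: doubleton_eq_iff bhyp_def H0_def split: if_splits)
    ultimately show "bhyp V a p q \<inter> H0 \<in> ?im"
      using ne[OF bc(1-3)] inA[OF bc(1-3)] bc(4) by (auto intro!: image_eqI[of _ _ "bhyp V a b c"])
  qed
  have tri: "count (restriction V A H0) (bhyp V a j w \<inter> H0) = n v + n j + n w + of_bool (G w j)"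
    if w: "w \<in> I" "w \<noteq> v" "w \<noteq> j" for w
  proof -
    let ?Y = "bhyp V a j w \<inter> H0"
    have Y: "?Y = {x \<in> V. a v x = a j x \<and> a w x = a j x}" by (auto simp: bhyp_def H0_def)
    let ?\<rho> = "\<lambda>i. if i = v then 0 else if i = w then 1 else (2 :: nat)"
    have lv: "later {v, j, w} G ?\<rho> v \<subseteq> {j, w}" by (auto simp: later_def)
    have lw: "later {v, j, w} G ?\<rho> w \<subseteq> {j}" using vj w by (auto simp: later_def split: if_splits)
    have lj: "later {v, j, w} G ?\<rho> j = {}" using vj w by (auto simp: later_def split: if_splits)
    have "perfect_elim {v, j, w} G ?\<rho>"
      unfolding perfect_elim_def
    proof (intro conjI ballI impI)
      show "inj_on ?\<rho> {v, j, w}" using vj w by (auto simp: inj_on_def)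
      show "G c b" if "b \<in> {v, j, w}" "c \<in> {v, j, w}" "G b c" for b c using that symG vj w by blast
      fix u b c assume u: "u \<in> {v, j, w}" and b: "b \<in> later {v, j, w} G ?\<rho> u"
        and c: "c \<in> later {v, j, w} G ?\<rho> u" and bc: "b \<noteq> c"
      have "u = v" using u b c bc lw lj by blast
      then have "{b, c} = {j, w}" "G v b" "G v c" using b c bc lv by (auto simp: later_def)
      then have "G w j" "{b, c} = {j, w}" using simplicial[of w] w by (auto simp: doubleton_eq_iff)
      then show "G b c" using symG[of w j] w vj by (auto simp: doubleton_eq_iff)
    qed
    then have eu: "euler_mult V A H0 ?Y = n v + n j + n w + of_bool (G w j)"
      unfolding H0_def
      by (intro euler_triangle[OF A vj(1,2) w(1) vj(3) _ w(3) Y[unfolded H0_def] _ _ _ Gvj \<mu>])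
        (use w vj in auto)
    show ?thesis
    proof (cases "?Y \<in> ?im")
      case True
      then show ?thesis using eu by (simp add: count_restriction)
    next
      \<comment> \<open>The flat is absent from the restriction, so the formula has to give 0:
        neither \<open>v\<close> nor \<open>j\<close> shares a hyperplane of positive multiplicity
        with \<open>w\<close>, and so all summands are 0.\<close>
      case False
      have zero: "\<mu> b w = 0" if b: "b \<in> {v, j}" for b
      proof (rule ccontr)
        assume "\<mu> b w \<noteq> 0"
        then have "\<mu> b w > 0" by simp
        moreover have "b \<in> I" "b \<noteq> w" using b vj w by auto
        moreover have "(if b = v then j else b) = j" "(if w = v then j else w) = w" using b w by auto
        then have "{if b = v then j else b, if w = v then j else w} = {j, w}" by (simp only:)
        moreover have "j \<in> I - {v}" "w \<in> I - {v}" "j \<noteq> w" using vj w by auto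
        ultimately have "?Y \<in> ?im" by (intro im[of j w b w] w(1))
        then show False using False by contradiction
      qed
      have "n j + n w + of_bool (G j w) = 0" "n v + n w + of_bool (G v w) = 0"
        using zero[of j] zero[of v] \<mu>[of j w] \<mu>[of v w] vj w by simp_all
      then have "n j = 0" "n w = 0" "n v = 0" "\<not> G w j"
        using symG'[of w j] vj(2) w(1) by simp_all
      then show ?thesis using False by (simp add: count_restriction)
    qed
  qed
  show ?thesis
    unfolding braid_arr_def bh
  proof (intro conjI ballI impI)
    fix p q assume pq: "p \<in> I - {v}" "q \<in> I - {v}" "p \<noteq> q"
    consider "p = j" | "q = j" | "p \<noteq> j" "q \<noteq> j" by blast
    then show "count (restriction V A H0) (bhyp V a p q \<inter> H0) = n' p + n' q + of_bool (G p q)"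
    proof cases
      case 1
      then show ?thesis using tri[of q] pq symG'[of j q] vj by (simp add: n'_def)
    next
      case 2
      then show ?thesis using tri[of p] pq vj bhyp_sym[of p j] by (simp add: n'_def)
    next
      case 3
      let ?Y = "bhyp V a p q \<inter> H0"
      have Y: "?Y = {x \<in> V. a v x = a j x \<and> a p x = a q x}" by (auto simp: bhyp_def H0_def)
      have "\<mu> v j > 0" using \<mu>[OF vj] Gvj by simp
      then have eu: "euler_mult V A H0 ?Y = \<mu> p q"
        unfolding H0_def using pq 3 \<mu>sym
        by (intro euler_square[OF A vj _ _ pq(3) Y[unfolded H0_def]]) auto
      have "\<mu> p q = 0" if "?Y \<notin> ?im"
      proof (rule ccontr)
        assume "\<mu> p q \<noteq> 0"
        then have "?Y \<in> ?im" using pq by (intro im[of p q p q]) auto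
        then show False using that by contradiction
      qed
      then have "count (restriction V A H0) ?Y = \<mu> p q" using eu by (simp add: count_restriction)
      then show ?thesis using \<mu>[of p q] pq 3 by (simp add: n'_def)
    qed
  next
    fix H assume "H \<in># restriction V A H0"
    then have "H \<in> ?im" using count_restriction[of A H0 H] by (metis count_eq_zero_iff)
    then obtain H' where H': "H' \<in># A" "H' \<noteq> H0" "H = H' \<inter> H0" by auto
    from H'(1) obtain b c where bc: "b \<in> I" "c \<in> I" "b \<noteq> c" "H' = bhyp V a b c"
      using A unfolding braid_arr_def by blast
    let ?b = "if b = v then j else b" and ?c = "if c = v then j else c"
    have "H = bhyp V a ?b ?c \<inter> H0" using H'(3) bc(4) by (auto simp: bhyp_def H0_def)
    moreover have "?b \<noteq> ?c"
    proof
      assume "?b = ?c"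
      then have "{b, c} = {v, j}" using bc(3) by (auto split: if_splits)
      then have "H' = H0" using bc(4) bhyp_sym by (auto simp: H0_def doubleton_eq_iff)
      then show False using H' by simp
    qed
    ultimately show "\<exists>p\<in>I - {v}. \<exists>q\<in>I - {v}. p \<noteq> q \<and> H = bhyp V a p q \<inter> H0"
      using bc vj by (intro bexI[of _ ?b] bexI[of _ ?c]) auto
  qed
qed

end

section \<open>Inductive freeness\<close>

lemma later_subset_mono: "J \<subseteq> I \<Longrightarrow> later J G \<rho> u \<subseteq> later I G \<rho> u"
  by (auto simp: later_def)

lemma perfect_elim_subset: "perfect_elim I G \<rho> \<Longrightarrow> J \<subseteq> I \<Longrightarrow> perfect_elim J G \<rho>"
  using later_subset_mono[of J I G \<rho>] unfolding perfect_elim_def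
  by (meson inj_on_subset subset_iff)

text \<open>The successor of the sum of all ranks puts \<open>v\<close> behind every other vertex,
  each of which then has at most \<open>v\<close> as a later neighbour.\<close>

lemma perfect_elim_star:
  assumes "finite I" "inj_on \<rho> I" "v \<in> I"
  shows "perfect_elim I (\<lambda>x y. x = v \<or> y = v) (\<lambda>i. if i = v then Suc (\<Sum>i\<in>I. \<rho> i) else \<rho> i)"
    (is "perfect_elim I ?G ?\<rho>")
proof -
  have le: "\<rho> i \<le> (\<Sum>i\<in>I. \<rho> i)" if "i \<in> I" for i
    using that assms(1) by (intro member_le_sum) auto
  have "later I ?G ?\<rho> u \<subseteq> {v}" if "u \<in> I" for u
  proof
    fix x assume "x \<in> later I ?G ?\<rho> u"
    then show "x \<in> {v}" using le[of x] by (auto simp: later_def split: if_splits)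
  qed
  moreover have "inj_on ?\<rho> I"
  proof (rule inj_onI)
    fix x y assume "x \<in> I" "y \<in> I" "?\<rho> x = ?\<rho> y"
    then show "x = y"
      using assms(2) le[of x] le[of y] by (auto simp: inj_on_def split: if_splits)
  qed
  ultimately show ?thesis unfolding perfect_elim_def by blast
qed

text \<open>\<open>v\<close> is the vertex of least rank that has an edge. Its neighbours all come
  later, hence form a clique; as earlier vertices are isolated, cutting an edge at \<open>v\<close>
  breaks no clique condition.\<close>

lemma obtain_simplicial:
  assumes G: "perfect_elim I G \<rho>" and fin: "finite I"
    and edge: "p \<in> I" "q \<in> I" "p \<noteq> q" "G p q"
  obtains v j where "v \<in> I" "j \<in> I" "v \<noteq> j" "G v j" "\<rho> v < \<rho> j"
    "\<And>u. u \<in> I \<Longrightarrow> u \<noteq> v \<Longrightarrow> G v u \<Longrightarrow> \<rho> v < \<rho> u"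
    "\<And>u w. u \<in> I \<Longrightarrow> w \<in> I \<Longrightarrow> u \<noteq> w \<Longrightarrow> \<rho> u < \<rho> v \<Longrightarrow> \<not> G u w"
proof -
  let ?P = "\<lambda>v. v \<in> I \<and> (\<exists>w\<in>I. w \<noteq> v \<and> G v w)"
  have "?P p" using edge by auto
  then obtain v where v: "?P v" "\<And>u. ?P u \<Longrightarrow> \<rho> v \<le> \<rho> u"
    using ex_has_least_nat[of ?P p \<rho>] by blast
  have later: "\<rho> v < \<rho> u" if u: "u \<in> I" "u \<noteq> v" "G v u" for u
  proof -
    have "G u v" using G u v unfolding perfect_elim_def by blast
    then have "?P u" using u v(1) by auto
    then have "\<rho> v \<le> \<rho> u" by (rule v(2))
    moreover have "\<rho> v \<noteq> \<rho> u" using G u v by (auto simp: perfect_elim_def inj_on_def)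
    ultimately show ?thesis by simp
  qed
  obtain j where j: "j \<in> I" "j \<noteq> v" "G v j" using v by blast
  show ?thesis
  proof (rule that[of v j])
    show "\<not> G u w" if "u \<in> I" "w \<in> I" "u \<noteq> w" "\<rho> u < \<rho> v" for u w
    proof
      assume "G u w"
      then have "?P u" using that by auto
      then have "\<rho> v \<le> \<rho> u" by (rule v(2))
      then show False using that by simp
    qed
  qed (use v j later in auto)
qed

text \<open>In the restriction to \<open>a v = a j\<close>, where \<open>v\<close> is simplicial, the vertex \<open>v\<close> disappears from
  the graph and \<open>n v\<close> is added to \<open>n j\<close>. Without edges, one unit of some \<open>n v\<close> is traded for
  the star at \<open>v\<close>.\<close>

theorem chordal_inductively_free:
  fixes V :: "(complex ^ 'k) set" and I :: "'i set" and n :: "'i \<Rightarrow> nat"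
  assumes "ess_braid V I a" "perfect_elim I G \<rho>" "braid_arr V I a \<mu> A"
    "\<And>b c. b \<in> I \<Longrightarrow> c \<in> I \<Longrightarrow> b \<noteq> c \<Longrightarrow> \<mu> b c = n b + n c + of_bool (G b c)"
  shows "inductively_free V A"
proof -
  have "\<forall>(V :: (complex ^ 'k) set) a A G \<rho> \<mu> n. ess_braid V I a \<longrightarrow> perfect_elim I G \<rho> \<longrightarrow> braid_arr V I a \<mu> A \<longrightarrow>
    (\<forall>b\<in>I. \<forall>c\<in>I. b \<noteq> c \<longrightarrow> \<mu> b c = n b + n c + of_bool (G b c)) \<longrightarrow> size A = s \<longrightarrow>
    inductively_free V A" for s
  \<comment> \<open>Restriction lowers the number of vertices; deletion keeps it and lowers the size
    of the multiset.\<close>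
  proof (induction "(card I, s)" arbitrary: I s rule: wf_induct[OF wf_lex_prod[OF wf_less_than wf_less_than]])
    case (1 I s)
    have IH: "inductively_free V A"
      if "card J < card I \<or> card J = card I \<and> size A < s"
        "ess_braid V J a" "perfect_elim J G \<rho>" "braid_arr V J a \<mu> A"
        "\<And>b c. b \<in> J \<Longrightarrow> c \<in> J \<Longrightarrow> b \<noteq> c \<Longrightarrow> \<mu> b c = n b + n c + of_bool (G b c)"
      for J :: "'i set" and V :: "(complex ^ 'k) set" and a A G \<rho> \<mu> and n :: "'i \<Rightarrow> nat"
      using 1[rule_format, of "(card J, size A)" J "size A" V a G \<rho> \<mu> A n] that by auto
    \<comment> \<open>The case of a graph with an edge. The edgeless case is an instance of it, for
      the same \<open>A\<close> with other \<open>n\<close> and \<open>G\<close>, and so makes no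
      appeal to the induction hypothesis of its own.\<close>
    have main: "inductively_free V A"
      if br: "ess_braid V I a" and G: "perfect_elim I G \<rho>" and A: "braid_arr V I a \<mu> A"
        and \<mu>: "\<And>b c. b \<in> I \<Longrightarrow> c \<in> I \<Longrightarrow> b \<noteq> c \<Longrightarrow> \<mu> b c = n b + n c + of_bool (G b c)"
        and s: "size A = s" and edge: "p \<in> I" "q \<in> I" "p \<noteq> q" "G p q"
      for V :: "(complex ^ 'k) set" and a A G \<rho> \<mu> p q and n :: "'i \<Rightarrow> nat"
    proof -
      interpret B: ess_braid V I a by (rule br)
      obtain v j where vj: "v \<in> I" "j \<in> I" "v \<noteq> j" "G v j" "\<rho> v < \<rho> j"
        and v_first: "\<And>u. u \<in> I \<Longrightarrow> u \<noteq> v \<Longrightarrow> G v u \<Longrightarrow> \<rho> v < \<rho> u"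
        and isolated: "\<And>u w. u \<in> I \<Longrightarrow> w \<in> I \<Longrightarrow> u \<noteq> w \<Longrightarrow> \<rho> u < \<rho> v \<Longrightarrow> \<not> G u w"
        using obtain_simplicial[OF G B.finI edge] by metis
      have symG: "G c b" if "b \<in> I" "c \<in> I" "G b c" for b c
        using G that unfolding perfect_elim_def by blast
      have clique: "G w w'" if "u \<in> I" "w \<in> later I G \<rho> u" "w' \<in> later I G \<rho> u" "w \<noteq> w'" for u w w'
        using G that unfolding perfect_elim_def by blast
      let ?H0 = "bhyp V a v j" and ?a = "\<lambda>i. ext0 (bhyp V a v j) (a i)"
      let ?J = "I - {v}" and ?n = "n(j := n j + n v)"
      define G1 where "G1 b c \<longleftrightarrow> G b c \<and> {b, c} \<noteq> {v, j}" for b c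
      have later1: "later I G1 \<rho> u \<subseteq> later I G \<rho> u" for u by (auto simp: later_def G1_def)
      have elim1: "perfect_elim I G1 \<rho>"
        unfolding perfect_elim_def
      proof (intro conjI ballI impI)
        show "inj_on \<rho> I" using G by (simp add: perfect_elim_def)
        show "G1 c b" if "b \<in> I" "c \<in> I" "G1 b c" for b c
          using that symG by (auto simp: G1_def insert_commute)
        fix u w w' assume u: "u \<in> I" "w \<in> later I G1 \<rho> u" "w' \<in> later I G1 \<rho> u" "w \<noteq> w'"
        have w: "w \<in> later I G \<rho> u" "w' \<in> later I G \<rho> u" using u later1 by blast+
        \<comment> \<open>The cut edge could be required only among later neighbours of a vertex
          before \<open>v\<close>, and such a vertex is isolated.\<close>
        have "{w, w'} \<noteq> {v, j}"
        proof
          assume "{w, w'} = {v, j}"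
          then have "v \<in> later I G \<rho> u" using w by (auto simp: doubleton_eq_iff)
          then have "G u v" "\<rho> u < \<rho> v" by (auto simp: later_def)
          then show False using isolated[of u v] u vj by auto
        qed
        then show "G1 w w'" using clique[OF u(1) w u(4)] by (simp add: G1_def)
      qed
      define \<mu>1 where "\<mu>1 b c = n b + n c + of_bool (G1 b c)" for b c
      have H0A: "?H0 \<in># A"
      proof -
        have "count A ?H0 = \<mu> v j" using A vj by (simp add: braid_arr_def)
        then show ?thesis using \<mu>[OF vj(1-3)] vj(4) by (metis add_gr_0 count_greater_zero_iff of_bool_eq(2) zero_less_one)
      qed
      have del: "braid_arr V I a \<mu>1 (deletion A ?H0)"
        unfolding braid_arr_def
      proof (intro conjI ballI impI)
        fix b c assume bc: "b \<in> I" "c \<in> I" "b \<noteq> c"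
        have cA: "count A (bhyp V a b c) = \<mu> b c" using A bc by (simp add: braid_arr_def)
        have "bhyp V a b c = ?H0 \<longleftrightarrow> {b, c} = {v, j}"
          using B.bhyp_eq_iff[OF bc vj(1-3)] B.bhyp_sym by (auto simp: doubleton_eq_iff)
        then show "count (deletion A ?H0) (bhyp V a b c) = \<mu>1 b c"
          using cA \<mu>[OF bc] vj(4) symG[of v j] vj(1,2)
          by (auto simp: deletion_def \<mu>1_def G1_def doubleton_eq_iff)
      next
        fix H assume "H \<in># deletion A ?H0"
        then have "H \<in># A" unfolding deletion_def by (rule in_diffD)
        then show "\<exists>i\<in>I. \<exists>k\<in>I. i \<noteq> k \<and> H = bhyp V a i k" using A unfolding braid_arr_def by blast
      qed
      have simplicial: "G w j" if "w \<in> I" "w \<noteq> v" "w \<noteq> j" "G v w" for w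
        using clique[of v w j] that vj v_first[of w] by (auto simp: later_def)
      have res: "braid_arr ?H0 ?J ?a (\<lambda>p q. ?n p + ?n q + of_bool (G p q)) (restriction V A ?H0)"
        by (rule B.restriction_arr[OF A vj(1-3) \<mu> symG vj(4) simplicial])
      have br': "ess_braid ?H0 ?J ?a" by (rule B.restricted_braid[OF vj(1-3)])
      have elim': "perfect_elim ?J G \<rho>" by (rule perfect_elim_subset[OF G]) auto
      have card: "card ?J < card I" using vj(1) B.finI by (meson card_Diff1_less)
      obtain z where z: "z \<in> I" "\<And>u. u \<in> I \<Longrightarrow> \<rho> u \<le> \<rho> z"
        using obtains_MAX[OF B.finI, of \<rho>] vj(1) Max_ge[OF finite_imageI[OF B.finI], of _ \<rho>] by (metis empty_iff imageI)
      \<comment> \<open>Both exponent formulas leave out the last vertex, so it has to survive the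
        restriction.\<close>
      have zv: "z \<noteq> v" using z(2)[OF vj(2)] vj(5) by auto
      let ?f = "\<lambda>u. (\<Sum>s\<in>I. n s) + card (later I G1 \<rho> u)"
      have exp1: "has_exponents V (deletion A ?H0) (image_mset ?f (mset_set (I - {z})))"
        by (rule B.chordal_exponents[OF elim1 z del]) (auto simp: \<mu>1_def)
      have exp2: "has_exponents ?H0 (restriction V A ?H0)
          (image_mset (\<lambda>u. (\<Sum>s\<in>?J. ?n s) + card (later ?J G \<rho> u)) (mset_set (?J - {z})))"
      proof -
        interpret B': ess_braid ?H0 ?J ?a by (rule br')
        show ?thesis by (rule B'.chordal_exponents[OF elim' _ _ res]) (use z zv in auto)
      qed
      have N: "(\<Sum>s\<in>?J. ?n s) = (\<Sum>s\<in>I. n s)"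
      proof -
        have "(\<Sum>s\<in>?J. ?n s) = (n j + n v) + (\<Sum>s\<in>?J - {j}. n s)"
          using vj B.finI by (subst sum.remove[of _ j]) auto
        moreover have "(\<Sum>s\<in>I. n s) = n v + (n j + (\<Sum>s\<in>?J - {j}. n s))"
          using vj B.finI by (subst sum.remove[of _ v], simp, simp, subst sum.remove[of _ j]) auto
        ultimately show ?thesis by simp
      qed
      \<comment> \<open>A vertex other than \<open>v\<close> loses nothing: \<open>v\<close> is not
        a later neighbour of any vertex, and the cut edge counts only at its earlier end
        \<open>v\<close>.\<close>
      have lat: "later ?J G \<rho> u = later I G1 \<rho> u" if u: "u \<in> ?J" for u
      proof -
        have "\<not> (G u v \<and> \<rho> u < \<rho> v)" using isolated[of u v] u vj(1) by auto
        moreover have "\<not> (G u w \<and> \<rho> u < \<rho> w \<and> {u, w} = {v, j})" for w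
          using u vj(5) by (auto simp: doubleton_eq_iff)
        ultimately show ?thesis by (auto simp: later_def G1_def)
      qed
      have "image_mset (\<lambda>u. (\<Sum>s\<in>?J. ?n s) + card (later ?J G \<rho> u)) (mset_set (?J - {z})) =
          image_mset ?f (mset_set (?J - {z}))"
        unfolding N using B.finI by (intro image_mset_cong) (simp add: lat)
      also have "\<dots> \<subseteq># image_mset ?f (mset_set (I - {z}))"
        using B.finI by (intro image_mset_subseteq_mono) (auto simp: subset_imp_msubset_mset_set)
      finally have sub: "image_mset (\<lambda>u. (\<Sum>s\<in>?J. ?n s) + card (later ?J G \<rho> u)) (mset_set (?J - {z}))
          \<subseteq># image_mset ?f (mset_set (I - {z}))" .
      have multi: "multiarrangement V A"
        unfolding multiarrangement_def
      proof (intro conjI ballI B.subspace_V)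
        fix H assume "H \<in># A"
        then obtain b c where bc: "b \<in> I" "c \<in> I" "b \<noteq> c" "H = bhyp V a b c"
          using A unfolding braid_arr_def by blast
        then show "\<exists>\<alpha>\<in>dual V. \<alpha> \<noteq> 0 \<and> H = ker_on V \<alpha>"
          using B.L_dual B.L_nonzero B.bhyp_ker by blast
      qed
      have "size (deletion A ?H0) < s"
        using H0A s by (simp add: deletion_def size_Diff_singleton)
          (metis Suc_pred size_eq_0_iff_empty empty_not_add_mset insert_DiffM lessI nat_neq_iff not_gr_zero set_mset_empty empty_iff)
      then have if1: "inductively_free V (deletion A ?H0)"
        by (intro IH[OF _ br elim1 del]) (auto simp: \<mu>1_def)
      have if2: "inductively_free ?H0 (restriction V A ?H0)"
        by (rule IH[OF disjI1[OF card] br' elim' res]) simp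
      show ?thesis by (rule inductively_free.step[OF multi H0A if1 if2 exp1 exp2 sub])
    qed
    show ?case
    proof (intro allI impI)
      fix V :: "(complex ^ 'k) set" and a A G \<rho> \<mu> and n :: "'i \<Rightarrow> nat"
      assume br: "ess_braid V I a" and G: "perfect_elim I G \<rho>" and A: "braid_arr V I a \<mu> A"
        and \<mu>: "\<forall>b\<in>I. \<forall>c\<in>I. b \<noteq> c \<longrightarrow> \<mu> b c = n b + n c + of_bool (G b c)" and s: "size A = s"
      interpret B: ess_braid V I a by (rule br)
      show "inductively_free V A"
      proof (cases "A = {#}")
        case True
        then show ?thesis using B.subspace_V by (simp add: inductively_free.empty)
      next
        case False
        then obtain H where H: "H \<in># A" by blast
        then obtain p q where pq: "p \<in> I" "q \<in> I" "p \<noteq> q" "H = bhyp V a p q"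
          using A unfolding braid_arr_def by blast
        have "count A (bhyp V a p q) = \<mu> p q" using A pq(1-3) by (simp add: braid_arr_def)
        then have "\<mu> p q > 0" using H pq(4) by (metis count_greater_zero_iff)
        show ?thesis
        proof (cases "\<exists>p\<in>I. \<exists>q\<in>I. p \<noteq> q \<and> G p q")
          case True
          then show ?thesis using main[OF br G A _ s] \<mu> by blast
        next
          case no_edge: False
          then have "n p + n q > 0" using \<open>\<mu> p q > 0\<close> \<mu> pq by auto
          then obtain v where v: "v \<in> I" "n v > 0" using pq by auto
          \<comment> \<open>A second vertex, so that the star at \<open>v\<close> has an edge and
            \<open>main\<close> applies.\<close>
          obtain w where w: "w \<in> I" "w \<noteq> v"
            by (rule that[of "if p = v then q else p"]) (use pq(1-3) in auto)
          let ?G = "\<lambda>x y. x = v \<or> y = v"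
          have inj: "inj_on \<rho> I" using G by (simp add: perfect_elim_def)
          show ?thesis
          proof (rule main[OF br perfect_elim_star[OF B.finI inj v(1)] A _ s v(1) w(1)])
            show "\<mu> b c = (n(v := n v - 1)) b + (n(v := n v - 1)) c + of_bool (b = v \<or> c = v)"
              if "b \<in> I" "c \<in> I" "b \<noteq> c" for b c
              using \<mu> no_edge that v by auto
          qed (use w in auto)
        qed
      qed
    qed
  qed
  then show ?thesis using assms by blast
qed

section \<open>Type A\<close>

lemma count_sum_replicate:
  "finite S \<Longrightarrow> count (\<Sum>H\<in>S. replicate_mset k H) X = (if X \<in> S then k else 0)"
proof -
  assume S: "finite S"
  have "count (\<Sum>H\<in>S. replicate_mset k H) X = (\<Sum>H\<in>S. if H = X then k else 0)"
    unfolding count_sum by (intro sum.cong) auto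
  then show ?thesis using S by simp
qed

theorem corollary1p2:
  fixes \<pi> :: "complex ^ 'l \<Rightarrow> complex ^ 'k" and i1 :: 'l and l m q :: nat
  assumes "CARD('l) = l" and "l \<ge> 2" and "m \<ge> 1" and "q \<ge> 1"
    and "Vector_Spaces.linear (*s) (*s) \<pi>"
    and "{x. \<pi> x = 0} = vec.span {\<chi> i. 1}"
  shows "inductively_free (range \<pi>) (type_A_mult \<pi> i1 m q) \<and>
    (even m \<longrightarrow> has_exponents (range \<pi>) (type_A_mult \<pi> i1 m q)
       (replicate_mset (l - 1) (m * l div 2 + q))) \<and>
    (odd m \<longrightarrow> has_exponents (range \<pi>) (type_A_mult \<pi> i1 m q)
       (image_mset (\<lambda>k. (m - 1) * l div 2 + k + q) (mset_set {1..l - 1})))"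
proof -
  let ?V = "range \<pi>" and ?A = "type_A_mult \<pi> i1 m q"
  interpret lin: Vector_Spaces.linear "(*s)" "(*s)" \<pi> by fact
  have ker: "\<pi> x = 0 \<longleftrightarrow> (\<exists>c. x = c *s (\<chi> i. 1))" for x
    using assms(6) vec.span_singleton[of "(\<chi> i. 1) :: complex ^ 'l"] by blast
  \<comment> \<open>The coordinate of \<open>i1\<close> is subtracted because a preimage under \<pi>
    is determined only up to multiples of the all-one vector; the difference is the same for all
    preimages.\<close>
  define a where "a i = (\<lambda>y. if y \<in> ?V then (SOME x. \<pi> x = y) $ i - (SOME x. \<pi> x = y) $ i1 else 0)" for i
  have a: "a i (\<pi> x) = x $ i - x $ i1" for i x
  proof -
    let ?x = "SOME z. \<pi> z = \<pi> x"
    have "\<pi> ?x = \<pi> x" by (rule someI[of _ x]) simp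
    then have "\<pi> (?x - x) = 0" by (simp add: lin.diff)
    then obtain c where "?x - x = c *s (\<chi> i. 1)" using ker by blast
    then have "?x $ k - x $ k = c" for k by (simp add: vec_eq_iff)
    then have "?x $ i - x $ i = ?x $ i1 - x $ i1" by metis
    then show ?thesis by (simp add: a_def algebra_simps)
  qed
  interpret B: ess_braid ?V "UNIV :: 'l set" a
  proof unfold_locales
    show "vec.subspace ?V" by (rule lin.subspace_image[OF vec.subspace_UNIV])
    show "a i \<in> dual ?V" for i
      unfolding dual_def
    proof (intro CollectI conjI ballI allI impI)
      fix y z c
      show "a i (y + z) = a i y + a i z" if "y \<in> ?V" "z \<in> ?V"
        using that by (auto simp: a lin.add [symmetric])
      show "a i (c *s y) = c * a i y" if "y \<in> ?V"
        using that by (auto simp: a lin.scale [symmetric] algebra_simps)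
      show "a i y = 0" if "y \<notin> ?V" using that by (simp add: a_def)
    qed
    show "y = 0" if y: "y \<in> ?V" and eq: "\<And>i j. i \<in> UNIV \<Longrightarrow> j \<in> UNIV \<Longrightarrow> a i y = a j y" for y
    proof -
      obtain x where x: "y = \<pi> x" using y by blast
      have "x $ i = x $ i1" for i using eq[of i i1] by (simp add: x a)
      then have "x = x $ i1 *s (\<chi> i. 1)" by (simp add: vec_eq_iff)
      then show ?thesis using ker x by blast
    qed
    show "\<exists>x\<in>?V. (\<forall>i\<in>UNIV. \<forall>j\<in>UNIV. a i x - a j x = c i - c j) \<and> (\<forall>k\<in>{}. (0 :: 'k fn) x = d k)"
      for c d
      by (intro bexI[of _ "\<pi> (\<chi> i. c i)"]) (auto simp: a)
  qed auto
  have hyp: "hyp \<pi> i j = bhyp ?V a i j" for i j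
    by (auto simp: hyp_def bhyp_def a)
  define \<mu> where "\<mu> i j = (if i = i1 \<or> j = i1 then m + q else m)" for i j
  have A: "braid_arr ?V UNIV a \<mu> ?A"
  proof -
    let ?S1 = "{hyp \<pi> i1 j | j. j \<noteq> i1}" and ?S2 = "{hyp \<pi> i j | i j. i \<noteq> i1 \<and> j \<noteq> i1 \<and> i \<noteq> j}"
    have fin: "finite ?S1" "finite ?S2"
      by (rule finite_subset[of _ "(\<lambda>(i, j). hyp \<pi> i j) ` UNIV"]; auto)+
    have eq: "bhyp ?V a i j = bhyp ?V a k r \<longleftrightarrow> {i, j} = {k, r}" if "i \<noteq> j" "k \<noteq> r" for i j k r
      using B.bhyp_eq_iff[of i j k r] that B.bhyp_sym by (auto simp: doubleton_eq_iff)
    have S1: "bhyp ?V a i j \<in> ?S1 \<longleftrightarrow> i = i1 \<or> j = i1" if ij: "i \<noteq> j" for i j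
    proof
      assume "bhyp ?V a i j \<in> ?S1"
      then obtain r where "r \<noteq> i1" "bhyp ?V a i j = bhyp ?V a i1 r" unfolding hyp by blast
      then have "{i, j} = {i1, r}" using eq[OF ij, of i1 r] by auto
      then show "i = i1 \<or> j = i1" by (auto simp: doubleton_eq_iff)
    next
      assume "i = i1 \<or> j = i1"
      then show "bhyp ?V a i j \<in> ?S1" unfolding hyp using ij B.bhyp_sym[of i j] by blast
    qed
    have S2: "bhyp ?V a i j \<in> ?S2 \<longleftrightarrow> i \<noteq> i1 \<and> j \<noteq> i1" if ij: "i \<noteq> j" for i j
    proof
      assume "bhyp ?V a i j \<in> ?S2"
      then obtain k r where "k \<noteq> i1" "r \<noteq> i1" "k \<noteq> r" "bhyp ?V a i j = bhyp ?V a k r"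
        unfolding hyp by blast
      then have "{i, j} = {k, r}" "k \<noteq> i1" "r \<noteq> i1" using eq[OF ij, of k r] by auto
      then show "i \<noteq> i1 \<and> j \<noteq> i1" by (auto simp: doubleton_eq_iff)
    next
      assume "i \<noteq> i1 \<and> j \<noteq> i1"
      then show "bhyp ?V a i j \<in> ?S2" unfolding hyp using ij by blast
    qed
    have cnt: "count ?A X = (if X \<in> ?S1 then m + q else 0) + (if X \<in> ?S2 then m else 0)" for X
      unfolding type_A_mult_def by (simp add: count_sum_replicate[OF fin(1)] count_sum_replicate[OF fin(2)])
    show ?thesis
      unfolding braid_arr_def
    proof (intro conjI ballI impI)
      show "count ?A (bhyp ?V a i j) = \<mu> i j" if "i \<noteq> j" for i j
        unfolding cnt using S1[OF that] S2[OF that] by (simp add: \<mu>_def)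
      fix H assume "H \<in># ?A"
      then have "count ?A H > 0" by simp
      then have "H \<in> ?S1 \<union> ?S2" unfolding cnt by (auto split: if_splits)
      then show "\<exists>i\<in>UNIV. \<exists>j\<in>UNIV. i \<noteq> j \<and> H = bhyp ?V a i j" by (auto simp: hyp) metis
    qed
  qed
  \<comment> \<open>Every pair receives twice \<open>m div 2\<close>, the graph adds the missing 1
    for odd \<open>m\<close>, and the extra \<open>q\<close> at \<open>i1\<close> reaches exactly
    the pairs that contain \<open>i1\<close>.\<close>
  define n where "n = (\<lambda>i. (m div 2) + (if i = i1 then q else 0))"
  define G :: "'l \<Rightarrow> 'l \<Rightarrow> bool" where "G = (\<lambda>_ _. odd m)"
  have \<mu>: "\<mu> b c = n b + n c + of_bool (G b c)" if "b \<noteq> c" for b c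
    using that by (auto simp: \<mu>_def n_def G_def elim!: evenE oddE)
  obtain \<rho>0 :: "'l \<Rightarrow> nat" where \<rho>0: "bij_betw \<rho>0 UNIV {0..<l}"
    using ex_bij_betw_finite_nat[of "UNIV :: 'l set"] assms(1) by auto
  have elim: "perfect_elim UNIV G \<rho>0"
    using \<rho>0 by (auto simp: perfect_elim_def bij_betw_def G_def later_def)
  have inj: "inj \<rho>0" and range: "range \<rho>0 = {0..<l}" using \<rho>0 by (simp_all add: bij_betw_def)
  have lt: "\<rho>0 u < l" for u using range by (metis atLeastLessThan_iff rangeI)
  have "l - 1 \<in> range \<rho>0" unfolding range using assms(2) by simp
  then obtain z where z: "\<rho>0 z = l - 1" by (metis rangeE)
  have zmax: "\<rho>0 u \<le> \<rho>0 z" for u using lt[of u] z by simp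
  have N: "(\<Sum>s\<in>UNIV. n s) = l * (m div 2) + q"
    using assms(1) by (simp add: n_def sum.distrib)
  have free: "inductively_free ?V ?A"
    using chordal_inductively_free[OF B.ess_braid_axioms elim A \<mu>] by blast
  have ex: "has_exponents ?V ?A (image_mset (\<lambda>u. (\<Sum>s\<in>UNIV. n s) + card (later UNIV G \<rho>0 u)) (mset_set (UNIV - {z})))"
    by (rule B.chordal_exponents[OF elim _ _ A]) (auto simp: zmax \<mu>)
  have cardz: "card (UNIV - {z}) = l - 1" using assms(1) by (simp add: card_Diff_singleton)
  have even: "image_mset (\<lambda>u. (\<Sum>s\<in>UNIV. n s) + card (later UNIV G \<rho>0 u)) (mset_set (UNIV - {z})) =
      replicate_mset (l - 1) (m * l div 2 + q)" if "even m"
  proof -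
    have "later UNIV G \<rho>0 u = {}" for u using that by (simp add: later_def G_def)
    then have "(\<Sum>s\<in>UNIV. n s) + card (later UNIV G \<rho>0 u) = m * l div 2 + q" for u
      using that by (auto simp: N elim!: evenE)
    then show ?thesis using cardz by (simp add: image_mset_const_eq)
  qed
  have odd: "image_mset (\<lambda>u. (\<Sum>s\<in>UNIV. n s) + card (later UNIV G \<rho>0 u)) (mset_set (UNIV - {z})) =
      image_mset (\<lambda>k. (m - 1) * l div 2 + k + q) (mset_set {1..l - 1})" if m: "odd m"
  proof -
    have card_later: "card (later UNIV G \<rho>0 u) = l - 1 - \<rho>0 u" for u
    proof -
      have "later UNIV G \<rho>0 u = {w. \<rho>0 u < \<rho>0 w}" using m by (simp add: later_def G_def)
      moreover have "\<rho>0 ` {w. \<rho>0 u < \<rho>0 w} = {Suc (\<rho>0 u)..<l}"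
      proof (intro equalityI subsetI)
        fix k assume k: "k \<in> {Suc (\<rho>0 u)..<l}"
        then have "k \<in> range \<rho>0" unfolding range by simp
        then show "k \<in> \<rho>0 ` {w. \<rho>0 u < \<rho>0 w}" using k by auto
      qed (use lt in auto)
      ultimately have "card (later UNIV G \<rho>0 u) = card {Suc (\<rho>0 u)..<l}"
        using inj by (metis card_image inj_on_subset subset_UNIV)
      then show ?thesis by simp
    qed
    \<comment> \<open>In the complete graph the number of later neighbours reverses the rank;
      leaving out the last vertex \<open>z\<close> leaves out the value 0.\<close>
    have bij: "bij_betw (\<lambda>u. l - 1 - \<rho>0 u) (UNIV - {z}) {1..l - 1}"
    proof -
      have "bij_betw \<rho>0 (UNIV - {z}) ({0..<l} - {l - 1})"
        using inj range z by (auto simp: bij_betw_def inj_on_def image_set_diff)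
      moreover have "bij_betw (\<lambda>k. l - 1 - k) ({0..<l} - {l - 1}) {1..l - 1}"
        by (rule bij_betw_byWitness[where f' = "\<lambda>k. l - 1 - k"]) (use assms(2) in auto)
      ultimately show ?thesis using bij_betw_trans by (fastforce simp: comp_def)
    qed
    have "image_mset (\<lambda>k. (m - 1) * l div 2 + k + q) (mset_set {1..l - 1}) =
        image_mset (\<lambda>k. (m - 1) * l div 2 + k + q) (image_mset (\<lambda>u. l - 1 - \<rho>0 u) (mset_set (UNIV - {z})))"
      using bij by (simp add: image_mset_mset_set bij_betw_def)
    also have "\<dots> = image_mset (\<lambda>u. (\<Sum>s\<in>UNIV. n s) + card (later UNIV G \<rho>0 u)) (mset_set (UNIV - {z}))"
      unfolding image_mset.compositionality using m
      by (intro image_mset_cong) (auto simp: card_later N elim!: oddE)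
    finally show ?thesis by simp
  qed
  show ?thesis using free ex even odd by auto
qed

end
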